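(* Let $k\ge 3$, $0\le\alpha<1$, and let $m,d$ be integers with $4\le d\le m-2$. If $G\in NC(m,d)$, then $$\rho_\alpha(G)\le \max\{\rho_\alpha(H_1(m,d)),\rho_\alpha(H_2(m,d))\}.$$ Equality holds if and only if $G\cong H_1(m,d)$ or $G\cong H_2(m,d)$.
   Context: A $k$-uniform hypergraph $G=(V(G),E(G))$ has a finite vertex set and an edge set that is a collection of $k$-subsets of $V(G)$ (no repeated edges). The degree of a vertex is the number of edges containing it. An edge is a pendant edge if all its vertices, except at most one, have degree one. A supertree is a hypergraph that is connected and acyclic (no cycle $v_1e_1v_2e_2\dots v_\ell e_\ell v_1$ with $\ell\ge2$, distinct vertices $v_i$ and distinct edges $e_i$, $v_i,v_{i+1}\in e_i$, indices mod $\ell$). Distance is the least number of edges in a path joining two vertices, and the diameter is the maximum distance. A loose path of length $d$ is a hypergraph consisting of distinct edges $e_1,\dots,e_d$ with $|e_i\cap e_j|=1$ if $|i-j|=1$ and $e_i\cap e_j=\varnothing$ if $|i-j|\ge2$. A supertree is a caterpillar if removing all its pendant edges (and the vertices that thereby become isolated) leaves a loose path (possibly trivial, i.e. with no edges); otherwise it is a non-caterpillar. $NC(m,d)$ is the set of $k$-uniform non-caterpillar supertrees with $m$ edges and diameter $d$; it can be nonempty only if $m\ge6$ and $4\le d\le m-2$. The $k$-th power of a simple graph is the $k$-uniform hypergraph obtained by adding $k-2$ new vertices (of degree one) to each edge. The double star $S(s,t)$ is the tree obtained from a single edge by attaching $s$ pendant edges to one end and $t$ pendant edges to the other end. For positive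 integers $a,b$ with $a+b=d$, $T(s,t;a,b)$ is the tree obtained from $S(s,t)$ by attaching two paths, of lengths $a$ and $b$, at the central vertex that carries the $t$ pendant edges (the central vertex of degree $t+1$ in $S(s,t)$); $T^k(s,t;a,b)$ is its $k$-th power. Set $$H_1(m,d)=T^k(1,m-d-2;\lfloor d/2\rfloor,d-\lfloor d/2\rfloor),\qquad H_2(m,d)=T^k(m-d-1,0;\lfloor d/2\rfloor,d-\lfloor d/2\rfloor).$$ Spectral notation: with $V(G)=\{1,\dots,n\}$, $\mathcal A_\alpha(G)=\alpha\mathcal D(G)+(1-\alpha)\mathcal A(G)$, where $\mathcal D(G)$ is the diagonal tensor of order $k$ and dimension $n$ of vertex degrees and $\mathcal A(G)$ is the adjacency tensor with entries $a_{i_1\dots i_k}=\frac1{(k-1)!}$ if $\{i_1,\dots,i_k\}\in E(G)$ and $0$ otherwise; equivalently $(\mathcal A_\alpha(G)\boldsymbol x)_v=\alpha d_vx_v^{k-1}+(1-\alpha)\sum_{e\ni v}\prod_{w\in e\setminus\{v\}}x_w$, $d_v$ the degree of $v$. An eigenvalue is $\lambda\in\mathbb C$ with $\mathcal A_\alpha(G)\boldsymbol x=\lambda (x_i^{k-1})_i$ for some nonzero $\boldsymbol x\in\mathbb C^n$. The $\alpha$-spectral radius $\rho_\alpha(G)$ is the largest modulus of an eigenvalue of $\mathcal A_\alpha(G)$.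
   Formalization: Equality is shown to hold iff G is isomorphic to an H_i whose spectral radius attains the maximum of the two; the literal "G≅H_1 or G≅H_2" fails when the radii differ (k=3, α=0, m=7, d=4, G=H_2). *)

theory Defs
  imports Complex_Main
begin

section \<open>Uniform hypergraphs\<close>

datatype 'a hypergraph = Hypergraph (verts: "'a set") (edges: "'a set set")

definition uniform :: "nat \<Rightarrow> 'a hypergraph \<Rightarrow> bool" where
  "uniform k G \<longleftrightarrow> finite (verts G) \<and> (\<forall>e\<in>edges G. e \<subseteq> verts G \<and> card e = k)"

definition hdegree :: "'a hypergraph \<Rightarrow> 'a \<Rightarrow> nat" where
  "hdegree G v = card {e \<in> edges G. v \<in> e}"

definition hiso :: "'a hypergraph \<Rightarrow> 'b hypergraph \<Rightarrow> bool" (infix "\<cong>\<^sub>h" 50) where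
  "G \<cong>\<^sub>h H \<longleftrightarrow> (\<exists>f. bij_betw f (verts G) (verts H) \<and> edges H = (\<lambda>e. f ` e) ` edges G)"

text \<open>
  A path of length \<open>length es\<close> is an alternating sequence
  \<open>vs!0, es!0, vs!1, \<dots>, es!(l-1), vs!l\<close> of distinct vertices and distinct edges;
  the path of length 0 from a vertex to itself is allowed.
\<close>
definition hpath :: "'a hypergraph \<Rightarrow> 'a \<Rightarrow> 'a list \<Rightarrow> 'a set list \<Rightarrow> 'a \<Rightarrow> bool" where
  "hpath G u vs es v \<longleftrightarrow>
     length vs = length es + 1 \<and> distinct vs \<and> distinct es \<and>
     set vs \<subseteq> verts G \<and> set es \<subseteq> edges G \<and> hd vs = u \<and> last vs = v \<and>
     (\<forall>i<length es. vs ! i \<in> es ! i \<and> vs ! Suc i \<in> es ! i)"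

definition hcycle :: "'a hypergraph \<Rightarrow> 'a list \<Rightarrow> 'a set list \<Rightarrow> bool" where
  "hcycle G vs es \<longleftrightarrow>
     length es \<ge> 2 \<and> length vs = length es \<and> distinct vs \<and> distinct es \<and>
     set vs \<subseteq> verts G \<and> set es \<subseteq> edges G \<and>
     (\<forall>i<length es. vs ! i \<in> es ! i \<and> vs ! (Suc i mod length es) \<in> es ! i)"

definition hconnected :: "'a hypergraph \<Rightarrow> bool" where
  "hconnected G \<longleftrightarrow> (\<forall>u\<in>verts G. \<forall>v\<in>verts G. \<exists>vs es. hpath G u vs es v)"

definition hacyclic :: "'a hypergraph \<Rightarrow> bool" where
  "hacyclic G \<longleftrightarrow> (\<nexists>vs es. hcycle G vs es)"

definition supertree :: "'a hypergraph \<Rightarrow> bool" where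
  "supertree G \<longleftrightarrow> hconnected G \<and> hacyclic G"

definition hdist :: "'a hypergraph \<Rightarrow> 'a \<Rightarrow> 'a \<Rightarrow> nat" where
  "hdist G u v = (LEAST l. \<exists>vs es. hpath G u vs es v \<and> length es = l)"

definition hdiameter :: "'a hypergraph \<Rightarrow> nat" where
  "hdiameter G = Max {hdist G u v | u v. u \<in> verts G \<and> v \<in> verts G}"


section \<open>Caterpillars and non-caterpillars\<close>

definition pendant_edge :: "'a hypergraph \<Rightarrow> 'a set \<Rightarrow> bool" where
  "pendant_edge G e \<longleftrightarrow> e \<in> edges G \<and> (\<exists>u. \<forall>v\<in>e - {u}. hdegree G v = 1)"

definition remove_pendant_edges :: "'a hypergraph \<Rightarrow> 'a hypergraph" where
  "remove_pendant_edges G =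
     (let P = {e. pendant_edge G e}; E' = edges G - P
      in Hypergraph (verts G - (\<Union>P - \<Union>E')) E')"

text \<open>
  A trivial loose path has no edges; it may consist of a single vertex or be empty
  (the latter is what is left when every edge is pendant and all vertices become isolated).
\<close>
definition loose_path :: "'a hypergraph \<Rightarrow> bool" where
  "loose_path G \<longleftrightarrow>
     (\<exists>es. distinct es \<and> set es = edges G \<and>
        (if es = [] then card (verts G) \<le> 1 else verts G = \<Union>(set es)) \<and>
        (\<forall>i<length es. \<forall>j<length es.
           (j = Suc i \<longrightarrow> card (es ! i \<inter> es ! j) = 1) \<and>
           (j > Suc i \<longrightarrow> es ! i \<inter> es ! j = {})))"

definition caterpillar :: "'a hypergraph \<Rightarrow> bool" where
  "caterpillar G \<longleftrightarrow> supertree G \<and> loose_path (remove_pendant_edges G)"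

definition NC :: "nat \<Rightarrow> nat \<Rightarrow> nat \<Rightarrow> 'a hypergraph set" where
  "NC k m d = {G. uniform k G \<and> supertree G \<and> \<not> caterpillar G \<and>
                  card (edges G) = m \<and> hdiameter G = d}"


section \<open>The extremal hypergraphs\<close>

text \<open>
  A simple graph is a 2-uniform hypergraph. In its \<open>k\<close>-th power, \<open>Inr (e, i)\<close> with
  \<open>i < k - 2\<close> are the new vertices added to the edge \<open>e\<close>.
\<close>
definition hpower :: "nat \<Rightarrow> 'a hypergraph \<Rightarrow> ('a + 'a set \<times> nat) hypergraph" where
  "hpower k G = Hypergraph
     (Inl ` verts G \<union> Inr ` (edges G \<times> {..<k - 2}))
     ((\<lambda>e. Inl ` e \<union> (\<lambda>i. Inr (e, i)) ` {..<k - 2}) ` edges G)"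

text \<open>
  Vertices of \<open>T(s,t;a,b)\<close>: the two centres \<open>CentreS\<close>, \<open>CentreT\<close> of the double star, the
  leaves \<open>LeafS i\<close> (\<open>i < s\<close>) at \<open>CentreS\<close> and \<open>LeafT i\<close> (\<open>i < t\<close>) at \<open>CentreT\<close>, and the
  vertices \<open>ArmA i\<close> (\<open>i < a\<close>) and \<open>ArmB i\<close> (\<open>i < b\<close>) of the paths attached at \<open>CentreT\<close>,
  at distance \<open>i + 1\<close> from it.
\<close>
datatype tvertex = CentreS | CentreT | LeafS nat | LeafT nat | ArmA nat | ArmB nat

definition double_star :: "nat \<Rightarrow> nat \<Rightarrow> tvertex hypergraph" where
  "double_star s t = Hypergraph
     ({CentreS, CentreT} \<union> LeafS ` {..<s} \<union> LeafT ` {..<t})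
     ({{CentreS, CentreT}} \<union> {{CentreS, LeafS i} | i. i < s} \<union> {{CentreT, LeafT i} | i. i < t})"

definition attach_path ::
    "'a \<Rightarrow> (nat \<Rightarrow> 'a) \<Rightarrow> nat \<Rightarrow> 'a hypergraph \<Rightarrow> 'a hypergraph" where
  "attach_path c p l G = Hypergraph
     (verts G \<union> p ` {..<l})
     (edges G \<union> {{case_nat c p i, p i} | i. i < l})"

definition T_tree :: "nat \<Rightarrow> nat \<Rightarrow> nat \<Rightarrow> nat \<Rightarrow> tvertex hypergraph" where
  "T_tree s t a b =
     attach_path CentreT ArmA a (attach_path CentreT ArmB b (double_star s t))"

type_synonym ptvertex = "tvertex + tvertex set \<times> nat"

definition H1 :: "nat \<Rightarrow> nat \<Rightarrow> nat \<Rightarrow> ptvertex hypergraph" where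
  "H1 k m d = hpower k (T_tree 1 (m - d - 2) (d div 2) (d - d div 2))"

definition H2 :: "nat \<Rightarrow> nat \<Rightarrow> nat \<Rightarrow> ptvertex hypergraph" where
  "H2 k m d = hpower k (T_tree (m - d - 1) 0 (d div 2) (d - d div 2))"


section \<open>Tensors and the \<open>\<alpha>\<close>-spectral radius\<close>

text \<open>
  A tensor of order \<open>k\<close> with index set \<open>V\<close> is represented by its entries at the index tuples,
  i.e. at the lists of length \<open>k\<close> over \<open>V\<close>; values at other lists are irrelevant.
\<close>
type_synonym 'a tensor = "'a list \<Rightarrow> real"

definition adjacency_tensor :: "nat \<Rightarrow> 'a hypergraph \<Rightarrow> 'a tensor" where
  "adjacency_tensor k G is = (if set is \<in> edges G then 1 / fact (k - 1) else 0)"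

definition degree_tensor :: "'a hypergraph \<Rightarrow> 'a tensor" where
  "degree_tensor G is = (if \<exists>v. set is = {v} then real (hdegree G (hd is)) else 0)"

definition alpha_tensor :: "nat \<Rightarrow> real \<Rightarrow> 'a hypergraph \<Rightarrow> 'a tensor" where
  "alpha_tensor k \<alpha> G is = \<alpha> * degree_tensor G is + (1 - \<alpha>) * adjacency_tensor k G is"

definition tensor_apply :: "nat \<Rightarrow> 'a set \<Rightarrow> 'a tensor \<Rightarrow> ('a \<Rightarrow> complex) \<Rightarrow> 'a \<Rightarrow> complex" where
  "tensor_apply k V T x v =
     (\<Sum>is | set is \<subseteq> V \<and> length is = k - 1. of_real (T (v # is)) * (\<Prod>w\<leftarrow>is. x w))"

definition tensor_eigenvalue :: "nat \<Rightarrow> 'a set \<Rightarrow> 'a tensor \<Rightarrow> complex \<Rightarrow> bool" where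
  "tensor_eigenvalue k V T \<mu> \<longleftrightarrow>
     (\<exists>x. (\<exists>v\<in>V. x v \<noteq> 0) \<and> (\<forall>v\<in>V. tensor_apply k V T x v = \<mu> * x v ^ (k - 1)))"

text \<open>
  For a tensor on a nonempty finite index set the set of moduli is nonempty and compact, so the
  supremum is the largest modulus of an eigenvalue.
\<close>
definition alpha_spectral_radius :: "nat \<Rightarrow> real \<Rightarrow> 'a hypergraph \<Rightarrow> real" where
  "alpha_spectral_radius k \<alpha> G =
     Sup {cmod \<mu> | \<mu>. tensor_eigenvalue k (verts G) (alpha_tensor k \<alpha> G) \<mu>}"

end

theory Submission
  imports Defs "HOL-Analysis.Analysis" "HOL-Combinatorics.Multiset_Permutations" "HOL-Library.Disjoint_Sets"
begin

text \<open>
  The spectral radius is the maximum of the form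
  \<open>\<Sum>e. (\<alpha> * (\<Sum>v\<in>e. x v ^ k) + (1 - \<alpha>) * k * (\<Prod>v\<in>e. x v))\<close> over nonnegative \<open>x\<close> with
  \<open>(\<Sum>v. x v ^ k) = 1\<close>, and for a connected hypergraph the maximiser \<open>x\<close> is a positive eigenvector.
  Hence replacing vertices of edges by vertices of larger weight increases the spectral radius,
  strictly if some vertex only gains edges.

  Given a non-caterpillar with diametral path \<open>P\<close>, let \<open>M\<close> be a vertex of maximal weight among those
  of degree at least two, and in every edge outside \<open>P\<close> replace the vertex closest to \<open>M\<close> by \<open>M\<close>
  itself. If \<open>M\<close> lies on \<open>P\<close>, one edge that does not meet \<open>P\<close> is left alone. After rerouting \<open>P\<close>
  or the edge joining it to \<open>M\<close> around a vertex of \<open>P\<close> that is not a joint of \<open>P\<close>, the result is some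
  \<open>T\<^sup>k(s,t;a,b)\<close> with \<open>a + b = d\<close> and \<open>s + t = m - d - 1\<close>.

  For these, divide the eigenvector equation at \<open>v\<close> by \<open>x v ^ k\<close>. The share of each edge is then
  determined by the branch below it, so that the radius \<open>l\<close> solves
  \<open>\<phi> (s * \<phi> 0) + t * \<phi> 0 + f a + f b = l\<close> with \<open>\<phi> y = \<alpha> + C / (l - \<alpha> - y)\<close>, \<open>f 0 = 0\<close> and
  \<open>f (n + 1) = \<phi> (f n)\<close>. Convexity of \<open>\<phi>\<close> forces \<open>s = 1\<close> or \<open>t = 0\<close>, and concavity of \<open>f\<close> balances
  the arms.
\<close>

section \<open>The variational characterisation of the spectral radius\<close>

text \<open>Maximality of \<open>M\<close> among vertices of degree at least two is enough: the
  vertex of an edge closest to \<open>M\<close>, unless it is \<open>M\<close> itself, is entered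
  through a second edge, so it competes with \<open>M\<close>. If \<open>M\<close> lies on
  \<open>P\<close>, moving every edge to \<open>M\<close> would produce a caterpillar; the edge left
  alone exists precisely because the hypergraph is no caterpillar, and it keeps
  \<open>s \<ge> 1\<close>. Its own link to the rest becomes the central edge of the double star.

  Radii of different trees are not compared by a direct computation. The constant
  \<open>C = (1 - \<alpha>) ^ k / (l - \<alpha>) ^ (k - 2)\<close> falls as \<open>l\<close> grows,
  so a tree of radius at most \<open>l\<close> has total centre share at most \<open>l\<close> when
  evaluated at \<open>l\<close>. If \<open>H1\<close> and \<open>H2\<close> both have radius at most
  the radius \<open>l\<close> of some tree \<open>T\<close>, all three can thus be evaluated at the
  same \<open>l\<close>, where convexity in \<open>s\<close> and concavity along the arms force
  \<open>T\<close> to be one of the two. This single implication yields both the bound and the case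
  of equality.\<close>

lemma lists_with_head_eq_permutations:
  assumes "v \<in> e" "finite e" "e \<subseteq> V"
  shows "{is. set is \<subseteq> V \<and> length is = card e - 1 \<and> set (v # is) = e} = permutations_of_set (e - {v})"
proof (intro set_eqI iffI)
  fix l assume "l \<in> {is. set is \<subseteq> V \<and> length is = card e - 1 \<and> set (v # is) = e}"
  then have l: "length l = card e - 1" "insert v (set l) = e" by auto
  then have "card (set (v # l)) = length (v # l)"
    using assms card_gt_0_iff[of e] by auto
  then have "distinct (v # l)" by (rule card_distinct)
  then show "l \<in> permutations_of_set (e - {v})"
    using l by (auto simp: permutations_of_set_def)
next
  fix l assume "l \<in> permutations_of_set (e - {v})"
  then have "set l = e - {v}" "distinct l" by (auto simp: permutations_of_set_def)
  then show "l \<in> {is. set is \<subseteq> V \<and> length is = card e - 1 \<and> set (v # is) = e}"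
    using assms distinct_card[of l] by auto
qed

text \<open>For the degree part only the constant list survives. For the adjacency part an edge at
  \<open>v\<close> is met once for each ordering of its other vertices, and these
  \<open>(k - 1)!\<close> orderings cancel the factor in the adjacency tensor.\<close>

lemma tensor_apply_alpha_tensor:
  fixes x :: "'a \<Rightarrow> complex"
  assumes "uniform k G" "k \<ge> 1" "v \<in> verts G"
  shows "tensor_apply k (verts G) (alpha_tensor k \<alpha> G) x v =
    (\<Sum>e | e \<in> edges G \<and> v \<in> e. of_real \<alpha> * x v ^ (k - 1) + of_real (1 - \<alpha>) * (\<Prod>w\<in>e - {v}. x w))"
proof -
  let ?V = "verts G" and ?E = "edges G"
  let ?L = "{is. set is \<subseteq> ?V \<and> length is = k - 1}"
  have finV: "finite ?V" and E: "\<And>e. e \<in> ?E \<Longrightarrow> e \<subseteq> ?V \<and> card e = k"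
    using assms by (auto simp: uniform_def)
  have finE: "finite ?E" using finV E by (meson finite_Pow_iff finite_subset PowI subsetI)
  have finL: "finite ?L" using finite_lists_length_eq[OF finV] by simp
  have split: "tensor_apply k ?V (alpha_tensor k \<alpha> G) x v =
     of_real \<alpha> * (\<Sum>is\<in>?L. of_real (degree_tensor G (v # is)) * prod_list (map x is))
   + of_real (1 - \<alpha>) * (\<Sum>is\<in>?L. of_real (adjacency_tensor k G (v # is)) * prod_list (map x is))"
    unfolding tensor_apply_def alpha_tensor_def
    by (simp add: sum_distrib_left algebra_simps flip: sum.distrib)
  have D: "(\<Sum>is\<in>?L. of_real (degree_tensor G (v # is)) * prod_list (map x is)) =
      of_nat (hdegree G v) * x v ^ (k - 1)"
  proof -
    have eq: "(\<exists>u. set (v # is) = {u}) \<longleftrightarrow> is = replicate (k - 1) v" if "is \<in> ?L" for "is"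
    proof
      assume "\<exists>u. set (v # is) = {u}"
      then have "\<forall>w\<in>set is. w = v" by auto
      then show "is = replicate (k - 1) v" using that by (metis (mono_tags) mem_Collect_eq replicate_length_same)
    qed auto
    have "(\<Sum>is\<in>?L. of_real (degree_tensor G (v # is)) * prod_list (map x is)) =
      (\<Sum>is\<in>?L. if is = replicate (k - 1) v then of_nat (hdegree G v) * x v ^ (k - 1) else 0)"
      using eq by (intro sum.cong refl) (auto simp: degree_tensor_def prod_list_replicate)
    also have "\<dots> = of_nat (hdegree G v) * x v ^ (k - 1)"
      using assms finL by (auto simp: set_replicate_conv_if)
    finally show ?thesis .
  qed
  have A: "(\<Sum>is\<in>?L. of_real (adjacency_tensor k G (v # is)) * prod_list (map x is)) =
     (\<Sum>e | e \<in> ?E \<and> v \<in> e. \<Prod>w\<in>e - {v}. x w)"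
  proof -
    have "(\<Sum>is\<in>?L. of_real (adjacency_tensor k G (v # is)) * prod_list (map x is)) =
      (\<Sum>is | is \<in> ?L \<and> set (v # is) \<in> ?E. of_real (1 / fact (k - 1)) * prod_list (map x is))"
      using finL by (intro sum.mono_neutral_cong_right) (auto simp: adjacency_tensor_def)
    also have "\<dots> = (\<Sum>e | e \<in> ?E \<and> v \<in> e. \<Sum>is | is \<in> {is. is \<in> ?L \<and> set (v # is) \<in> ?E} \<and> set (v # is) = e.
       of_real (1 / fact (k - 1)) * prod_list (map x is))"
      using finL finE by (intro sum.group[symmetric]) (auto intro: finite_subset[OF _ finL])
    also have "\<dots> = (\<Sum>e | e \<in> ?E \<and> v \<in> e. \<Prod>w\<in>e - {v}. x w)"
    proof (intro sum.cong refl)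
      fix e assume "e \<in> {e. e \<in> ?E \<and> v \<in> e}"
      then have e: "e \<in> ?E" "v \<in> e" by auto
      have fe: "finite e" using E[OF e(1)] finV finite_subset by blast
      have set_eq: "{is. is \<in> {is. is \<in> ?L \<and> set (v # is) \<in> ?E} \<and> set (v # is) = e} = permutations_of_set (e - {v})"
        using lists_with_head_eq_permutations[of v e ?V] e E[OF e(1)] fe by auto
      have "(\<Sum>is\<in>permutations_of_set (e - {v}). of_real (1 / fact (k - 1)) * prod_list (map x is)) =
        (\<Sum>is\<in>permutations_of_set (e - {v}). of_real (1 / fact (k - 1)) * (\<Prod>w\<in>e - {v}. x w))"
      proof (intro sum.cong refl arg_cong2[where f = "(*)"])
        fix xs assume "xs \<in> permutations_of_set (e - {v})"
        then have "set xs = e - {v}" "distinct xs" by (simp_all add: permutations_of_set_def)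
        then show "prod_list (map x xs) = (\<Prod>w\<in>e - {v}. x w)"
          using prod.distinct_set_conv_list[of xs x] by simp
      qed
      also have "\<dots> = (\<Prod>w\<in>e - {v}. x w)"
        using e E[OF e(1)] fe by (simp add: card_Diff_singleton)
      finally show "(\<Sum>is | is \<in> {is. is \<in> ?L \<and> set (v # is) \<in> ?E} \<and> set (v # is) = e.
          of_real (1 / fact (k - 1)) * prod_list (map x is)) = (\<Prod>w\<in>e - {v}. x w)"
        unfolding set_eq .
    qed
    finally show ?thesis .
  qed
  have "(\<Sum>e | e \<in> ?E \<and> v \<in> e. of_real \<alpha> * x v ^ (k - 1) + of_real (1 - \<alpha>) * (\<Prod>w\<in>e - {v}. x w)) =
      of_real \<alpha> * (of_nat (hdegree G v) * x v ^ (k - 1))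
    + of_real (1 - \<alpha>) * (\<Sum>e | e \<in> ?E \<and> v \<in> e. \<Prod>w\<in>e - {v}. x w)"
    by (simp only: sum.distrib sum_constant hdegree_def sum_distrib_left mult_ac)
  then show ?thesis by (simp only: split D A)
qed

text \<open>Connectedness as a statement about cuts: no path has to be constructed for the modified
  hypergraphs, and the zero set of a maximiser is directly such a cut.\<close>

definition linked :: "'a hypergraph \<Rightarrow> bool" where
  "linked G \<longleftrightarrow>
     (\<forall>S. S \<subseteq> verts G \<and> S \<noteq> {} \<and> S \<noteq> verts G \<longrightarrow> (\<exists>e\<in>edges G. e \<inter> S \<noteq> {} \<and> e - S \<noteq> {}))"

text \<open>The factor \<open>k\<close> appears because the product of an edge is counted once at
  each of its \<open>k\<close> vertices.\<close>

definition alpha_form :: "nat \<Rightarrow> real \<Rightarrow> 'a hypergraph \<Rightarrow> ('a \<Rightarrow> real) \<Rightarrow> real" where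
  "alpha_form k \<alpha> G x =
     (\<Sum>e\<in>edges G. \<alpha> * (\<Sum>v\<in>e. x v ^ k) + (1 - \<alpha>) * real k * (\<Prod>v\<in>e. x v))"

text \<open>The usual equation at \<open>v\<close> is multiplied by \<open>x v\<close>, so that an
  edge contributes the same full product at all its vertices. Positivity is built in.\<close>

definition alpha_eigenvector :: "nat \<Rightarrow> real \<Rightarrow> 'a hypergraph \<Rightarrow> real \<Rightarrow> ('a \<Rightarrow> real) \<Rightarrow> bool" where
  "alpha_eigenvector k \<alpha> G l x \<longleftrightarrow>
     (\<forall>v\<in>verts G. 0 < x v \<and>
        (\<Sum>e | e \<in> edges G \<and> v \<in> e. \<alpha> * x v ^ k + (1 - \<alpha>) * (\<Prod>w\<in>e. x w)) = l * x v ^ k)"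

section \<open>Maximising the form over nonnegative vectors\<close>

locale uniform_hypergraph =
  fixes k :: nat and \<alpha> :: real and G :: "'a hypergraph"
  assumes uniform: "uniform k G" and k_ge_2: "k \<ge> 2" and alpha_nonneg: "0 \<le> \<alpha>" and alpha_less_1: "\<alpha> < 1"
begin

abbreviation "V \<equiv> verts G"
abbreviation "E \<equiv> edges G"
abbreviation "Q \<equiv> alpha_form k \<alpha> G"

lemma finite_V: "finite V" and edge_subset: "e \<in> E \<Longrightarrow> e \<subseteq> V" and card_edge: "e \<in> E \<Longrightarrow> card e = k"
  using uniform by (auto simp: uniform_def)

lemma finite_E: "finite E"
  using finite_V edge_subset by (meson finite_Pow_iff finite_subset PowI subsetI)

lemma finite_edge: "e \<in> E \<Longrightarrow> finite e"
  using finite_V edge_subset finite_subset by blast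

lemma alpha_form_eq_sum_verts:
  "Q x = (\<Sum>v\<in>V. \<Sum>e | e \<in> E \<and> v \<in> e. \<alpha> * x v ^ k + (1 - \<alpha>) * (\<Prod>w\<in>e. x w))"
proof -
  have "(\<Sum>v\<in>V. \<Sum>e | e \<in> E \<and> v \<in> e. \<alpha> * x v ^ k + (1 - \<alpha>) * (\<Prod>w\<in>e. x w))
    = (\<Sum>e\<in>E. \<Sum>v | v \<in> V \<and> v \<in> e. \<alpha> * x v ^ k + (1 - \<alpha>) * (\<Prod>w\<in>e. x w))"
    using finite_V finite_E by (rule sum.swap_restrict)
  also have "\<dots> = (\<Sum>e\<in>E. \<Sum>v\<in>e. \<alpha> * x v ^ k + (1 - \<alpha>) * (\<Prod>w\<in>e. x w))"
    using edge_subset by (intro sum.cong refl) auto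
  also have "\<dots> = Q x"
    unfolding alpha_form_def
    by (intro sum.cong refl) (simp add: sum.distrib sum_distrib_left card_edge)
  finally show ?thesis by simp
qed

lemma alpha_form_eigenvector:
  "alpha_eigenvector k \<alpha> G l x \<Longrightarrow> Q x = l * (\<Sum>v\<in>V. x v ^ k)"
  unfolding alpha_form_eq_sum_verts alpha_eigenvector_def sum_distrib_left by (intro sum.cong) auto

lemma alpha_form_nonneg: "(\<And>v. v \<in> V \<Longrightarrow> 0 \<le> x v) \<Longrightarrow> 0 \<le> Q x"
  unfolding alpha_form_def
  by (intro sum_nonneg add_nonneg_nonneg mult_nonneg_nonneg prod_nonneg zero_le_power)
     (use alpha_nonneg alpha_less_1 edge_subset in auto)

lemma alpha_form_cong: "(\<And>v. v \<in> V \<Longrightarrow> x v = y v) \<Longrightarrow> Q x = Q y"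
  unfolding alpha_form_def
proof (intro sum.cong refl)
  fix e assume *: "\<And>v. v \<in> V \<Longrightarrow> x v = y v" and "e \<in> E"
  then have "v \<in> e \<Longrightarrow> x v = y v" for v using edge_subset by blast
  then show "\<alpha> * (\<Sum>v\<in>e. x v ^ k) + (1 - \<alpha>) * real k * (\<Prod>v\<in>e. x v) =
    \<alpha> * (\<Sum>v\<in>e. y v ^ k) + (1 - \<alpha>) * real k * (\<Prod>v\<in>e. y v)" by simp
qed

lemma alpha_form_scale: "Q (\<lambda>v. c * x v) = c ^ k * Q x"
  unfolding alpha_form_def sum_distrib_left
  by (intro sum.cong refl)
     (simp add: power_mult_distrib prod.distrib card_edge sum_distrib_left algebra_simps)

text \<open>The normalised nonnegative vectors form a compact set, and homogeneity of degree
  \<open>k\<close> carries the bound over to all nonnegative vectors.\<close>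

lemma alpha_form_attains_max:
  assumes "V \<noteq> {}"
  obtains x l where "\<And>v. v \<in> V \<Longrightarrow> 0 \<le> x v" "(\<Sum>v\<in>V. x v ^ k) = 1" "Q x = l"
    "\<And>y. (\<And>v. v \<in> V \<Longrightarrow> 0 \<le> y v) \<Longrightarrow> Q y \<le> l * (\<Sum>v\<in>V. y v ^ k)"
proof -
  \<comment> \<open>The type of vertices may be infinite. Pinning the coordinates outside
    \<open>V\<close> to 0 makes the box a product of compact sets, hence compact by
    Tychonoff.\<close>
  let ?B = "PiE UNIV (\<lambda>v. if v \<in> V then {0..1::real} else {0})"
  let ?S = "?B \<inter> {x. (\<Sum>v\<in>V. x v ^ k) = 1}"
  have cB: "compact ?B"
  proof -
    have "compactin (product_topology (\<lambda>_. euclidean) UNIV) ?B"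
      by (subst compactin_PiE) auto
    then show ?thesis by (simp add: euclidean_product_topology)
  qed
  have cl: "closed {x :: 'a \<Rightarrow> real. (\<Sum>v\<in>V. x v ^ k) = 1}"
    by (intro closed_Collect_eq continuous_on_sum continuous_on_power continuous_on_const
        continuous_on_product_coordinates)
  have cS: "compact ?S" using cB cl by blast
  have coord: "continuous_on A (\<lambda>x :: 'a \<Rightarrow> real. x v)" for A v
    by (rule continuous_on_subset[OF continuous_on_product_coordinates]) simp
  have contQ: "continuous_on A Q" for A
    unfolding alpha_form_def
    by (intro continuous_on_sum continuous_on_add continuous_on_mult continuous_on_const continuous_on_power
        continuous_on_prod coord)
  obtain v0 where v0: "v0 \<in> V" using assms by blast
  have "(\<lambda>v. if v = v0 then 1 else 0) \<in> ?S"
  proof -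
    have "(\<Sum>v\<in>V. (if v = v0 then 1 else 0 :: real) ^ k) = (\<Sum>v\<in>V. if v = v0 then 1 else 0)"
      using k_ge_2 by (intro sum.cong) auto
    also have "\<dots> = 1" using v0 finite_V by simp
    finally show ?thesis using v0 by (auto simp: PiE_iff)
  qed
  then have "?S \<noteq> {}" by blast
  from continuous_attains_sup[OF cS this contQ]
  obtain x where x: "x \<in> ?S" "\<And>y. y \<in> ?S \<Longrightarrow> Q y \<le> Q x" by blast
  show thesis
  proof (rule that[of x "Q x"])
    have "\<forall>v. x v \<in> (if v \<in> V then {0..1} else {0})" using x(1) by (simp add: PiE_iff)
    then show "0 \<le> x v" if "v \<in> V" for v using that by (metis atLeastAtMost_iff)
    show "(\<Sum>v\<in>V. x v ^ k) = 1" using x(1) by auto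
    show "Q x = Q x" ..
    fix y :: "'a \<Rightarrow> real" assume y: "\<And>v. v \<in> V \<Longrightarrow> 0 \<le> y v"
    define s where "s = (\<Sum>v\<in>V. y v ^ k)"
    have s0: "s \<ge> 0" unfolding s_def using y by (intro sum_nonneg) auto
    show "Q y \<le> Q x * (\<Sum>v\<in>V. y v ^ k)"
    proof (cases "s = 0")
      case True
      then have "\<forall>v\<in>V. y v ^ k = 0"
        unfolding s_def using y finite_V by (subst (asm) sum_nonneg_eq_0_iff) auto
      then have "Q y = Q (\<lambda>v. 0 * y v)" by (intro alpha_form_cong) auto
      also have "\<dots> = 0" using alpha_form_scale[of 0 y] k_ge_2 by (simp add: zero_power)
      finally show ?thesis using True s_def by simp
    next
      case False
      \<comment> \<open>Division by the \<open>k\<close>-th root normalises \<open>y\<close>, since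
        the constraint is a sum of \<open>k\<close>-th powers.\<close>
      define r where "r = root k s"
      have r: "r > 0" "r ^ k = s" using False s0 k_ge_2 by (auto simp: r_def)
      let ?z = "\<lambda>v. if v \<in> V then (1 / r) * y v else 0"
      have z1: "(\<Sum>v\<in>V. ?z v ^ k) = 1"
        using r False by (simp add: power_mult_distrib power_divide sum_divide_distrib[symmetric] s_def[symmetric])
      have "?z v \<le> 1" if "v \<in> V" for v
      proof (rule ccontr)
        assume "\<not> ?z v \<le> 1"
        then have "1 < ?z v ^ k" using k_ge_2 by (intro one_less_power) auto
        also have "?z v ^ k \<le> (\<Sum>v\<in>V. ?z v ^ k)"
          using y r finite_V by (intro member_le_sum[OF that]) simp_all
        finally show False using z1 by simp
      qed
      moreover have "0 \<le> y v / r" if "v \<in> V" for v using y[OF that] r by simp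
      ultimately have "?z \<in> ?S" using z1 by (simp add: PiE_iff)
      then have "Q ?z \<le> Q x" by (rule x(2))
      also have "Q ?z = Q (\<lambda>v. (1 / r) * y v)" by (intro alpha_form_cong) auto
      also have "\<dots> = Q y / s" by (subst alpha_form_scale) (simp add: power_divide r)
      finally show ?thesis using s0 False by (simp add: divide_simps s_def split: if_splits)
    qed
  qed
qed

lemma alpha_form_update:
  assumes "v \<in> V"
  shows "Q (x(v := t)) = \<alpha> * real (card {e \<in> E. v \<in> e}) * t ^ k
    + (1 - \<alpha>) * real k * (\<Sum>e | e \<in> E \<and> v \<in> e. \<Prod>w\<in>e - {v}. x w) * t
    + (\<alpha> * (\<Sum>e | e \<in> E \<and> v \<in> e. \<Sum>u\<in>e - {v}. x u ^ k)
      + (\<Sum>e | e \<in> E \<and> v \<notin> e. \<alpha> * (\<Sum>u\<in>e. x u ^ k) + (1 - \<alpha>) * real k * (\<Prod>u\<in>e. x u)))"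
proof -
  let ?y = "x(v := t)"
  let ?w = "\<lambda>y e. \<alpha> * (\<Sum>v\<in>e. y v ^ k) + (1 - \<alpha>) * real k * (\<Prod>v\<in>e. y v)"
  have "E = {e \<in> E. v \<in> e} \<union> {e \<in> E. v \<notin> e}" by blast
  then have "Q ?y = (\<Sum>e | e \<in> E \<and> v \<in> e. ?w ?y e) + (\<Sum>e | e \<in> E \<and> v \<notin> e. ?w ?y e)"
    unfolding alpha_form_def using finite_E
    by (metis (no_types, lifting) sum.union_disjoint disjoint_iff finite_Un mem_Collect_eq)
  also have "(\<Sum>e | e \<in> E \<and> v \<notin> e. ?w ?y e) = (\<Sum>e | e \<in> E \<and> v \<notin> e. ?w x e)"
  proof (intro sum.cong refl)
    fix e assume "e \<in> {e \<in> E. v \<notin> e}"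
    then have "u \<in> e \<Longrightarrow> ?y u = x u" for u by auto
    then show "?w ?y e = ?w x e" by (simp cong: sum.cong prod.cong)
  qed
  also have "(\<Sum>e | e \<in> E \<and> v \<in> e. ?w ?y e) = (\<Sum>e | e \<in> E \<and> v \<in> e.
     \<alpha> * t ^ k + (\<alpha> * (\<Sum>u\<in>e - {v}. x u ^ k) + (1 - \<alpha>) * real k * t * (\<Prod>w\<in>e - {v}. x w)))"
  proof (intro sum.cong refl)
    fix e assume e: "e \<in> {e \<in> E. v \<in> e}"
    then have fe: "finite e" using finite_edge by auto
    have "(\<Sum>u\<in>e. ?y u ^ k) = t ^ k + (\<Sum>u\<in>e - {v}. ?y u ^ k)"
      using e fe by (simp add: sum.remove[of e v])
    moreover have "(\<Sum>u\<in>e - {v}. ?y u ^ k) = (\<Sum>u\<in>e - {v}. x u ^ k)" by (intro sum.cong) auto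
    moreover have "(\<Prod>u\<in>e. ?y u) = t * (\<Prod>u\<in>e - {v}. ?y u)"
      using e fe by (simp add: prod.remove[of e v])
    moreover have "(\<Prod>u\<in>e - {v}. ?y u) = (\<Prod>u\<in>e - {v}. x u)" by (intro prod.cong) auto
    ultimately show "?w ?y e = \<alpha> * t ^ k + (\<alpha> * (\<Sum>u\<in>e - {v}. x u ^ k) + (1 - \<alpha>) * real k * t * (\<Prod>w\<in>e - {v}. x w))"
      by (simp add: algebra_simps)
  qed
  also have "\<dots> = \<alpha> * real (card {e \<in> E. v \<in> e}) * t ^ k
      + (\<alpha> * (\<Sum>e | e \<in> E \<and> v \<in> e. \<Sum>u\<in>e - {v}. x u ^ k)
        + (1 - \<alpha>) * real k * t * (\<Sum>e | e \<in> E \<and> v \<in> e. \<Prod>w\<in>e - {v}. x w))"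
    by (simp only: sum.distrib sum_constant sum_distrib_left mult_ac)
  finally show ?thesis by (simp only: ac_simps)
qed

text \<open>Vary one coordinate only. As \<open>x v\<close> is positive, it is an interior maximum
  of the resulting one-variable polynomial, and the vanishing derivative is \<open>k\<close> times
  the eigenvector equation at \<open>v\<close>, up to a power of \<open>x v\<close>.\<close>

lemma maximiser_eigenvector:
  assumes pos: "\<And>v. v \<in> V \<Longrightarrow> 0 < x v"
    and eq: "Q x = l * (\<Sum>v\<in>V. x v ^ k)"
    and le: "\<And>y. (\<And>v. v \<in> V \<Longrightarrow> 0 \<le> y v) \<Longrightarrow> Q y \<le> l * (\<Sum>v\<in>V. y v ^ k)"
  shows "alpha_eigenvector k \<alpha> G l x"
  unfolding alpha_eigenvector_def
proof (intro ballI conjI)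
  fix v assume v: "v \<in> V"
  show "0 < x v" using pos v .
  define S where "S = (\<Sum>e | e \<in> E \<and> v \<in> e. \<Prod>w\<in>e - {v}. x w)"
  define d where "d = real (card {e \<in> E. v \<in> e})"
  define F where "F t = (\<alpha> * d - l) * t ^ k + (1 - \<alpha>) * real k * S * t" for t
  define R where "R = \<alpha> * (\<Sum>e | e \<in> E \<and> v \<in> e. \<Sum>u\<in>e - {v}. x u ^ k)
      + (\<Sum>e | e \<in> E \<and> v \<notin> e. \<alpha> * (\<Sum>u\<in>e. x u ^ k) + (1 - \<alpha>) * real k * (\<Prod>u\<in>e. x u))"
  define T where "T = (\<Sum>u\<in>V - {v}. x u ^ k)"
  define K where "K = R - l * T"
  have sum_update: "(\<Sum>u\<in>V. (x(v := t)) u ^ k) = t ^ k + T" for t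
    unfolding T_def by (subst sum.remove[OF finite_V v]) (auto intro!: sum.cong)
  have Q_update: "Q (x(v := t)) = \<alpha> * d * t ^ k + (1 - \<alpha>) * real k * S * t + R" for t
    unfolding d_def S_def R_def by (rule alpha_form_update[OF v])
  have K: "Q (x(v := t)) - l * (\<Sum>u\<in>V. (x(v := t)) u ^ k) = F t + K" for t
    unfolding sum_update Q_update F_def K_def by (simp add: algebra_simps)
  have K0: "F (x v) + K = 0" using K[of "x v"] eq by (simp only: fun_upd_triv)
  have Kle: "F t + K \<le> 0" if "t \<ge> 0" for t
  proof -
    have "0 \<le> (x(v := t)) u" if "u \<in> V" for u using pos[OF that] \<open>t \<ge> 0\<close> by simp
    then have "Q (x(v := t)) \<le> l * (\<Sum>u\<in>V. (x(v := t)) u ^ k)" by (intro le)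
    with K[of t] show ?thesis by linarith
  qed
  have "(F has_real_derivative (\<alpha> * d - l) * (real k * x v ^ (k - 1)) + (1 - \<alpha>) * real k * S) (at (x v))"
    unfolding F_def by (auto intro!: derivative_eq_intros)
  then have "(\<alpha> * d - l) * (real k * x v ^ (k - 1)) + (1 - \<alpha>) * real k * S = 0"
  proof (rule DERIV_local_max)
    show "0 < x v" by fact
    show "\<forall>y. \<bar>x v - y\<bar> < x v \<longrightarrow> F y \<le> F (x v)"
    proof (intro allI impI)
      fix y assume "\<bar>x v - y\<bar> < x v"
      then have "y \<ge> 0" by linarith
      from Kle[OF this] K0 show "F y \<le> F (x v)" by linarith
    qed
  qed
  then have "real k * ((\<alpha> * d - l) * x v ^ (k - 1) + (1 - \<alpha>) * S) = 0" by (simp add: algebra_simps)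
  then have *: "(\<alpha> * d - l) * x v ^ (k - 1) + (1 - \<alpha>) * S = 0" using k_ge_2 by simp
  have pk: "x v ^ k = x v * x v ^ (k - 1)" using k_ge_2 by (cases k) auto
  have "(\<Sum>e | e \<in> E \<and> v \<in> e. \<alpha> * x v ^ k + (1 - \<alpha>) * (\<Prod>w\<in>e. x w))
     = (\<Sum>e | e \<in> E \<and> v \<in> e. \<alpha> * x v ^ k + (1 - \<alpha>) * (x v * (\<Prod>w\<in>e - {v}. x w)))"
  proof (intro sum.cong refl)
    fix e assume "e \<in> {e \<in> E. v \<in> e}"
    then show "\<alpha> * x v ^ k + (1 - \<alpha>) * (\<Prod>w\<in>e. x w) = \<alpha> * x v ^ k + (1 - \<alpha>) * (x v * (\<Prod>w\<in>e - {v}. x w))"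
      using finite_edge by (simp add: prod.remove[of e v])
  qed
  also have "\<dots> = d * (\<alpha> * x v ^ k) + (1 - \<alpha>) * (x v * S)"
    unfolding S_def d_def by (simp only: sum.distrib sum_constant sum_distrib_left)
  also have "\<dots> = x v * ((\<alpha> * d - l) * x v ^ (k - 1) + (1 - \<alpha>) * S) + l * x v ^ k"
    unfolding pk by (simp add: algebra_simps)
  also have "\<dots> = l * x v ^ k" unfolding * by simp
  finally show "(\<Sum>e | e \<in> E \<and> v \<in> e. \<alpha> * x v ^ k + (1 - \<alpha>) * (\<Prod>w\<in>e. x w)) = l * x v ^ k" .
qed

text \<open>
  If a maximiser vanished somewhere, raising it to \<open>t\<close> on the zeros of an edge that also
  meets its support would gain at least a multiple of \<open>t ^ j\<close> with \<open>j < k\<close>, while the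
  \<open>k\<close>-th powers only cost a multiple of \<open>t ^ k\<close>.
\<close>
lemma maximiser_pos:
  assumes linked: "linked G"
    and nonneg: "\<And>v. v \<in> V \<Longrightarrow> 0 \<le> x v" and nonzero: "\<exists>v\<in>V. x v \<noteq> 0"
    and eq: "Q x = l * (\<Sum>v\<in>V. x v ^ k)"
    and le: "\<And>y. (\<And>v. v \<in> V \<Longrightarrow> 0 \<le> y v) \<Longrightarrow> Q y \<le> l * (\<Sum>v\<in>V. y v ^ k)"
    and v: "v \<in> V"
  shows "0 < x v"
proof (rule ccontr)
  assume "\<not> 0 < x v"
  then have "x v = 0" using nonneg v by force
  let ?Z = "{v \<in> V. x v = 0}"
  have "?Z \<subseteq> V" "?Z \<noteq> {}" "?Z \<noteq> V" using v \<open>x v = 0\<close> nonzero by auto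
  then obtain e where e: "e \<in> E" "e \<inter> ?Z \<noteq> {}" "e - ?Z \<noteq> {}"
    using linked unfolding linked_def by (metis (no_types, lifting))
  have fe: "finite e" using e finite_edge by blast
  define A where "A = e \<inter> ?Z"
  define j where "j = card A"
  have Ae: "A \<subseteq> e" "finite A" using fe by (auto simp: A_def)
  have "A \<subset> e" using e by (auto simp: A_def)
  then have jk: "j < k" using psubset_card_mono[OF fe] card_edge[OF e(1)] by (auto simp: j_def)
  define P where "P = (\<Prod>u\<in>e - A. x u)"
  have P: "P > 0" unfolding P_def
  proof (intro prod_pos)
    fix u assume "u \<in> e - A"
    then have "u \<in> V" "x u \<noteq> 0" using edge_subset[OF e(1)] by (auto simp: A_def)
    then show "0 < x u" using nonneg[of u] by simp
  qed
  define c where "c = (1 - \<alpha>) * real k * P"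
  have c: "c > 0" using P alpha_less_1 k_ge_2 by (simp add: c_def)
  define y where "y t u = (if u \<in> A then t else x u)" for t u
  have gain: "l * j * t ^ k \<ge> c * t ^ j" if t: "t \<ge> 0" for t
  proof -
    have ynn: "0 \<le> y t u" "x u \<le> y t u" if "u \<in> V" for u using nonneg[OF that] t by (auto simp: y_def A_def)
    have sumy: "(\<Sum>u\<in>V. y t u ^ k) = (\<Sum>u\<in>V. x u ^ k) + j * t ^ k"
    proof -
      have "(\<Sum>u\<in>V. y t u ^ k) = (\<Sum>u\<in>V. x u ^ k + (if u \<in> A then t ^ k else 0))"
        using k_ge_2 by (intro sum.cong refl) (auto simp: y_def A_def zero_power)
      also have "\<dots> = (\<Sum>u\<in>V. x u ^ k) + (\<Sum>u\<in>V \<inter> A. t ^ k)"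
        by (simp only: sum.distrib sum.inter_restrict[OF finite_V])
      also have "V \<inter> A = A" using edge_subset[OF e(1)] Ae by blast
      finally show ?thesis by (simp add: j_def)
    qed
    let ?w = "\<lambda>x e. \<alpha> * (\<Sum>v\<in>e. x v ^ k) + (1 - \<alpha>) * real k * (\<Prod>v\<in>e. x v)"
    have wmono: "?w x e' \<le> ?w (y t) e'" if "e' \<in> E" for e'
    proof -
      have *: "u \<in> e' \<Longrightarrow> 0 \<le> x u \<and> x u \<le> y t u" for u
        using edge_subset[OF that] ynn nonneg by blast
      show ?thesis using alpha_nonneg alpha_less_1 *
        by (intro add_mono mult_left_mono sum_mono power_mono prod_mono) auto
    qed
    have we: "?w x e + c * t ^ j \<le> ?w (y t) e"
    proof -
      have *: "u \<in> e \<Longrightarrow> 0 \<le> x u \<and> x u \<le> y t u" for u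
        using edge_subset[OF e(1)] ynn nonneg by blast
      obtain a where "a \<in> A" using e by (auto simp: A_def)
      then have px: "(\<Prod>u\<in>e. x u) = 0" using fe Ae by (auto simp: A_def)
      have "(\<Prod>u\<in>e. y t u) = (\<Prod>u\<in>A. y t u) * (\<Prod>u\<in>e - A. y t u)"
        using Ae fe by (metis prod.subset_diff mult.commute)
      also have "(\<Prod>u\<in>A. y t u) = t ^ j" by (simp add: y_def j_def)
      also have "(\<Prod>u\<in>e - A. y t u) = P" unfolding P_def by (intro prod.cong) (auto simp: y_def)
      finally have py: "(\<Prod>u\<in>e. y t u) = t ^ j * P" .
      have "\<alpha> * (\<Sum>v\<in>e. x v ^ k) \<le> \<alpha> * (\<Sum>v\<in>e. y t v ^ k)"
        using alpha_nonneg * by (intro mult_left_mono sum_mono power_mono) auto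
      then show ?thesis unfolding px py c_def by (simp add: algebra_simps)
    qed
    have "Q x + c * t ^ j = (\<Sum>e'\<in>E - {e}. ?w x e') + (?w x e + c * t ^ j)"
      unfolding alpha_form_def using finite_E e(1) by (simp add: sum.remove[of E e])
    also have "\<dots> \<le> (\<Sum>e'\<in>E - {e}. ?w (y t) e') + ?w (y t) e"
      by (rule add_mono[OF sum_mono we]) (use wmono in blast)
    also have "\<dots> = Q (y t)"
      unfolding alpha_form_def using finite_E e(1) by (simp add: sum.remove[of E e])
    also have "\<dots> \<le> l * (\<Sum>u\<in>V. y t u ^ k)" using ynn by (intro le) auto
    finally show ?thesis unfolding sumy eq by (simp add: algebra_simps)
  qed
  define B where "B = l * j"
  define q where "q = c / (\<bar>B\<bar> + 1)"
  \<comment> \<open>\<open>t < q\<close> makes the cost \<open>\<bar>B\<bar> * t\<close> smaller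
    than the gain \<open>c\<close>, and \<open>t < 1\<close> gives
    \<open>t ^ k \<le> t ^ Suc j\<close>. The absolute value is taken because the sign of
    \<open>l\<close> is not known here.\<close>
  define t where "t = min 1 q / 2"
  have t: "0 < t" "t < 1" "t < c / (\<bar>B\<bar> + 1)"
  proof -
    have "q > 0" unfolding q_def using c by (intro divide_pos_pos) auto
    then show "0 < t" "t < 1" "t < c / (\<bar>B\<bar> + 1)"
      unfolding q_def[symmetric] by (auto simp: t_def min_def)
  qed
  have "c * t ^ j \<le> B * t ^ k" using gain[of t] t by (simp add: B_def)
  also have "\<dots> \<le> \<bar>B\<bar> * t ^ Suc j"
  proof (intro mult_mono)
    show "t ^ k \<le> t ^ Suc j" using t jk by (intro power_decreasing) auto
  qed (use t in auto)
  finally have "t ^ j * c \<le> t ^ j * (\<bar>B\<bar> * t)" by (simp add: algebra_simps)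
  then have "c \<le> \<bar>B\<bar> * t" using t by (subst (asm) mult_le_cancel_left_pos) auto
  also have "\<dots> \<le> (\<bar>B\<bar> + 1) * t" using t by (simp add: algebra_simps)
  also have "\<dots> < c" using t(3) by (simp add: field_simps)
  finally show False by simp
qed

text \<open>
  Taking absolute values of a complex eigenvector bounds the modulus of its eigenvalue by the
  maximum of the form; the positive maximiser shows that this bound is attained.
\<close>
lemma alpha_spectral_radius_eigenvector:
  assumes "linked G" "V \<noteq> {}"
  obtains x where "alpha_eigenvector k \<alpha> G (alpha_spectral_radius k \<alpha> G) x"
    "\<And>y. (\<And>v. v \<in> V \<Longrightarrow> 0 \<le> y v) \<Longrightarrow> Q y \<le> alpha_spectral_radius k \<alpha> G * (\<Sum>v\<in>V. y v ^ k)"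
proof -
  obtain x l where
    nn: "\<And>v. v \<in> V \<Longrightarrow> 0 \<le> x v" and one: "(\<Sum>v\<in>V. x v ^ k) = 1" and Ql: "Q x = l"
    and le: "\<And>y. (\<And>v. v \<in> V \<Longrightarrow> 0 \<le> y v) \<Longrightarrow> Q y \<le> l * (\<Sum>v\<in>V. y v ^ k)"
    by (rule alpha_form_attains_max[OF assms(2)], rule that) (assumption | blast)+
  have eq: "Q x = l * (\<Sum>v\<in>V. x v ^ k)" using one Ql by simp
  have nz: "\<exists>v\<in>V. x v \<noteq> 0"
  proof (rule ccontr)
    assume "\<not> ?thesis"
    then have "(\<Sum>v\<in>V. x v ^ k) = 0" using k_ge_2 by (simp add: zero_power)
    then show False using one by simp
  qed
  have pos: "0 < x v" if "v \<in> V" for v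
    by (rule maximiser_pos[of x l]) (fact assms nn nz eq le that)+
  have ev: "alpha_eigenvector k \<alpha> G l x"
    by (rule maximiser_eigenvector) (fact pos eq le)+
  have l0: "0 \<le> l" using alpha_form_nonneg[of x] nn Ql by blast
  \<comment> \<open>The factor \<open>z v\<close> brings the tensor equation into the form used in
    \<open>alpha_eigenvector\<close>, for complex vectors as well.\<close>
  have tensor: "tensor_apply k V (alpha_tensor k \<alpha> G) z v * z v =
    (\<Sum>e | e \<in> E \<and> v \<in> e. of_real \<alpha> * z v ^ k + of_real (1 - \<alpha>) * (\<Prod>w\<in>e. z w))"
    if "v \<in> V" for z v
  proof -
    have "tensor_apply k V (alpha_tensor k \<alpha> G) z v * z v = (\<Sum>e | e \<in> E \<and> v \<in> e.
      (of_real \<alpha> * z v ^ (k - 1) + of_real (1 - \<alpha>) * (\<Prod>w\<in>e - {v}. z w)) * z v)"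
      using tensor_apply_alpha_tensor[OF uniform _ that] k_ge_2 by (simp add: sum_distrib_right)
    also have "\<dots> = (\<Sum>e | e \<in> E \<and> v \<in> e. of_real \<alpha> * z v ^ k + of_real (1 - \<alpha>) * (\<Prod>w\<in>e. z w))"
    proof (intro sum.cong refl)
      fix e assume e: "e \<in> {e \<in> E. v \<in> e}"
      then have "(\<Prod>w\<in>e. z w) = z v * (\<Prod>w\<in>e - {v}. z w)"
        using finite_edge by (simp add: prod.remove[of e v])
      moreover have "z v ^ k = z v ^ (k - 1) * z v" using k_ge_2 by (cases k) auto
      ultimately show "(of_real \<alpha> * z v ^ (k - 1) + of_real (1 - \<alpha>) * (\<Prod>w\<in>e - {v}. z w)) * z v
        = of_real \<alpha> * z v ^ k + of_real (1 - \<alpha>) * (\<Prod>w\<in>e. z w)"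
        by (simp add: algebra_simps)
    qed
    finally show ?thesis .
  qed
  have "tensor_eigenvalue k V (alpha_tensor k \<alpha> G) (of_real l)"
    unfolding tensor_eigenvalue_def
  proof (intro exI[of _ "\<lambda>v. complex_of_real (x v)"] conjI ballI)
    show "\<exists>v\<in>V. complex_of_real (x v) \<noteq> 0" using assms(2) pos by force
    fix v assume v: "v \<in> V"
    let ?z = "\<lambda>v. complex_of_real (x v)"
    have "tensor_apply k V (alpha_tensor k \<alpha> G) ?z v * ?z v =
      of_real (\<Sum>e | e \<in> E \<and> v \<in> e. \<alpha> * x v ^ k + (1 - \<alpha>) * (\<Prod>w\<in>e. x w))"
      by (subst tensor[OF v]) simp
    also have "\<dots> = of_real (l * x v ^ k)" using ev v unfolding alpha_eigenvector_def by simp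
    also have "\<dots> = of_real l * ?z v ^ (k - 1) * ?z v" using k_ge_2 by (cases k) auto
    finally show "tensor_apply k V (alpha_tensor k \<alpha> G) ?z v = of_real l * ?z v ^ (k - 1)"
      using pos[OF v] by simp
  qed
  moreover have "cmod \<mu> \<le> l" if "tensor_eigenvalue k V (alpha_tensor k \<alpha> G) \<mu>" for \<mu>
  proof -
    have "\<exists>z. (\<exists>v\<in>V. z v \<noteq> 0) \<and>
        (\<forall>v\<in>V. tensor_apply k V (alpha_tensor k \<alpha> G) z v = \<mu> * z v ^ (k - 1))"
      using that unfolding tensor_eigenvalue_def .
    then obtain z where z_ne: "\<exists>v\<in>V. z v \<noteq> 0" and
      z_all: "\<forall>v\<in>V. tensor_apply k V (alpha_tensor k \<alpha> G) z v = \<mu> * z v ^ (k - 1)"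
      by (elim exE conjE) (rule that)
    note z = z_ne bspec[OF z_all]
    let ?y = "\<lambda>v. cmod (z v)"
    have "cmod \<mu> * (\<Sum>v\<in>V. ?y v ^ k) = (\<Sum>v\<in>V. cmod (\<mu> * z v ^ k))"
      by (simp add: sum_distrib_left norm_mult norm_power)
    also have "\<dots> = (\<Sum>v\<in>V. cmod (\<Sum>e | e \<in> E \<and> v \<in> e. of_real \<alpha> * z v ^ k + of_real (1 - \<alpha>) * (\<Prod>w\<in>e. z w)))"
    proof (intro sum.cong refl)
      fix v assume v: "v \<in> V"
      have e: "\<mu> * z v ^ k = \<mu> * z v ^ (k - 1) * z v" using k_ge_2 by (cases k) auto
      show "cmod (\<mu> * z v ^ k) = cmod (\<Sum>e | e \<in> E \<and> v \<in> e. of_real \<alpha> * z v ^ k + of_real (1 - \<alpha>) * (\<Prod>w\<in>e. z w))"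
        unfolding tensor[OF v, symmetric] z(2)[OF v] by (simp only: e)
    qed
    also have "\<dots> \<le> (\<Sum>v\<in>V. \<Sum>e | e \<in> E \<and> v \<in> e. \<alpha> * ?y v ^ k + (1 - \<alpha>) * (\<Prod>w\<in>e. ?y w))"
    proof (intro sum_mono order_trans[OF norm_sum])
      fix v e
      have "cmod (of_real \<alpha> * z v ^ k + of_real (1 - \<alpha>) * (\<Prod>w\<in>e. z w)) \<le>
        cmod (of_real \<alpha> * z v ^ k) + cmod (of_real (1 - \<alpha>) * (\<Prod>w\<in>e. z w))"
        by (rule norm_triangle_ineq)
      also have "\<dots> = \<alpha> * ?y v ^ k + (1 - \<alpha>) * (\<Prod>w\<in>e. ?y w)"
        using alpha_nonneg alpha_less_1 by (simp only: norm_mult norm_power norm_of_real prod_norm[symmetric])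
      finally show "cmod (of_real \<alpha> * z v ^ k + of_real (1 - \<alpha>) * (\<Prod>w\<in>e. z w)) \<le> \<alpha> * ?y v ^ k + (1 - \<alpha>) * (\<Prod>w\<in>e. ?y w)" .
    qed
    also have "\<dots> = Q ?y" by (simp only: alpha_form_eq_sum_verts)
    also have "\<dots> \<le> l * (\<Sum>v\<in>V. ?y v ^ k)" by (intro le) auto
    finally have "cmod \<mu> * (\<Sum>v\<in>V. ?y v ^ k) \<le> l * (\<Sum>v\<in>V. ?y v ^ k)" .
    moreover have "(\<Sum>v\<in>V. ?y v ^ k) > 0"
    proof -
      obtain v where "v \<in> V" "z v \<noteq> 0" using z(1) by blast
      then show ?thesis using finite_V by (intro sum_pos2[of _ v]) auto
    qed
    ultimately show ?thesis by simp
  qed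
  moreover have "cmod (of_real l) = l" using l0 by simp
  ultimately have "alpha_spectral_radius k \<alpha> G = l"
    unfolding alpha_spectral_radius_def
    by (intro cSup_eq_maximum) (force, blast)
  then show thesis using that[of x] ev le by metis
qed

end

section \<open>Shifting edges\<close>

text \<open>The eigenvector of \<open>G\<close> is a test vector for \<open>G'\<close>. If the radii
  agreed, it would be a maximiser for \<open>G'\<close> and hence an eigenvector there too; but at a
  vertex \<open>z\<close> that keeps its edges and gains \<open>e0\<close>, the two eigenvector
  equations have the same right-hand side and different left-hand sides.\<close>

lemma alpha_spectral_radius_shift:
  fixes G G' :: "'a hypergraph"
  assumes G: "uniform k G" and G': "uniform k G'" "linked G'" and k: "k \<ge> 2" and \<alpha>: "0 \<le> \<alpha>" "\<alpha> < 1"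
    and V: "verts G' = verts G" "verts G \<noteq> {}"
    and ev: "alpha_eigenvector k \<alpha> G (alpha_spectral_radius k \<alpha> G) x"
    and inj: "inj_on \<sigma> (edges G)" and E: "edges G' = \<sigma> ` edges G"
    and prod_le: "\<And>e. e \<in> edges G \<Longrightarrow> (\<Prod>w\<in>e. x w) \<le> (\<Prod>w\<in>\<sigma> e. x w)"
    and sum_le: "\<And>e. e \<in> edges G \<Longrightarrow> (\<Sum>w\<in>e. x w ^ k) \<le> (\<Sum>w\<in>\<sigma> e. x w ^ k)"
  shows "alpha_spectral_radius k \<alpha> G \<le> alpha_spectral_radius k \<alpha> G'"
    and "z \<in> verts G \<Longrightarrow> (\<And>e. e \<in> edges G \<Longrightarrow> z \<in> e \<Longrightarrow> z \<in> \<sigma> e) \<Longrightarrow> e0 \<in> edges G \<Longrightarrow> z \<notin> e0 \<Longrightarrow> z \<in> \<sigma> e0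
      \<Longrightarrow> alpha_spectral_radius k \<alpha> G < alpha_spectral_radius k \<alpha> G'"
proof -
  let ?r = "alpha_spectral_radius k \<alpha> G" and ?r' = "alpha_spectral_radius k \<alpha> G'"
  interpret G: uniform_hypergraph k \<alpha> G by unfold_locales (use G k \<alpha> in auto)
  interpret G': uniform_hypergraph k \<alpha> G' by unfold_locales (use G' k \<alpha> in auto)
  have pos: "\<And>v. v \<in> verts G \<Longrightarrow> 0 < x v" using ev by (simp add: alpha_eigenvector_def)
  define N where "N = (\<Sum>v\<in>verts G. x v ^ k)"
  have N: "N > 0" unfolding N_def using V(2) pos G.finite_V by (intro sum_pos) auto
  obtain y where max': "\<And>y. (\<And>v. v \<in> verts G' \<Longrightarrow> 0 \<le> y v) \<Longrightarrow> G'.Q y \<le> ?r' * (\<Sum>v\<in>verts G'. y v ^ k)"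
    using G'.alpha_spectral_radius_eigenvector[OF G'(2)] V by metis
  have "G'.Q x = (\<Sum>e\<in>edges G. \<alpha> * (\<Sum>v\<in>\<sigma> e. x v ^ k) + (1 - \<alpha>) * real k * (\<Prod>v\<in>\<sigma> e. x v))"
    unfolding alpha_form_def E using inj by (simp add: sum.reindex)
  also have "\<dots> \<ge> G.Q x"
    unfolding alpha_form_def using prod_le sum_le \<alpha> by (intro sum_mono add_mono mult_left_mono) auto
  finally have Qle: "G.Q x \<le> G'.Q x" .
  have Qx: "G.Q x = ?r * N" unfolding N_def by (rule G.alpha_form_eigenvector[OF ev])
  have Q'x: "G'.Q x \<le> ?r' * N" using max'[of x] pos unfolding N_def V(1) by force
  have "?r * N \<le> ?r' * N" using Qle Qx Q'x by linarith
  then show le: "?r \<le> ?r'" using N by simp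
  show "?r < ?r'" if z: "z \<in> verts G" "\<And>e. e \<in> edges G \<Longrightarrow> z \<in> e \<Longrightarrow> z \<in> \<sigma> e"
    "e0 \<in> edges G" "z \<notin> e0" "z \<in> \<sigma> e0"
  proof (rule ccontr)
    assume "\<not> ?thesis"
    then have eq: "?r' = ?r" using le by simp
    have "G'.Q x = ?r' * (\<Sum>v\<in>verts G'. x v ^ k)" using Qle Qx Q'x unfolding eq N_def V(1) by linarith
    then have ev': "alpha_eigenvector k \<alpha> G' ?r' x"
      using pos V(1) by (intro G'.maximiser_eigenvector max') auto
    \<comment> \<open>The contribution of one edge to the equation at \<open>z\<close>; the
      additional edge \<open>\<sigma> e0\<close> makes the sum over \<open>G'\<close> strictly
      larger.\<close>
    let ?f = "\<lambda>e. \<alpha> * x z ^ k + (1 - \<alpha>) * (\<Prod>w\<in>e. x w)"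
    have fpos: "?f e > 0" if "e \<in> edges G'" for e
    proof -
      have "(\<Prod>w\<in>e. x w) > 0" using G'.edge_subset[OF that] pos V(1) by (intro prod_pos) auto
      moreover have "x z > 0" using pos z by auto
      ultimately show ?thesis using \<alpha> by (intro add_nonneg_pos) auto
    qed
    have "?r * x z ^ k = (\<Sum>e | e \<in> edges G \<and> z \<in> e. ?f e)"
      using ev z(1) unfolding alpha_eigenvector_def by simp
    also have "\<dots> \<le> (\<Sum>e | e \<in> edges G \<and> z \<in> e. ?f (\<sigma> e))"
      using prod_le \<alpha> by (intro sum_mono) (auto intro!: mult_left_mono)
    also have "\<dots> < (\<Sum>e | e \<in> edges G \<and> z \<in> \<sigma> e. ?f (\<sigma> e))"
    proof (rule sum_strict_mono2[of _ _ e0])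
      show "finite {e \<in> edges G. z \<in> \<sigma> e}" using G.finite_E by auto
      show "0 < ?f (\<sigma> e0)" using z E by (intro fpos) auto
      show "0 \<le> ?f (\<sigma> e)" if "e \<in> {e \<in> edges G. z \<in> \<sigma> e}" for e using that E fpos[of "\<sigma> e"] by auto
    qed (use z in auto)
    also have "\<dots> = (\<Sum>e | e \<in> edges G' \<and> z \<in> e. ?f e)"
    proof -
      have "{e \<in> edges G'. z \<in> e} = \<sigma> ` {e \<in> edges G. z \<in> \<sigma> e}" using E by auto
      moreover have "inj_on \<sigma> {e \<in> edges G. z \<in> \<sigma> e}" using inj by (rule inj_on_subset) auto
      ultimately show ?thesis by (simp add: sum.reindex)
    qed
    also have "\<dots> = ?r * x z ^ k"
      using ev' z(1) V eq unfolding alpha_eigenvector_def by simp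
    finally show False by simp
  qed
qed

lemma hiso_sym:
  assumes "G \<cong>\<^sub>h H" and sub: "\<And>e. e \<in> edges G \<Longrightarrow> e \<subseteq> verts G"
  shows "H \<cong>\<^sub>h G"
proof -
  obtain f where f: "bij_betw f (verts G) (verts H)" "edges H = (\<lambda>e. f ` e) ` edges G"
    using assms(1) by (auto simp: hiso_def)
  let ?g = "inv_into (verts G) f"
  have "?g ` f ` e = e" if "e \<in> edges G" for e
    using f(1) sub[OF that] by (intro inv_into_image_cancel) (auto simp: bij_betw_def)
  then have "(\<lambda>e. ?g ` e) ` edges H = edges G" unfolding f(2) by (simp add: image_comp cong: image_cong)
  then show ?thesis unfolding hiso_def using bij_betw_inv_into[OF f(1)] by metis
qed

text \<open>The eigenvector of \<open>G\<close>, transported along the bijection, is a test vector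
  for \<open>H\<close>. The converse inequality comes from the inverse isomorphism.\<close>

lemma alpha_spectral_radius_hiso_le:
  assumes iso: "G \<cong>\<^sub>h H" and u: "uniform k G" "uniform k H" and l: "linked G" "linked H"
    and ne: "verts G \<noteq> {}" and k: "k \<ge> 2" and \<alpha>: "0 \<le> \<alpha>" "\<alpha> < 1"
  shows "alpha_spectral_radius k \<alpha> G \<le> alpha_spectral_radius k \<alpha> H"
proof -
  let ?r = "alpha_spectral_radius k \<alpha> G" and ?r' = "alpha_spectral_radius k \<alpha> H"
  interpret G: uniform_hypergraph k \<alpha> G by unfold_locales (use u k \<alpha> in auto)
  interpret H: uniform_hypergraph k \<alpha> H by unfold_locales (use u k \<alpha> in auto)
  obtain f where f: "bij_betw f (verts G) (verts H)" "edges H = (\<lambda>e. f ` e) ` edges G"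
    using iso by (auto simp: hiso_def)
  then have inj: "inj_on f (verts G)" and img: "verts H = f ` verts G" by (auto simp: bij_betw_def)
  have injE: "inj_on (\<lambda>e. f ` e) (edges G)"
    using inj G.edge_subset by (meson inj_on_image_eq_iff inj_onI)
  obtain x where x: "alpha_eigenvector k \<alpha> G ?r x"
    using G.alpha_spectral_radius_eigenvector[OF l(1) ne] by metis
  have pos: "\<And>v. v \<in> verts G \<Longrightarrow> 0 < x v" using x by (simp add: alpha_eigenvector_def)
  have ne': "verts H \<noteq> {}" using ne img by auto
  obtain y' where max': "\<And>y. (\<And>v. v \<in> verts H \<Longrightarrow> 0 \<le> y v) \<Longrightarrow> H.Q y \<le> ?r' * (\<Sum>v\<in>verts H. y v ^ k)"
    using H.alpha_spectral_radius_eigenvector[OF l(2) ne'] by metis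
  define y where "y = x \<circ> inv_into (verts G) f"
  have y: "y (f v) = x v" if "v \<in> verts G" for v using inj that by (simp add: y_def)
  have sum_y: "(\<Sum>v\<in>verts H. y v ^ k) = (\<Sum>v\<in>verts G. x v ^ k)"
    unfolding img using inj y by (simp add: sum.reindex)
  have Qy: "H.Q y = G.Q x"
    unfolding alpha_form_def f(2) sum.reindex[OF injE]
  proof (intro sum.cong refl)
    fix e assume "e \<in> edges G"
    then have e: "inj_on f e" "\<And>v. v \<in> e \<Longrightarrow> y (f v) = x v"
      using inj G.edge_subset y by (meson inj_on_subset, blast)
    then show "((\<lambda>e. \<alpha> * (\<Sum>v\<in>e. y v ^ k) + (1 - \<alpha>) * real k * (\<Prod>v\<in>e. y v)) \<circ> (`) f) e =
      \<alpha> * (\<Sum>v\<in>e. x v ^ k) + (1 - \<alpha>) * real k * (\<Prod>v\<in>e. x v)"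
      by (simp add: sum.reindex prod.reindex)
  qed
  have "H.Q y \<le> ?r' * (\<Sum>v\<in>verts H. y v ^ k)"
    using pos y img by (intro max') (auto intro!: less_imp_le)
  then have "?r * (\<Sum>v\<in>verts G. x v ^ k) \<le> ?r' * (\<Sum>v\<in>verts G. x v ^ k)"
    unfolding Qy sum_y G.alpha_form_eigenvector[OF x] .
  moreover have "(\<Sum>v\<in>verts G. x v ^ k) > 0" using ne pos G.finite_V by (intro sum_pos) auto
  ultimately show ?thesis by simp
qed

lemma alpha_spectral_radius_hiso:
  assumes iso: "G \<cong>\<^sub>h H" and u: "uniform k G" "uniform k H" and l: "linked G" "linked H"
    and ne: "verts G \<noteq> {}" and k: "k \<ge> 2" and \<alpha>: "0 \<le> \<alpha>" "\<alpha> < 1"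
  shows "alpha_spectral_radius k \<alpha> G = alpha_spectral_radius k \<alpha> H"
proof -
  have iso': "H \<cong>\<^sub>h G" by (rule hiso_sym[OF iso]) (use u in \<open>auto simp: uniform_def\<close>)
  have "verts H \<noteq> {}" using iso ne by (auto simp: hiso_def bij_betw_def)
  then show ?thesis
    using alpha_spectral_radius_hiso_le[OF iso u l ne k \<alpha>]
      alpha_spectral_radius_hiso_le[OF iso' u(2,1) l(2,1) _ k \<alpha>] by simp
qed

section \<open>Shares of branches\<close>

text \<open>The function \<phi> of the overview: what an edge contributes at its upper end if the
  branches below its lower end contribute \<open>s\<close> there. \<open>C\<close> is kept as a
  separate parameter, since the comparison of radii changes \<open>l\<close> and \<open>C\<close>
  together.\<close>

definition branch_share :: "real \<Rightarrow> real \<Rightarrow> real \<Rightarrow> real \<Rightarrow> real" where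
  "branch_share \<alpha> C l s = \<alpha> + C / (l - \<alpha> - s)"

fun arm_share :: "real \<Rightarrow> real \<Rightarrow> real \<Rightarrow> nat \<Rightarrow> real" where
  "arm_share \<alpha> C l 0 = 0"
| "arm_share \<alpha> C l (Suc n) = branch_share \<alpha> C l (arm_share \<alpha> C l n)"

definition centre_share :: "real \<Rightarrow> real \<Rightarrow> real \<Rightarrow> nat \<Rightarrow> nat \<Rightarrow> nat \<Rightarrow> nat \<Rightarrow> real" where
  "centre_share \<alpha> C l s t a b = branch_share \<alpha> C l (real s * arm_share \<alpha> C l 1)
     + real t * arm_share \<alpha> C l 1 + arm_share \<alpha> C l a + arm_share \<alpha> C l b"

lemma branch_share_mono:
  assumes "l \<le> l'" "0 \<le> C'" "C' \<le> C" "s' \<le> s" "\<alpha> + s < l"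
  shows "branch_share \<alpha> C' l' s' \<le> branch_share \<alpha> C l s"
  unfolding branch_share_def using assms by (intro add_left_mono frac_le) auto

text \<open>Positive denominators are demanded at the smaller value \<open>l\<close> only: the
  inequality for shorter arms together with \<open>l \<le> l'\<close> makes the denominators at
  \<open>l'\<close> at least as large.\<close>

lemma arm_share_antimono:
  assumes "l \<le> l'" "0 \<le> C'" "C' \<le> C" and "\<And>j. j < n \<Longrightarrow> \<alpha> + arm_share \<alpha> C l j < l"
  shows "arm_share \<alpha> C' l' n \<le> arm_share \<alpha> C l n"
  using assms(4)
proof (induction n)
  case (Suc n)
  then show ?case using assms(1-3) by (auto intro!: branch_share_mono)
qed simp

lemma centre_share_antimono:
  assumes "l \<le> l'" "0 \<le> C'" "C' \<le> C" and l: "0 \<le> \<alpha>" "\<alpha> < l" and "\<alpha> + real s * arm_share \<alpha> C l 1 < l"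
    and a: "\<And>j. j < a \<Longrightarrow> \<alpha> + arm_share \<alpha> C l j < l" and b: "\<And>j. j < b \<Longrightarrow> \<alpha> + arm_share \<alpha> C l j < l"
  shows "centre_share \<alpha> C' l' s t a b \<le> centre_share \<alpha> C l s t a b"
proof -
  have "arm_share \<alpha> C' l' 1 \<le> arm_share \<alpha> C l 1"
    using l by (intro arm_share_antimono assms(1-3)) auto
  then show ?thesis unfolding centre_share_def
    using a b assms by (intro add_mono branch_share_mono arm_share_antimono mult_left_mono) auto
qed

section \<open>Shares at a fixed radius: fixed points, monotonicity and concavity\<close>

locale shares =
  fixes \<alpha> C l :: real
  assumes \<alpha>_nonneg: "0 \<le> \<alpha>" and C_pos: "0 < C" and \<alpha>_less: "\<alpha> < l"
begin

abbreviation "f \<equiv> arm_share \<alpha> C l"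

lemma f1_pos: "0 < f 1"
  using \<alpha>_nonneg C_pos \<alpha>_less by (simp add: branch_share_def add_nonneg_pos)

text \<open>Monotonicity as far as the denominators are known to be positive. It is needed to
  establish the hypothesis of \<open>discriminant\<close>, before the bounds valid for all arm
  lengths are available.\<close>

lemma f_mono:
  assumes "\<And>j. j < n \<Longrightarrow> \<alpha> + f j < l" "i \<le> j" "j \<le> n"
  shows "f i \<le> f j"
proof -
  have mono_step: "f m \<le> f (Suc m)" if "m < n" for m
    using that
  proof (induction m)
    case 0
    then show ?case using f1_pos by simp
  next
    case (Suc m)
    then have "f m \<le> f (Suc m)" "\<alpha> + f (Suc m) < l" using assms(1) by (simp_all del: arm_share.simps)
    then show ?case using C_pos by (auto intro!: branch_share_mono simp del: arm_share.simps simp: arm_share.simps(2)[of _ _ _ "Suc m"] arm_share.simps(2)[of _ _ _ m])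
  qed
  show ?thesis using assms(2,3)
  proof (induction j rule: dec_induct)
    case (step m)
    then show ?case using mono_step[of m] by linarith
  qed simp
qed

text \<open>
  The spider with three legs of length two already forces the fixed points of
  \<^term>\<open>branch_share \<alpha> C l\<close> to be real, so that arms of any length have convergent shares.
\<close>
lemma discriminant:
  assumes "\<alpha> + f 1 < l" "3 * f 2 \<le> l"
  shows "4 * C \<le> (l - 2 * \<alpha>)\<^sup>2" "\<alpha> < l - 2 * \<alpha>"
proof -
  define D where "D = l - 2 * \<alpha>"
  have f1: "f 1 = \<alpha> + C / (D + \<alpha>)" by (simp add: branch_share_def D_def)
  have pos: "D - C / (D + \<alpha>) > 0" using assms(1) unfolding f1 D_def by simp
  have E: "D + \<alpha> > 0" using \<alpha>_less by (simp add: D_def)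
  have "f 2 = \<alpha> + C / (l - \<alpha> - f 1)" by (simp add: numeral_2_eq_2 branch_share_def)
  then have f2: "f 2 = \<alpha> + C / (D - C / (D + \<alpha>))" unfolding f1 by (simp add: D_def algebra_simps)
  have "3 * (C / (D - C / (D + \<alpha>))) \<le> D - \<alpha>" using assms(2) unfolding f2 by (simp add: D_def)
  moreover have "C / (D - C / (D + \<alpha>)) > 0" using C_pos pos by simp
  ultimately show D\<alpha>: "\<alpha> < l - 2 * \<alpha>" unfolding D_def by linarith
  have "3 * C \<le> (D - \<alpha>) * (D - C / (D + \<alpha>))"
    using \<open>3 * (C / (D - C / (D + \<alpha>))) \<le> D - \<alpha>\<close> pos by (simp add: pos_divide_le_eq)
  then have "3 * C * (D + \<alpha>) \<le> (D - \<alpha>) * (D - C / (D + \<alpha>)) * (D + \<alpha>)"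
    using E by (intro mult_right_mono) auto
  also have "\<dots> = (D - \<alpha>) * (D * (D + \<alpha>) - C)" using E by (simp add: field_simps)
  finally have "4 * C * D + (2 * \<alpha> * C + \<alpha> * \<alpha> * D) \<le> D * D * D" by (simp add: algebra_simps)
  moreover have "0 \<le> 2 * \<alpha> * C + \<alpha> * \<alpha> * D" using \<alpha>_nonneg C_pos D\<alpha> by (simp add: D_def)
  ultimately have "4 * C * D \<le> D * D * D" by linarith
  then show "4 * C \<le> (l - 2 * \<alpha>)\<^sup>2"
    using D\<alpha> \<alpha>_nonneg by (simp add: D_def power2_eq_square mult_le_cancel_right)
qed

context
  assumes disc: "4 * C \<le> (l - 2 * \<alpha>)\<^sup>2" "\<alpha> < l - 2 * \<alpha>"
begin

text \<open>The fixed points of \<phi> are the roots of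
  \<open>(y - \<alpha>) * (l - \<alpha> - y) = C\<close>; their sum is \<open>l\<close> and their
  discriminant is \<open>(l - 2 * \<alpha>)\<^sup>2 - 4 * C\<close>. The bound \<open>l / 2\<close>
  is the midpoint of the two roots, and the iteration started at 0 stays below it.\<close>

lemma f_bound: "f n < l / 2"
proof (induction n)
  case 0
  then show ?case using disc \<alpha>_nonneg by simp
next
  case (Suc n)
  let ?D = "l - 2 * \<alpha>"
  have D: "?D > 0" using disc \<alpha>_nonneg by simp
  have "C / (l - \<alpha> - f n) < C / (?D / 2)"
    using Suc D C_pos by (intro divide_strict_left_mono mult_pos_pos) (auto simp: field_simps)
  also have "\<dots> \<le> ?D / 2" using disc(1) D by (simp add: field_simps power2_eq_square)
  finally show ?case by (simp add: branch_share_def field_simps)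
qed

lemma f_strict: "f n < f (Suc n)"
proof (induction n)
  case 0
  then show ?case using f1_pos by simp
next
  case (Suc n)
  have "l - \<alpha> - f (Suc n) > 0" using f_bound[of "Suc n"] disc \<alpha>_nonneg by linarith
  then have "C / (l - \<alpha> - f n) < C / (l - \<alpha> - f (Suc n))"
    using Suc C_pos by (intro divide_strict_left_mono mult_pos_pos) auto
  then show ?case by (simp add: branch_share_def)
qed

text \<open>One application of \<phi> multiplies an increment by \<open>C / (p * q)\<close>. Below
  the midpoint both denominators exceed \<open>(l - 2 * \<alpha>) / 2\<close>, so this factor is
  less than 1.\<close>

lemma f_concave: "f (Suc (Suc n)) - f (Suc n) < f (Suc n) - f n"
proof -
  let ?D = "l - 2 * \<alpha>"
  define p q where "p = l - \<alpha> - f n" and "q = l - \<alpha> - f (Suc n)"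
  have D: "?D > 0" using disc \<alpha>_nonneg by simp
  have p: "p > ?D / 2" and q: "q > ?D / 2"
    using f_bound[of n] f_bound[of "Suc n"] unfolding p_def q_def by (simp_all add: field_simps)
  have "C \<le> (?D / 2) * (?D / 2)" using disc(1) by (simp add: power2_eq_square)
  also have "\<dots> < p * q" using p q D by (intro mult_strict_mono) auto
  finally have Cpq: "C < p * q" .
  have "f (Suc (Suc n)) - f (Suc n) = C / q - C / p"
    by (simp add: branch_share_def p_def q_def)
  also have "\<dots> = C * (p - q) / (p * q)" using p q D by (simp add: field_simps)
  also have "\<dots> < p - q"
  proof -
    have "p - q > 0" "p * q > 0" using f_strict[of n] p q D unfolding p_def q_def by simp_all
    then show ?thesis using Cpq by (simp add: pos_divide_less_eq mult.commute)
  qed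
  finally show ?thesis by (simp add: p_def q_def)
qed

lemma f_increment_antimono: "m < n \<Longrightarrow> f (Suc n) - f n < f (Suc m) - f m"
proof (induction n)
  case (Suc n)
  then show ?case using f_concave[of n] by (cases "m = n") (auto simp del: arm_share.simps)
qed simp

text \<open>Moving one edge from the longer arm to the shorter one trades a late increment for an
  earlier, larger one; the induction on \<open>a - b\<close> stops when the arms differ by at most
  one.\<close>

lemma f_balance_le: "b \<le> a \<Longrightarrow> f a + f b \<le> f ((a + b) div 2) + f (a + b - (a + b) div 2)
   \<and> (b + 2 \<le> a \<longrightarrow> f a + f b < f ((a + b) div 2) + f (a + b - (a + b) div 2))"
proof (induction "a - b" arbitrary: a b rule: less_induct)
  case less
  show ?case
  proof (cases "b + 2 \<le> a")
    case True
    then obtain a' where a': "a = Suc a'" "b < a'" by (cases a) auto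
    have "f a + f b < f a' + f (Suc b)"
      using f_increment_antimono[OF a'(2)] unfolding a'(1) by linarith
    also have "\<dots> \<le> f ((a' + Suc b) div 2) + f (a' + Suc b - (a' + Suc b) div 2)"
      using less.hyps[of a' "Suc b"] a' by (simp del: arm_share.simps)
    finally show ?thesis using a' by (simp del: arm_share.simps)
  next
    case False
    then have "a = b \<or> a = Suc b" using less.prems by auto
    then show ?thesis by (auto simp del: arm_share.simps)
  qed
qed

end

text \<open>All three trees are evaluated at the radius \<open>l\<close> of the tree with parameters
  \<open>s\<close>, \<open>t\<close>, \<open>a\<close>, \<open>b\<close>, which attains
  \<open>l\<close> exactly while the two candidates stay at or below it. An interior
  \<open>s\<close> or unbalanced arms would push one candidate above \<open>l\<close>.\<close>

lemma centre_share_extremal: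
  assumes N: "1 \<le> s" "s + t = N" and d: "a + b = d" "4 \<le> d"
    and eq: "centre_share \<alpha> C l s t a b = l"
    and H1: "centre_share \<alpha> C l 1 (N - 1) (d div 2) (d - d div 2) \<le> l"
    and H2: "centre_share \<alpha> C l N 0 (d div 2) (d - d div 2) \<le> l" "\<alpha> + real N * f 1 < l"
    and arms: "\<And>j. j < d - d div 2 \<Longrightarrow> \<alpha> + f j < l"
  shows "(s = 1 \<or> s = N) \<and> (a = d div 2 \<or> b = d div 2)"
proof -
  \<comment> \<open>By \<open>4 \<le> d\<close> both arms have length at least two, and the branch
    through \<open>CentreS\<close> with its single leaf is a third leg of length two; these are the
    three legs required by \<open>discriminant\<close>.\<close>
  have "f 2 \<le> f (d div 2)" "f 2 \<le> f (d - d div 2)"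
    using d by (auto intro!: f_mono[of "d - d div 2"] arms simp del: arm_share.simps)
  moreover have "0 \<le> real (N - 1) * f 1" using f1_pos by simp
  moreover have "branch_share \<alpha> C l (real 1 * f 1) = f 2" by (simp add: numeral_2_eq_2)
  ultimately have f2: "3 * f 2 \<le> l" using H1 unfolding centre_share_def by linarith
  have f1: "\<alpha> + f 1 < l" using d by (intro arms) auto
  note disc = discriminant[OF f1 f2]
  let ?B = "f (d div 2) + f (d - d div 2)"
  have bal: "f a + f b \<le> ?B" "\<not> (a = d div 2 \<or> b = d div 2) \<Longrightarrow> f a + f b < ?B"
  proof -
    have "f a + f b \<le> ?B \<and> (\<not> (a = d div 2 \<or> b = d div 2) \<longrightarrow> f a + f b < ?B)"
    proof (cases "b \<le> a")
      case True
      have "\<not> (a = d div 2 \<or> b = d div 2) \<longrightarrow> b + 2 \<le> a" using True d by presburger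
      then show ?thesis using f_balance_le[OF disc True] d by (simp add: add.commute del: arm_share.simps)
    next
      case False
      then have "a \<le> b" by simp
      have "\<not> (a = d div 2 \<or> b = d div 2) \<longrightarrow> a + 2 \<le> b" using False d by presburger
      then show ?thesis using f_balance_le[OF disc \<open>a \<le> b\<close>] d by (simp add: add.commute del: arm_share.simps)
    qed
    then show "f a + f b \<le> ?B" "\<not> (a = d div 2 \<or> b = d div 2) \<Longrightarrow> f a + f b < ?B" by blast+
  qed
  define w where "w = f 1"
  define g where "g n = branch_share \<alpha> C l (real n * w) + real (N - n) * w" for n
  have w: "w > 0" using f1_pos by (simp add: w_def)
  have g1: "g 1 + ?B \<le> l" using H1 unfolding centre_share_def g_def w_def by simp
  have gN: "g N + ?B \<le> l" using H2(1) unfolding centre_share_def g_def w_def by simp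
  have gs: "g s + (f a + f b) = l" using eq N unfolding centre_share_def g_def w_def by auto
  \<comment> \<open>The assumptions say that the slope of \<phi> is at least 1 between
    \<open>w\<close> and \<open>s * w\<close>, and at most 1 between \<open>s * w\<close> and
    \<open>N * w\<close>. These slopes are \<open>C / (p * q)\<close> and
    \<open>C / (q * u)\<close>, and \<open>u < p\<close> makes the second strictly larger.\<close>
  have strict: False if "1 < s" "s < N" "g 1 \<le> g s" "g N \<le> g s"
  proof -
    define p q u where "p = l - \<alpha> - w" and "q = l - \<alpha> - real s * w" and "u = l - \<alpha> - real N * w"
    have u: "u > 0" using H2(2) by (simp add: u_def w_def)
    have qu: "q - u = real (N - s) * w" and pq: "p - q = real (s - 1) * w"
      using that by (simp_all add: p_def q_def u_def of_nat_diff algebra_simps)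
    have qu0: "q - u > 0" and pq0: "p - q > 0" unfolding qu pq using that w by simp_all
    then have q: "q > 0" and p: "p > 0" using u by linarith+
    have "real (N - 1) * w = (p - q) + (q - u)" unfolding pq qu using that by (simp add: of_nat_diff algebra_simps)
    then have "C / p + (p - q) \<le> C / q" using that(3)
      by (simp add: g_def branch_share_def p_def[symmetric] q_def[symmetric] qu[symmetric])
    then have "p - q \<le> C * (p - q) / (p * q)" using p q by (simp add: field_simps)
    then have "(p - q) * (p * q) \<le> C * (p - q)" using p q by (simp add: pos_le_divide_eq)
    then have 1: "p * q \<le> C" using pq0 by (simp add: mult.commute)
    have "C / u \<le> C / q + (q - u)" using that(4)
      by (simp add: g_def branch_share_def u_def[symmetric] q_def[symmetric] qu[symmetric])
    then have "C * (q - u) / (q * u) \<le> q - u" using u q by (simp add: field_simps)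
    then have "C * (q - u) \<le> (q - u) * (q * u)" using u q by (simp add: pos_divide_le_eq)
    then have "C \<le> q * u" using qu0 by (simp add: mult.commute)
    also have "\<dots> < p * q" using qu0 pq0 q u by (simp add: mult.commute)
    finally show False using 1 by simp
  qed
  have "s = 1 \<or> s = N"
    using strict N bal(1) gs g1 gN by force
  moreover have "a = d div 2 \<or> b = d div 2"
  proof (rule ccontr)
    assume "\<not> ?thesis"
    from bal(2)[OF this] gs have "g 1 < g s" "g N < g s" using g1 gN by linarith+
    then show False using \<open>s = 1 \<or> s = N\<close> by auto
  qed
  ultimately show ?thesis by blast
qed

end

section \<open>Powers of rooted trees\<close>

text \<open>\<open>depth\<close> need only decrease towards the root; it excludes parent cycles and
  serves as the measure for inductions from the root.\<close>

locale rooted_tree =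
  fixes I :: "'i set" and r :: 'i and par :: "'i \<Rightarrow> 'i" and depth :: "'i \<Rightarrow> nat"
  assumes finite_I: "finite I" and root_notin: "r \<notin> I"
    and par_in: "i \<in> I \<Longrightarrow> par i \<in> insert r I" and depth_par: "i \<in> I \<Longrightarrow> depth (par i) < depth i"

text \<open>
  Edges of a power of a rooted tree are indexed by the non-root nodes of the tree: \<open>g i\<close> is the
  edge joining \<open>i\<close> to its parent, and \<open>h\<close> embeds the nodes into the vertices.
\<close>
locale power_tree = rooted_tree I r par depth
  for I :: "'i set" and r par depth +
  fixes k :: nat and G :: "'a hypergraph" and h :: "'i \<Rightarrow> 'a" and g :: "'i \<Rightarrow> 'a set"
  assumes k_ge_3: "k \<ge> 3"
    and edges_eq: "edges G = g ` I"
    and verts_eq: "verts G = insert (h r) (\<Union>i\<in>I. g i)"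
    and card_g: "i \<in> I \<Longrightarrow> card (g i) = k"
    and h_in: "i \<in> I \<Longrightarrow> h i \<in> g i"
    and h_par_in: "i \<in> I \<Longrightarrow> h (par i) \<in> g i"
    and h_neq: "i \<in> I \<Longrightarrow> h i \<noteq> h (par i)"
    and disj: "i \<in> I \<Longrightarrow> j \<in> I \<Longrightarrow> i \<noteq> j \<Longrightarrow> (g i - {h (par i)}) \<inter> (g j - {h (par j)}) = {}"
    and root_disj: "i \<in> I \<Longrightarrow> h r \<notin> g i - {h (par i)}"
begin

text \<open>Together with the root vertex these sets partition the vertex set, so a vertex other
  than the root determines a unique node \<open>i\<close>.\<close>

abbreviation "D i \<equiv> g i - {h (par i)}"

lemma finite_g: "i \<in> I \<Longrightarrow> finite (g i)"
  using card_g k_ge_3 by (metis card.infinite not_numeral_le_zero)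

lemma h_in_D: "i \<in> I \<Longrightarrow> h i \<in> D i"
  using h_in h_neq by blast

lemma card_D: "i \<in> I \<Longrightarrow> card (D i) = k - 1"
  using card_g h_par_in by simp

lemma D_unique: "i \<in> I \<Longrightarrow> j \<in> I \<Longrightarrow> z \<in> D i \<Longrightarrow> z \<in> D j \<Longrightarrow> i = j"
  using disj by blast

lemma inj_h: "inj_on h (insert r I)"
proof (rule inj_onI)
  fix i j assume ij: "i \<in> insert r I" "j \<in> insert r I" "h i = h j"
  show "i = j"
  proof (cases "i = r \<or> j = r")
    case True
    then show ?thesis using ij h_in_D root_disj by (metis insertE)
  next
    case False
    then have "i \<in> I" "j \<in> I" using ij by auto
    then show ?thesis using D_unique[of i j "h i"] h_in_D ij(3) by metis
  qed
qed

lemma inj_g: "inj_on g I"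
proof (rule inj_onI, rule ccontr)
  fix i j assume ij: "i \<in> I" "j \<in> I" "g i = g j" "i \<noteq> j"
  then have "g i \<subseteq> {h (par i), h (par j)}" using disj[of i j] by blast
  then have "card (g i) \<le> card {h (par i), h (par j)}" by (intro card_mono) auto
  also have "\<dots> \<le> 2" by (simp add: card_insert_if)
  finally show False using card_g[OF ij(1)] k_ge_3 by simp
qed

lemma uniform_G: "uniform k G"
  using finite_I finite_g card_g by (auto simp: uniform_def edges_eq verts_eq)

lemma h_in_g_iff: "i \<in> I \<Longrightarrow> j \<in> insert r I \<Longrightarrow> h j \<in> g i \<longleftrightarrow> j = i \<or> j = par i"
proof
  assume i: "i \<in> I" and j: "j \<in> insert r I" and hj: "h j \<in> g i"
  show "j = i \<or> j = par i"
  proof (cases "h j = h (par i)")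
    case True
    then show ?thesis using inj_onD[OF inj_h True j par_in[OF i]] by blast
  next
    case False
    then have "h j \<in> D i" using hj by blast
    then have "j \<in> I" using j root_disj[OF i] by auto
    then show ?thesis using D_unique[OF _ i, of j "h j"] h_in_D \<open>h j \<in> D i\<close> by blast
  qed
next
  show "i \<in> I \<Longrightarrow> j = i \<or> j = par i \<Longrightarrow> h j \<in> g i" using h_in h_par_in by blast
qed

lemma verts_eq_D: "verts G = insert (h r) (\<Union>i\<in>I. D i)"
proof -
  have "h (par i) \<in> insert (h r) (\<Union>i\<in>I. D i)" if "i \<in> I" for i
    using par_in[OF that] h_in_D by blast
  then show ?thesis unfolding verts_eq by blast
qed

text \<open>Here \<open>k \<ge> 3\<close> provides a vertex of degree one in every edge; its
  equation later yields \<open>\<alpha> < l\<close>.\<close>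

lemma other_vertex:
  assumes "i \<in> I" shows "\<exists>z\<in>g i. z \<notin> h ` insert r I"
proof -
  have "card {h i, h (par i)} < card (g i)" using card_g[OF assms] k_ge_3 by (simp add: card_insert_if)
  then have "\<not> g i \<subseteq> {h i, h (par i)}" by (meson card_mono finite.intros not_less)
  then obtain z where "z \<in> g i" "z \<noteq> h i" "z \<noteq> h (par i)" by blast
  then have "z \<notin> h ` insert r I" using h_in_g_iff[OF assms] by (metis imageE)
  then show ?thesis using \<open>z \<in> g i\<close> by (rule bexI)
qed

lemma linked_G: "linked G"
  unfolding linked_def
proof (intro allI impI, rule ccontr)
  fix S assume S: "S \<subseteq> verts G \<and> S \<noteq> {} \<and> S \<noteq> verts G"
    and no: "\<not> (\<exists>e\<in>edges G. e \<inter> S \<noteq> {} \<and> e - S \<noteq> {})"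
  then have cl: "g i \<subseteq> S \<or> g i \<inter> S = {}" if "i \<in> I" for i using that unfolding edges_eq by blast
  have h_iff: "h i \<in> S \<longleftrightarrow> h r \<in> S" if "i \<in> insert r I" for i
    using that
  proof (induction "depth i" arbitrary: i rule: less_induct)
    case less
    show ?case
    proof (cases "i = r")
      case False
      then have i: "i \<in> I" using less.prems by simp
      have "h (par i) \<in> S \<longleftrightarrow> h r \<in> S" using less.hyps[OF depth_par[OF i]] par_in[OF i] by blast
      then show ?thesis using cl[OF i] h_in[OF i] h_par_in[OF i] by blast
    qed simp
  qed
  have "v \<in> S \<longleftrightarrow> h r \<in> S" if v: "v \<in> verts G" for v
  proof (cases "v = h r")
    case False
    then obtain i where i: "i \<in> I" "v \<in> g i" using v unfolding verts_eq by blast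
    then have "v \<in> S \<longleftrightarrow> h i \<in> S" using cl[OF i(1)] h_in[OF i(1)] by blast
    then show ?thesis using h_iff[of i] i(1) by simp
  qed simp
  then show False using S by blast
qed

lemma edges_at_node:
  assumes "i \<in> insert r I"
  shows "{e \<in> edges G. h i \<in> e} = g ` ({j \<in> I. par j = i} \<union> ({i} \<inter> I))"
  unfolding edges_eq using h_in_g_iff assms by auto

lemma edges_at_other:
  assumes "i \<in> I" "z \<in> g i" "z \<notin> h ` insert r I"
  shows "{e \<in> edges G. z \<in> e} = {g i}"
proof -
  have "z \<in> D j" if "j \<in> I" "z \<in> g j" for j using that assms(3) par_in[OF that(1)] by blast
  then show ?thesis using assms D_unique unfolding edges_eq by blast
qed

text \<open>
  In terms of the share \<open>F i\<close> that the edge \<open>g i\<close> contributes at the parent of \<open>i\<close>, the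
  eigenvector equations become a recursion from the leaves to the root.
\<close>
context
  fixes \<alpha> l :: real and x :: "'a \<Rightarrow> real"
  assumes \<alpha>: "0 \<le> \<alpha>" "\<alpha> < 1" and ev: "alpha_eigenvector k \<alpha> G l x"
begin

definition share :: "'i \<Rightarrow> real" where
  "share i = \<alpha> + (1 - \<alpha>) * (\<Prod>w\<in>g i. x w) / x (h (par i)) ^ k"

definition child_share :: "'i \<Rightarrow> real" where
  "child_share i = (\<Sum>j | j \<in> I \<and> par j = i. share j)"

lemma x_pos: "v \<in> verts G \<Longrightarrow> 0 < x v"
  using ev by (simp add: alpha_eigenvector_def)

lemma h_verts: "i \<in> insert r I \<Longrightarrow> h i \<in> verts G"
  using h_in unfolding verts_eq by blast

lemma node_equation:
  assumes "i \<in> insert r I"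
  shows "(if i = r then 0 else \<alpha> * x (h i) ^ k + (1 - \<alpha>) * (\<Prod>w\<in>g i. x w)) + child_share i * x (h i) ^ k
    = l * x (h i) ^ k"
proof -
  let ?f = "\<lambda>e. \<alpha> * x (h i) ^ k + (1 - \<alpha>) * (\<Prod>w\<in>e. x w)"
  let ?C = "{j \<in> I. par j = i}"
  have xi: "x (h i) > 0" using x_pos h_verts assms by blast
  have "(\<Sum>e | e \<in> edges G \<and> h i \<in> e. ?f e) = (\<Sum>j \<in> ?C \<union> ({i} \<inter> I). ?f (g j))"
    unfolding edges_at_node[OF assms] by (rule sum.reindex_cong[OF inj_on_subset[OF inj_g]]) auto
  also have "\<dots> = (\<Sum>j\<in>?C. ?f (g j)) + (\<Sum>j\<in>{i} \<inter> I. ?f (g j))"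
    using finite_I by (intro sum.union_disjoint) (auto dest: depth_par)
  also have "(\<Sum>j\<in>{i} \<inter> I. ?f (g j)) = (if i = r then 0 else ?f (g i))"
    using assms root_notin by auto
  also have "(\<Sum>j\<in>?C. ?f (g j)) = child_share i * x (h i) ^ k"
    unfolding child_share_def sum_distrib_right share_def
    using xi by (intro sum.cong refl) (simp add: field_simps)
  finally show ?thesis
    using ev h_verts[OF assms] unfolding alpha_eigenvector_def by (simp add: add.commute)
qed

lemma child_share_root: "child_share r = l"
proof -
  have "x (h r) > 0" by (intro x_pos h_verts) simp
  then show ?thesis using node_equation[of r] by simp
qed

lemma child_share_less:
  assumes "i \<in> I" shows "\<alpha> + child_share i < l"
    and "(l - \<alpha> - child_share i) * x (h i) ^ k = (1 - \<alpha>) * (\<Prod>w\<in>g i. x w)"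
proof -
  have xi: "x (h i) > 0" using assms by (intro x_pos h_verts) simp
  have "g i \<subseteq> verts G" using assms verts_eq by blast
  then have p: "(\<Prod>w\<in>g i. x w) > 0" using x_pos by (intro prod_pos) blast
  show *: "(l - \<alpha> - child_share i) * x (h i) ^ k = (1 - \<alpha>) * (\<Prod>w\<in>g i. x w)"
  proof -
    have "i \<noteq> r" using assms root_notin by blast
    then show ?thesis using node_equation[of i] assms by (simp add: algebra_simps)
  qed
  have "(l - \<alpha> - child_share i) * x (h i) ^ k > 0" unfolding * using p \<alpha> by simp
  then show "\<alpha> + child_share i < l" using xi by (simp add: zero_less_mult_iff)
qed

lemma other_equation:
  assumes "i \<in> I" "z \<in> g i" "z \<notin> h ` insert r I"
  shows "(l - \<alpha>) * x z ^ k = (1 - \<alpha>) * (\<Prod>w\<in>g i. x w)"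
proof -
  have z: "z \<in> verts G" using assms verts_eq by blast
  then have "(\<Sum>e | e \<in> edges G \<and> z \<in> e. \<alpha> * x z ^ k + (1 - \<alpha>) * (\<Prod>w\<in>e. x w)) = l * x z ^ k"
    using ev unfolding alpha_eigenvector_def by blast
  then show ?thesis unfolding edges_at_other[OF assms] by (simp add: algebra_simps)
qed

lemma alpha_less:
  assumes "i \<in> I" shows "\<alpha> < l"
proof -
  obtain z where z: "z \<in> g i" "z \<notin> h ` insert r I" using other_vertex[OF assms] by blast
  have zv: "z \<in> verts G" "g i \<subseteq> verts G" using assms z verts_eq by blast+
  then have p: "(\<Prod>w\<in>g i. x w) > 0" using x_pos by (intro prod_pos) blast
  have "(l - \<alpha>) * x z ^ k > 0" unfolding other_equation[OF assms z] using p \<alpha> by simp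
  then show ?thesis using x_pos[OF zv(1)] by (simp add: zero_less_mult_iff)
qed

text \<open>With \<open>?p\<close> the product over the edge, \<open>(1 - \<alpha>) * ?p\<close>
  equals a multiple of \<open>x w ^ k\<close> for every vertex \<open>w\<close> of the edge, with
  coefficient \<open>share i - \<alpha>\<close> at the parent,
  \<open>l - \<alpha> - child_share i\<close> at \<open>h i\<close>, and \<open>l - \<alpha>\<close>
  at the \<open>k - 2\<close> remaining vertices. Multiplying these \<open>k\<close> identities and
  cancelling \<open>?p ^ k\<close> gives the recursion and explains the constant
  \<open>C\<close>.\<close>

lemma share_recursion:
  assumes "i \<in> I"
  shows "share i = \<alpha> + (1 - \<alpha>) ^ k / (l - \<alpha>) ^ (k - 2) / (l - \<alpha> - child_share i)"
proof -
  let ?p = "\<Prod>w\<in>g i. x w" and ?R = "g i - {h (par i)} - {h i}"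
  have gv: "g i \<subseteq> verts G" using assms verts_eq by blast
  then have p: "?p > 0" using x_pos by (intro prod_pos) blast
  have xp: "x (h (par i)) > 0" and xi: "x (h i) > 0"
    using h_par_in[OF assms] h_in[OF assms] gv x_pos by blast+
  have R: "x w > 0 \<and> (1 - \<alpha>) * ?p = (l - \<alpha>) * x w ^ k" if "w \<in> ?R" for w
  proof -
    have "w \<notin> h ` insert r I" using that h_in_g_iff[OF assms] by (metis DiffD1 DiffD2 imageE insertI1)
    moreover have "w \<in> g i" using that by blast
    ultimately show ?thesis using other_equation[OF assms, of w] gv x_pos[of w] by auto
  qed
  have card_R: "card ?R = k - 2" using card_D[OF assms] h_in_D[OF assms] finite_g[OF assms] by simp
  have split: "(\<Prod>w\<in>g i. y w) = y (h (par i)) * (y (h i) * (\<Prod>w\<in>?R. y w))" for y :: "'a \<Rightarrow> real"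
    using finite_g[OF assms] h_par_in[OF assms] h_in_D[OF assms]
    by (simp add: prod.remove[of "g i" "h (par i)"] prod.remove[of "g i - {h (par i)}" "h i"])
  have k2: "2 + (k - 2) = k" using k_ge_3 by simp
  have "(1 - \<alpha>) ^ k * ?p ^ k = ((1 - \<alpha>) * ?p) ^ 2 * ((1 - \<alpha>) * ?p) ^ (k - 2)"
    by (simp only: power_add[symmetric] k2) (simp add: power_mult_distrib)
  also have "((1 - \<alpha>) * ?p) ^ (k - 2) = (\<Prod>w\<in>?R. (1 - \<alpha>) * ?p)" using card_R by simp
  also have "\<dots> = (\<Prod>w\<in>?R. (l - \<alpha>) * x w ^ k)" using R by (intro prod.cong) auto
  also have "\<dots> = (l - \<alpha>) ^ (k - 2) * (\<Prod>w\<in>?R. x w) ^ k"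
    by (simp add: prod.distrib card_R prod_power_distrib)
  also have "((1 - \<alpha>) * ?p) ^ 2 = (share i - \<alpha>) * x (h (par i)) ^ k * ((l - \<alpha> - child_share i) * x (h i) ^ k)"
    unfolding child_share_less(2)[OF assms] using xp by (simp add: share_def power2_eq_square)
  also have "\<dots> * ((l - \<alpha>) ^ (k - 2) * (\<Prod>w\<in>?R. x w) ^ k)
      = (share i - \<alpha>) * (l - \<alpha> - child_share i) * (l - \<alpha>) ^ (k - 2) * ?p ^ k"
    unfolding split[of x] by (simp add: power_mult_distrib mult_ac)
  finally have eq: "(1 - \<alpha>) ^ k = (share i - \<alpha>) * (l - \<alpha> - child_share i) * (l - \<alpha>) ^ (k - 2)" using p by simp
  have "l - \<alpha> - child_share i \<noteq> 0" "l - \<alpha> \<noteq> 0"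
    using child_share_less(1)[OF assms] alpha_less[OF assms] by auto
  then have "(1 - \<alpha>) ^ k / (l - \<alpha>) ^ (k - 2) / (l - \<alpha> - child_share i) = share i - \<alpha>"
    unfolding eq by simp
  then show ?thesis by simp
qed

end

end

text \<open>Corresponding blocks \<open>D i\<close> both have \<open>k - 1\<close> elements, so
  bijections that respect \<open>h i\<close> exist blockwise and can be glued. The missing vertex of
  each edge is a node image in another block or the root, where the glued map is already
  right.\<close>

lemma power_tree_hiso:
  assumes "power_tree I r par depth k G h g" "power_tree I r par depth k G' h' g'"
  shows "G \<cong>\<^sub>h G'"
proof -
  interpret A: power_tree I r par depth k G h g by fact
  interpret B: power_tree I r par depth k G' h' g' by fact
  have "\<exists>b. bij_betw b (A.D i) (B.D i) \<and> b (h i) = h' i" if i: "i \<in> I" for i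
  proof -
    let ?A = "A.D i - {h i}" and ?B = "B.D i - {h' i}"
    have "card ?A = card ?B" using A.card_D B.card_D A.h_in_D B.h_in_D i by simp
    then obtain b where b: "bij_betw b ?A ?B"
      using finite_same_card_bij[of ?A ?B] A.finite_g B.finite_g i by auto
    let ?b = "b(h i := h' i)"
    have "bij_betw ?b ?A ?B \<longleftrightarrow> bij_betw b ?A ?B" by (intro bij_betw_cong) auto
    then have "bij_betw ?b ?A ?B" using b by blast
    then have "bij_betw ?b (?A \<union> {h i}) (?B \<union> {?b (h i)})" by (intro notIn_Un_bij_betw) auto
    moreover have "?A \<union> {h i} = A.D i" "?B \<union> {h' i} = B.D i" using A.h_in_D[OF i] B.h_in_D[OF i] by auto
    ultimately show ?thesis by (intro exI[of _ ?b]) simp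
  qed
  then obtain b where b: "\<And>i. i \<in> I \<Longrightarrow> bij_betw (b i) (A.D i) (B.D i)" "\<And>i. i \<in> I \<Longrightarrow> b i (h i) = h' i" by metis
  define F where "F z = (if z = h r then h' r else b (THE i. i \<in> I \<and> z \<in> A.D i) z)" for z
  have FD: "F z = b i z" if "i \<in> I" "z \<in> A.D i" for i z
  proof -
    have "(THE i. i \<in> I \<and> z \<in> A.D i) = i" using that A.D_unique by (intro the_equality) blast+
    moreover have "z \<noteq> h r" using that A.root_disj by blast
    ultimately show ?thesis by (simp add: F_def)
  qed
  have bijD: "bij_betw F (A.D i) (B.D i)" if "i \<in> I" for i
    using b(1)[OF that] bij_betw_cong[of "A.D i" F "b i" "B.D i"] FD[OF that] by blast
  have Fh: "F (h i) = h' i" if "i \<in> insert r I" for i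
    using that FD[of i "h i"] A.h_in_D[of i] b(2)[of i] by (auto simp: F_def)
  have "bij_betw F (\<Union>i\<in>I. A.D i) (\<Union>i\<in>I. B.D i)"
    using B.disj bijD by (intro bij_betw_UNION_disjoint) (auto simp: disjoint_family_on_def)
  moreover have "h r \<notin> (\<Union>i\<in>I. A.D i)" "F (h r) \<notin> (\<Union>i\<in>I. B.D i)"
    using A.root_disj B.root_disj Fh by auto
  ultimately have "bij_betw F ((\<Union>i\<in>I. A.D i) \<union> {h r}) ((\<Union>i\<in>I. B.D i) \<union> {F (h r)})"
    by (intro notIn_Un_bij_betw)
  then have bij: "bij_betw F (verts G) (verts G')"
    unfolding A.verts_eq_D B.verts_eq_D using Fh[of r] by simp
  have "F ` g i = g' i" if "i \<in> I" for i
  proof -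
    have "g i = insert (h (par i)) (A.D i)" "g' i = insert (h' (par i)) (B.D i)"
      using A.h_par_in[OF that] B.h_par_in[OF that] by auto
    then show ?thesis using bijD[OF that] Fh[OF A.par_in[OF that]] by (metis bij_betw_imp_surj_on image_insert)
  qed
  then have "edges G' = (\<lambda>e. F ` e) ` edges G"
    unfolding A.edges_eq B.edges_eq by (simp add: image_image cong: image_cong)
  then show ?thesis using bij unfolding hiso_def by blast
qed

section \<open>The trees \<open>T(s,t;a,b)\<close> as rooted trees with root \<open>CentreT\<close>,
  and their share equations\<close>

definition T_nodes :: "nat \<Rightarrow> nat \<Rightarrow> nat \<Rightarrow> nat \<Rightarrow> tvertex set" where
  "T_nodes s t a b = {CentreS} \<union> LeafS ` {..<s} \<union> LeafT ` {..<t} \<union> ArmA ` {..<a} \<union> ArmB ` {..<b}"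

fun T_par :: "tvertex \<Rightarrow> tvertex" where
  "T_par CentreT = CentreT"
| "T_par CentreS = CentreT"
| "T_par (LeafS i) = CentreS"
| "T_par (LeafT i) = CentreT"
| "T_par (ArmA i) = case_nat CentreT ArmA i"
| "T_par (ArmB i) = case_nat CentreT ArmB i"

fun T_depth :: "tvertex \<Rightarrow> nat" where
  "T_depth CentreT = 0"
| "T_depth CentreS = 1"
| "T_depth (LeafS i) = 2"
| "T_depth (LeafT i) = 1"
| "T_depth (ArmA i) = Suc i"
| "T_depth (ArmB i) = Suc i"

lemma rooted_tree_T: "rooted_tree (T_nodes s t a b) CentreT T_par T_depth"
  by unfold_locales (auto simp: T_nodes_def split: nat.splits)

lemma T_tree_eq:
  "verts (T_tree s t a b) = insert CentreT (T_nodes s t a b)"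
  "edges (T_tree s t a b) = (\<lambda>i. {i, T_par i}) ` T_nodes s t a b"
proof -
  show "verts (T_tree s t a b) = insert CentreT (T_nodes s t a b)"
    by (auto simp: T_tree_def attach_path_def double_star_def T_nodes_def)
  have *: "{{case_nat c p i, p i} |i. i < n} = (\<lambda>i. {p i, case_nat c p i}) ` {..<n}" for c :: 'a and p n
    by (auto simp: insert_commute)
  show "edges (T_tree s t a b) = (\<lambda>i. {i, T_par i}) ` T_nodes s t a b"
    unfolding T_tree_def attach_path_def double_star_def T_nodes_def hypergraph.sel *
    by (auto simp: image_Un image_image insert_commute)
qed

lemma power_tree_hpower:
  assumes "rooted_tree I r par depth" "k \<ge> 3" "I \<noteq> {}"
    and V: "verts T = insert r I" and E: "edges T = (\<lambda>i. {i, par i}) ` I"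
  shows "power_tree I r par depth k (hpower k T) Inl
    (\<lambda>i. Inl ` {i, par i} \<union> (\<lambda>n. Inr ({i, par i}, n)) ` {..<k - 2})"
proof -
  interpret rooted_tree I r par depth by fact
  have neq: "i \<noteq> par i" if "i \<in> I" for i using depth_par[OF that] by auto
  \<comment> \<open>Distinct nodes with the same edge would be parents of each other, which
    \<open>depth\<close> forbids.\<close>
  have edge_inj: "i = j" if "i \<in> I" "j \<in> I" "{i, par i} = {j, par j}" for i j
    using that depth_par[of i] depth_par[of j] by (auto simp: doubleton_eq_iff)
  let ?g = "\<lambda>i. Inl ` {i, par i} \<union> (\<lambda>n. Inr ({i, par i}, n)) ` {..<k - 2}"
  show ?thesis
  proof unfold_locales
    show "3 \<le> k" by fact
    show "edges (hpower k T) = ?g ` I" by (simp add: hpower_def E image_image)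
    show "verts (hpower k T) = insert (Inl r) (\<Union>i\<in>I. ?g i)"
      using par_in by (auto simp: hpower_def V E)
    show "card (?g i) = k" if "i \<in> I" for i
    proof -
      have "card (?g i) = card (Inl ` {i, par i} :: ('a + 'a set \<times> nat) set)
          + card ((\<lambda>n. Inr ({i, par i}, n) :: 'a + 'a set \<times> nat) ` {..<k - 2})"
        by (intro card_Un_disjoint) auto
      also have "\<dots> = 2 + (k - 2)" using neq[OF that] by (subst (1 2) card_image) (auto simp: inj_on_def)
      finally show ?thesis using \<open>k \<ge> 3\<close> by simp
    qed
    show "Inl i \<in> ?g i" "Inl (par i) \<in> ?g i" for i by auto
    show "Inl i \<noteq> Inl (par i)" if "i \<in> I" for i using neq[OF that] by simp
    show "(?g i - {Inl (par i)}) \<inter> (?g j - {Inl (par j)}) = {}" if "i \<in> I" "j \<in> I" "i \<noteq> j" for i j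
      using edge_inj[OF that(1,2)] that(3) by auto
    show "Inl r \<notin> ?g i - {Inl (par i)}" if "i \<in> I" for i using that root_notin by auto
  qed
qed

lemma power_tree_T:
  "k \<ge> 3 \<Longrightarrow> power_tree (T_nodes s t a b) CentreT T_par T_depth k (hpower k (T_tree s t a b)) Inl
    (\<lambda>i. Inl ` {i, T_par i} \<union> (\<lambda>n. Inr ({i, T_par i}, n)) ` {..<k - 2})"
  by (intro power_tree_hpower rooted_tree_T T_tree_eq) (auto simp: T_nodes_def)

fun T_swap :: "tvertex \<Rightarrow> tvertex" where
  "T_swap (ArmA i) = ArmB i"
| "T_swap (ArmB i) = ArmA i"
| "T_swap v = v"

text \<open>Balancing determines the arm lengths only up to order, whereas \<open>H1\<close> and
  \<open>H2\<close> list the arm of length \<open>d div 2\<close> first.\<close>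

lemma power_tree_T_swap:
  assumes "power_tree (T_nodes s t a b) CentreT T_par T_depth k G h g"
  shows "power_tree (T_nodes s t b a) CentreT T_par T_depth k G (h \<circ> T_swap) (g \<circ> T_swap)"
proof -
  interpret power_tree "T_nodes s t a b" CentreT T_par T_depth k G h g by fact
  have img: "T_nodes s t a b = T_swap ` T_nodes s t b a"
    by (auto simp: T_nodes_def image_Un image_image)
  have mem: "i \<in> T_nodes s t b a \<Longrightarrow> T_swap i \<in> T_nodes s t a b" for i
    unfolding img by (rule imageI)
  have par: "T_swap (T_par i) = T_par (T_swap i)" for i
    by (cases i) (auto split: nat.splits)
  have swap_inj: "T_swap i = T_swap j \<Longrightarrow> i = j" for i j by (cases i; cases j) auto
  show ?thesis
  proof (intro power_tree.intro rooted_tree_T power_tree_axioms.intro)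
    show "edges G = (g \<circ> T_swap) ` T_nodes s t b a" unfolding edges_eq img by (simp add: image_comp)
    show "verts G = insert ((h \<circ> T_swap) CentreT) (\<Union>i\<in>T_nodes s t b a. (g \<circ> T_swap) i)"
      unfolding verts_eq img by simp
    show "((g \<circ> T_swap) i - {(h \<circ> T_swap) (T_par i)}) \<inter> ((g \<circ> T_swap) j - {(h \<circ> T_swap) (T_par j)}) = {}"
      if "i \<in> T_nodes s t b a" "j \<in> T_nodes s t b a" "i \<noteq> j" for i j
      using disj[OF mem[OF that(1)] mem[OF that(2)]] swap_inj that(3) by (auto simp: par)
  qed (use k_ge_3 card_g h_in h_par_in h_neq root_disj mem in \<open>auto simp: par\<close>)
qed

text \<open>The share recursion is solved from the leaves upwards; the equation at the root then
  becomes the one for \<open>centre_share\<close>, and the inequalities record that all denominators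
  on the way are positive.\<close>

lemma power_tree_T_equations:
  assumes "power_tree (T_nodes s t a b) CentreT T_par T_depth k G h g"
    and \<alpha>: "0 \<le> \<alpha>" "\<alpha> < 1" and ev: "alpha_eigenvector k \<alpha> G l x"
  defines "C \<equiv> (1 - \<alpha>) ^ k / (l - \<alpha>) ^ (k - 2)"
  shows "\<alpha> < l" and "centre_share \<alpha> C l s t a b = l" and "\<alpha> + real s * arm_share \<alpha> C l 1 < l"
    and "j < a \<Longrightarrow> \<alpha> + arm_share \<alpha> C l j < l" and "j < b \<Longrightarrow> \<alpha> + arm_share \<alpha> C l j < l"
proof -
  let ?I = "T_nodes s t a b"
  interpret power_tree ?I CentreT T_par T_depth k G h g by fact
  define F where "F = share \<alpha> x"
  define K where "K i = (\<Sum>j | j \<in> ?I \<and> T_par j = i. F j)" for i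
  have K_eq: "K i = child_share \<alpha> x i" for i
    unfolding K_def F_def child_share_def[OF \<alpha> ev] ..
  let ?f = "arm_share \<alpha> C l"
  have rec: "F i = branch_share \<alpha> C l (K i)" and less: "\<alpha> + K i < l" if "i \<in> ?I" for i
    using share_recursion[OF \<alpha> ev that] child_share_less(1)[OF \<alpha> ev that]
    unfolding branch_share_def C_def F_def K_eq by auto
  show "\<alpha> < l" by (rule alpha_less[OF \<alpha> ev, of CentreS]) (simp add: T_nodes_def)
  have leaf: "F i = ?f 1" if "i \<in> ?I" "K i = 0" for i using rec[OF that(1)] that(2) by simp
  have "K (LeafS i) = 0" "K (LeafT i) = 0" for i
    unfolding K_def by (auto simp: T_nodes_def split: nat.splits intro!: sum.neutral)
  then have leafS: "i < s \<Longrightarrow> F (LeafS i) = ?f 1" and leafT: "i < t \<Longrightarrow> F (LeafT i) = ?f 1" for i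
    by (auto intro!: leaf simp: T_nodes_def simp del: arm_share.simps One_nat_def)
  have "{j \<in> ?I. T_par j = CentreS} = LeafS ` {..<s}"
    by (auto simp: T_nodes_def split: nat.splits)
  then have KS: "K CentreS = real s * ?f 1"
    unfolding K_def by (simp add: sum.reindex inj_on_def leafS del: arm_share.simps)
  show "\<alpha> + real s * ?f 1 < l" using less[of CentreS] unfolding KS by (simp add: T_nodes_def del: arm_share.simps)
  \<comment> \<open>\<open>X i\<close> has distance \<open>i + 1\<close> from the centre on an arm
    of length \<open>n\<close>, so \<open>n - Suc i\<close> edges lie below it. Stated for a generic
    arm in order to serve both; the induction runs from the tip inwards.\<close>
  have arm: "K (X i) = ?f (n - Suc i) \<and> F (X i) = ?f (n - i)"
    if "i < n" and X_in: "\<And>i. i < n \<Longrightarrow> X i \<in> ?I"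
      and children: "\<And>i. i < n \<Longrightarrow> {j \<in> ?I. T_par j = X i} = (if Suc i < n then {X (Suc i)} else {})"
    for X i n
    using that(1)
  proof (induction "n - i" arbitrary: i rule: less_induct)
    case less
    have "K (X i) = (if Suc i < n then F (X (Suc i)) else 0)"
      unfolding K_def children[OF less.prems] by simp
    also have "\<dots> = ?f (n - Suc i)" using less.hyps[of "Suc i"] less.prems by auto
    finally have K: "K (X i) = ?f (n - Suc i)" .
    have "F (X i) = branch_share \<alpha> C l (K (X i))" using X_in[OF less.prems] by (rule rec)
    also have "\<dots> = ?f (Suc (n - Suc i))" unfolding K by simp
    also have "Suc (n - Suc i) = n - i" using less.prems by simp
    finally show ?case using K by blast
  qed
  have armA: "K (ArmA i) = ?f (a - Suc i) \<and> F (ArmA i) = ?f (a - i)" if "i < a" for i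
    using that by (rule arm) (auto simp: T_nodes_def split: nat.splits)
  have armB: "K (ArmB i) = ?f (b - Suc i) \<and> F (ArmB i) = ?f (b - i)" if "i < b" for i
    using that by (rule arm) (auto simp: T_nodes_def split: nat.splits)
  show "\<alpha> + ?f j < l" if "j < a" using less[of "ArmA (a - Suc j)"] armA[of "a - Suc j"] that
    by (auto simp: T_nodes_def)
  show "\<alpha> + ?f j < l" if "j < b" using less[of "ArmB (b - Suc j)"] armB[of "b - Suc j"] that
    by (auto simp: T_nodes_def)
  have sum4: "sum F (S1 \<union> (S2 \<union> (S3 \<union> S4))) = sum F S1 + (sum F S2 + (sum F S3 + sum F S4))"
    if "finite S1" "finite S2" "finite S3" "finite S4" "S1 \<inter> S2 = {}" "S1 \<inter> S3 = {}" "S1 \<inter> S4 = {}"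
      "S2 \<inter> S3 = {}" "S2 \<inter> S4 = {}" "S3 \<inter> S4 = {}" for S1 S2 S3 S4
    using that by (simp add: sum.union_disjoint Int_Un_distrib)
  \<comment> \<open>The index sets for the arms are empty for arms of length zero, which agrees with
    \<open>arm_share\<close> being 0 there.\<close>
  have root: "{j \<in> ?I. T_par j = CentreT} = {CentreS} \<union> (LeafT ` {..<t} \<union> (ArmA ` {i. i = 0 \<and> 0 < a} \<union> ArmB ` {i. i = 0 \<and> 0 < b}))"
    by (auto simp: T_nodes_def split: nat.splits)
  have "K CentreT = sum F {CentreS} + ((\<Sum>j\<in>LeafT ` {..<t}. F j) + ((\<Sum>j\<in>ArmA ` {i. i = 0 \<and> 0 < a}. F j) + (\<Sum>j\<in>ArmB ` {i. i = 0 \<and> 0 < b}. F j)))"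
    unfolding K_def root by (rule sum4) auto
  also have "sum F {CentreS} = F CentreS" by simp
  also have "(\<Sum>j\<in>LeafT ` {..<t}. F j) = real t * ?f 1"
    by (simp add: sum.reindex inj_on_def leafT del: arm_share.simps)
  also have "(\<Sum>j\<in>ArmA ` {i. i = 0 \<and> 0 < a}. F j) = ?f a" using armA[of 0] by (cases "a > 0") auto
  also have "(\<Sum>j\<in>ArmB ` {i. i = 0 \<and> 0 < b}. F j) = ?f b" using armB[of 0] by (cases "b > 0") auto
  also have "F CentreS = branch_share \<alpha> C l (real s * ?f 1)"
    unfolding KS[symmetric] by (intro rec) (simp add: T_nodes_def)
  also have "K CentreT = l" unfolding K_eq by (rule child_share_root[OF \<alpha> ev])
  finally show "centre_share \<alpha> C l s t a b = l" unfolding centre_share_def by simp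
qed

section \<open>Supertrees and diametral paths\<close>

text \<open>Reachability by walks with edges in \<open>F\<close>. Walks need no distinctness, and
  deleting an edge just means passing to \<open>E - {e}\<close>.\<close>

definition joined :: "'a set set \<Rightarrow> ('a \<times> 'a) set" where
  "joined F = {(x, y). \<exists>e\<in>F. x \<in> e \<and> y \<in> e}\<^sup>*"

lemma joined_refl [simp]: "(x, x) \<in> joined F"
  by (simp add: joined_def)

lemma joined_edge: "e \<in> F \<Longrightarrow> x \<in> e \<Longrightarrow> y \<in> e \<Longrightarrow> (x, y) \<in> joined F"
  by (auto simp: joined_def)

lemma joined_trans: "(x, y) \<in> joined F \<Longrightarrow> (y, z) \<in> joined F \<Longrightarrow> (x, z) \<in> joined F"
  by (simp add: joined_def)

lemma joined_sym: "(x, y) \<in> joined F \<Longrightarrow> (y, x) \<in> joined F"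
  unfolding joined_def by (rule symD[OF sym_rtrancl]) (auto simp: sym_def)

lemma joined_mono: "(x, y) \<in> joined F \<Longrightarrow> F \<subseteq> F' \<Longrightarrow> (x, y) \<in> joined F'"
  unfolding joined_def by (erule subsetD[OF rtrancl_mono, rotated]) auto

text \<open>Cut the walk at its first use of \<open>e\<close>.\<close>

lemma joined_hit: "(x, y) \<in> joined F \<Longrightarrow> (x, y) \<in> joined (F - {e}) \<or> (\<exists>z\<in>e. (x, z) \<in> joined (F - {e}))"
  unfolding joined_def
proof (induction rule: rtrancl_induct)
  case (step y z)
  then obtain f where f: "f \<in> F" "y \<in> f" "z \<in> f" by auto
  show ?case
  proof (cases "f = e")
    case True
    then show ?thesis using step.IH f by blast
  next
    case False
    then have "(y, z) \<in> {(x, y). \<exists>e\<in>F - {e}. x \<in> e \<and> y \<in> e}" using f by auto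
    then show ?thesis using step.IH by (meson rtrancl.rtrancl_into_rtrancl)
  qed
qed simp

lemma hpath_joined:
  assumes "hpath G u vs es v" "i \<le> j" "j \<le> length es"
  shows "(vs ! i, vs ! j) \<in> joined ((!) es ` {i..<j})"
  using assms(2,3)
proof (induction j rule: dec_induct)
  case (step j)
  have "(vs ! i, vs ! j) \<in> joined ((!) es ` {i..<Suc j})"
    using step by (auto intro: joined_mono)
  moreover have "(vs ! j, vs ! Suc j) \<in> joined ((!) es ` {i..<Suc j})"
    using assms(1) step by (intro joined_edge[of "es ! j"]) (auto simp: hpath_def)
  ultimately show ?case by (rule joined_trans)
qed simp

lemma hpath_nth:
  assumes "hpath G u vs es v"
  shows "vs ! 0 = u" "vs ! length es = v"
proof -
  have "vs \<noteq> []" "length vs - 1 = length es" "hd vs = u" "last vs = v" using assms by (auto simp: hpath_def)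
  then show "vs ! 0 = u" "vs ! length es = v" by (metis hd_conv_nth, metis last_conv_nth)
qed

text \<open>A walk is turned into a path edge by edge: before appending an edge, the path is
  truncated at its first vertex in that edge, which keeps vertices and edges distinct.\<close>

lemma joined_hpath:
  assumes "(u, v) \<in> joined F" "F \<subseteq> edges G" "u \<in> verts G" and sub: "\<And>e. e \<in> edges G \<Longrightarrow> e \<subseteq> verts G"
  shows "\<exists>vs es. hpath G u vs es v \<and> set es \<subseteq> F"
  using assms(1) unfolding joined_def
proof (induction rule: rtrancl_induct)
  case base
  then show ?case using assms(3) by (intro exI[of _ "[u]"] exI[of _ "[]"]) (auto simp: hpath_def)
next
  case (step y w)
  then obtain vs es where p: "hpath G u vs es y" and sF: "set es \<subseteq> F" by blast
  obtain f where f: "f \<in> F" "y \<in> f" "w \<in> f" using step by auto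
  have len: "length vs = length es + 1" and dist: "distinct vs" "distinct es"
    and sets: "set vs \<subseteq> verts G" "set es \<subseteq> edges G"
    and inc: "\<And>i. i < length es \<Longrightarrow> vs ! i \<in> es ! i \<and> vs ! Suc i \<in> es ! i"
    using p by (auto simp: hpath_def)
  define i where "i = (LEAST i. vs ! i \<in> f)"
  have ex: "vs ! length es \<in> f" using hpath_nth(2)[OF p] f by simp
  have i: "vs ! i \<in> f" "i \<le> length es" unfolding i_def using ex by (auto intro: LeastI Least_le)
  have before: "vs ! j \<notin> f" if "j < i" for j using that not_less_Least unfolding i_def by blast
  let ?vs = "take (Suc i) vs" and ?es = "take i es"
  have nth_es: "?es ! j = es ! j" "?vs ! j = vs ! j" if "j < i" for j using that by auto
  have hd: "hd ?vs = u" using p len by (cases vs) (auto simp: hpath_def)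
  have take1: "hpath G u ?vs ?es (vs ! i)"
    unfolding hpath_def
  proof (intro conjI allI impI)
    show "length ?vs = length ?es + 1" using len i by simp
    show "last ?vs = vs ! i" using len i by (simp add: take_Suc_conv_app_nth)
    show "set ?vs \<subseteq> verts G" "set ?es \<subseteq> edges G" using sets by (meson order_trans set_take_subset)+
  qed (use dist hd inc i in auto)
  show ?case
  proof (cases "w = vs ! i")
    case True
    then show ?thesis using take1 sF by (metis order_trans set_take_subset)
  next
    case False
    have wnot: "w \<notin> set ?vs"
    proof
      assume "w \<in> set ?vs"
      then obtain j where j: "j < Suc i" "w = vs ! j" using len i by (auto simp: in_set_conv_nth)
      then show False using before[of j] f False by (cases "j = i") auto
    qed
    have fnot: "f \<notin> set ?es"
    proof
      assume "f \<in> set ?es"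
      then obtain j where "j < i" "f = es ! j" using i by (auto simp: in_set_conv_nth)
      then show False using inc[of j] before[of j] i by auto
    qed
    have "hpath G u (?vs @ [w]) (?es @ [f]) w"
      unfolding hpath_def
    proof (intro conjI allI impI)
      show "length (?vs @ [w]) = length (?es @ [f]) + 1" using len i by simp
      show "set (?vs @ [w]) \<subseteq> verts G" "set (?es @ [f]) \<subseteq> edges G"
        using take1 f sub assms(2) by (auto simp: hpath_def)
      show "hd (?vs @ [w]) = u" using hd len by (cases vs) auto
      fix j assume "j < length (?es @ [f])"
      then have "j < i \<or> j = i" using i by auto
      then show "(?vs @ [w]) ! j \<in> (?es @ [f]) ! j" "(?vs @ [w]) ! Suc j \<in> (?es @ [f]) ! j"
        using inc[of j] i f len by (auto simp: nth_append min_def)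
    qed (use wnot fnot dist in auto)
    moreover have "set (?es @ [f]) \<subseteq> F" using f sF set_take_subset[of i es] by auto
    ultimately show ?thesis by blast
  qed
qed

lemma hpath_rev:
  assumes "hpath G u vs es v" shows "hpath G v (rev vs) (rev es) u"
proof -
  have "vs \<noteq> []" using assms by (auto simp: hpath_def)
  moreover have "rev vs ! i \<in> rev es ! i \<and> rev vs ! Suc i \<in> rev es ! i" if "i < length es" for i
  proof -
    let ?j = "length es - Suc i"
    have "vs ! ?j \<in> es ! ?j \<and> vs ! Suc ?j \<in> es ! ?j" using assms that by (simp add: hpath_def)
    moreover have "Suc ?j = length es - i" using that by simp
    ultimately show ?thesis using assms that by (simp add: hpath_def rev_nth)
  qed
  ultimately show ?thesis using assms by (simp add: hpath_def hd_rev last_rev)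
qed

section \<open>Gates, distances and rooted structure in a supertree\<close>

locale supertree_hypergraph =
  fixes k :: nat and G :: "'a hypergraph"
  assumes uniform: "uniform k G" and k_ge_2: "k \<ge> 2" and supertree: "supertree G"
begin

abbreviation "V \<equiv> verts G"
abbreviation "E \<equiv> edges G"

lemma finite_V: "finite V" and edge_subset: "e \<in> E \<Longrightarrow> e \<subseteq> V" and card_edge: "e \<in> E \<Longrightarrow> card e = k"
  using uniform by (auto simp: uniform_def)

lemma finite_E: "finite E"
  using finite_V edge_subset by (meson finite_Pow_iff finite_subset PowI subsetI)

lemma finite_edge: "e \<in> E \<Longrightarrow> finite e"
  using finite_V edge_subset finite_subset by blast

lemma all_joined: "u \<in> V \<Longrightarrow> v \<in> V \<Longrightarrow> (u, v) \<in> joined E"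
proof -
  assume "u \<in> V" "v \<in> V"
  then obtain vs es where p: "hpath G u vs es v" using supertree unfolding supertree_def hconnected_def by blast
  have "(u, v) \<in> joined ((!) es ` {0..<length es})"
    using hpath_joined[OF p, of 0 "length es"] hpath_nth[OF p] by simp
  then show ?thesis by (rule joined_mono) (use p in \<open>auto simp: hpath_def\<close>)
qed

text \<open>A path joining two vertices of an edge that it avoids would close up to a cycle.\<close>
lemma edge_separates:
  assumes e: "e \<in> E" "u \<in> e" "v \<in> e" and j: "(u, v) \<in> joined (E - {e})"
  shows "u = v"
proof (rule ccontr)
  assume neq: "u \<noteq> v"
  obtain vs es where p: "hpath G u vs es v" "set es \<subseteq> E - {e}"
    using joined_hpath[OF j, of G] e edge_subset by blast
  have len: "length vs = length es + 1" using p by (simp add: hpath_def)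
  have "2 \<le> length (es @ [e])" using hpath_nth[OF p(1)] neq by (cases es) auto
  moreover have "vs ! i \<in> (es @ [e]) ! i \<and> vs ! (Suc i mod length (es @ [e])) \<in> (es @ [e]) ! i"
    if "i < length (es @ [e])" for i
    using that p hpath_nth[OF p(1)] e by (cases "i = length es") (auto simp: hpath_def nth_append)
  ultimately have "hcycle G vs (es @ [e])"
    using p e len unfolding hcycle_def by (auto simp: hpath_def)
  then show False using supertree by (auto simp: supertree_def hacyclic_def)
qed

lemma linked_G: "linked G"
  unfolding linked_def
proof (intro allI impI, rule ccontr)
  fix S assume S: "S \<subseteq> V \<and> S \<noteq> {} \<and> S \<noteq> V" and no: "\<not> (\<exists>e\<in>E. e \<inter> S \<noteq> {} \<and> e - S \<noteq> {})"
  then obtain u v where uv: "u \<in> S" "v \<in> V" "v \<notin> S" by blast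
  have "(u, v) \<in> joined E" using uv S by (intro all_joined) auto
  then have "v \<in> S" unfolding joined_def
    by (induction rule: rtrancl_induct) (use uv no in auto)
  then show False using uv by simp
qed

text \<open>The vertex of the edge \<open>e\<close> that is closest to \<open>r\<close>.\<close>
definition gate :: "'a set \<Rightarrow> 'a \<Rightarrow> 'a" where
  "gate e r = (THE y. y \<in> e \<and> (r, y) \<in> joined (E - {e}))"

lemma gate_eqI: "e \<in> E \<Longrightarrow> y \<in> e \<Longrightarrow> (r, y) \<in> joined (E - {e}) \<Longrightarrow> gate e r = y"
  unfolding gate_def
  by (rule the_equality) (blast intro: edge_separates joined_trans joined_sym)+

lemma
  assumes "e \<in> E" "r \<in> V"
  shows gate_in: "gate e r \<in> e" and gate_joined: "(r, gate e r) \<in> joined (E - {e})"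
proof -
  obtain x where "x \<in> e" using card_edge[OF assms(1)] k_ge_2 by fastforce
  then have "(r, x) \<in> joined E" using assms edge_subset by (intro all_joined) auto
  then obtain y where "y \<in> e" "(r, y) \<in> joined (E - {e})" using joined_hit[of r x E e] \<open>x \<in> e\<close> by blast
  then show "gate e r \<in> e" "(r, gate e r) \<in> joined (E - {e})" using gate_eqI[OF assms(1)] by auto
qed

lemma gate_self: "e \<in> E \<Longrightarrow> r \<in> e \<Longrightarrow> gate e r = r"
  by (intro gate_eqI) auto

text \<open>With \<open>r\<close> as root these sets partition the remaining vertices, as the blocks
  \<open>D i\<close> do in a power of a rooted tree. Hence attaching \<open>r\<close> to several of
  them creates no unwanted intersections.\<close>

definition away :: "'a \<Rightarrow> 'a set \<Rightarrow> 'a set" where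
  "away r e = e - {gate e r}"

lemma away_root: "e \<in> E \<Longrightarrow> r \<notin> away r e"
  using gate_self by (auto simp: away_def)

lemma card_away: "e \<in> E \<Longrightarrow> r \<in> V \<Longrightarrow> card (away r e) = k - 1"
  using gate_in card_edge by (simp add: away_def)

text \<open>Let \<open>z\<close> lie beyond both gates. Either the walk from \<open>r\<close> to the
  gate of \<open>e1\<close> avoids \<open>e2\<close>, and continuing inside \<open>e1\<close> makes
  \<open>z\<close> the gate of \<open>e2\<close>; or it reaches \<open>e2\<close> without
  \<open>e1\<close>, and continuing inside \<open>e2\<close> makes \<open>z\<close> the gate of
  \<open>e1\<close>.\<close>

lemma away_disjoint:
  assumes e: "e1 \<in> E" "e2 \<in> E" "e1 \<noteq> e2" and r: "r \<in> V"
  shows "away r e1 \<inter> away r e2 = {}"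
proof (rule ccontr)
  assume "away r e1 \<inter> away r e2 \<noteq> {}"
  then obtain z where z: "z \<in> e1" "z \<in> e2" "z \<noteq> gate e1 r" "z \<noteq> gate e2 r" by (auto simp: away_def)
  from joined_hit[OF gate_joined[OF e(1) r], of e2]
  show False
  proof
    assume "(r, gate e1 r) \<in> joined (E - {e1} - {e2})"
    then have "(r, gate e1 r) \<in> joined (E - {e2})" by (rule joined_mono) auto
    moreover have "(gate e1 r, z) \<in> joined (E - {e2})"
      using e z gate_in[OF e(1) r] by (intro joined_edge[of e1]) auto
    ultimately have "gate e2 r = z" using e z by (intro gate_eqI) (auto intro: joined_trans)
    then show False using z by simp
  next
    assume "\<exists>y\<in>e2. (r, y) \<in> joined (E - {e1} - {e2})"
    then obtain y where y: "y \<in> e2" "(r, y) \<in> joined (E - {e1} - {e2})" by blast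
    have "(r, y) \<in> joined (E - {e1})" using y(2) by (rule joined_mono) auto
    moreover have "(y, z) \<in> joined (E - {e1})" using e z y by (intro joined_edge[of e2]) auto
    ultimately have "gate e1 r = z" using e z by (intro gate_eqI) (auto intro: joined_trans)
    then show False using z by simp
  qed
qed

lemma hpath_gate:
  assumes p: "hpath G r vs es v" and i: "i < length es"
  shows "gate (es ! i) r = vs ! i" "es ! i \<in> E" "vs ! i \<noteq> vs ! Suc i" "vs ! Suc i \<in> es ! i"
proof -
  have d: "distinct es" "distinct vs" "length vs = length es + 1" "vs ! i \<in> es ! i" "vs ! Suc i \<in> es ! i"
    and E: "set es \<subseteq> E" using p i by (auto simp: hpath_def)
  show ei: "es ! i \<in> E" "vs ! Suc i \<in> es ! i" using E i d by auto
  show "vs ! i \<noteq> vs ! Suc i" using d i by (simp add: nth_eq_iff_index_eq)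
  have "(r, vs ! i) \<in> joined ((!) es ` {0..<i})" using hpath_joined[OF p, of 0 i] hpath_nth[OF p] i by simp
  then have "(r, vs ! i) \<in> joined (E - {es ! i})"
    by (rule joined_mono) (use d E i in \<open>auto simp: nth_eq_iff_index_eq\<close>)
  then show "gate (es ! i) r = vs ! i" using ei d by (intro gate_eqI) auto
qed

lemma away_cover:
  assumes "r \<in> V" "z \<in> V" "z \<noteq> r"
  shows "\<exists>e\<in>E. z \<in> away r e"
proof -
  obtain vs es where p: "hpath G r vs es z"
    using supertree assms unfolding supertree_def hconnected_def by blast
  have "length es \<noteq> 0" using hpath_nth[OF p] assms by auto
  then have i: "length es - 1 < length es" "Suc (length es - 1) = length es" by auto
  note h = hpath_gate[OF p i(1)]
  then show ?thesis using hpath_nth[OF p] i by (intro bexI[of _ "es ! (length es - 1)"]) (auto simp: away_def)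
qed

lemma two_edges_hdegree:
  assumes "e \<in> E" "f \<in> E" "e \<noteq> f" "v \<in> e" "v \<in> f"
  shows "2 \<le> hdegree G v"
proof -
  have "card {e, f} \<le> hdegree G v" unfolding hdegree_def using assms finite_E by (intro card_mono) auto
  then show ?thesis using assms by simp
qed

lemma hdegree_two_edges:
  assumes "2 \<le> hdegree G v"
  shows "\<exists>f\<in>E. f \<noteq> e \<and> v \<in> f"
proof (rule ccontr)
  assume "\<not> ?thesis"
  then have "{e \<in> E. v \<in> e} \<subseteq> {e}" by blast
  then have "card {e \<in> E. v \<in> e} \<le> card {e}" by (intro card_mono) auto
  then show False using assms by (simp add: hdegree_def)
qed

text \<open>A walk from \<open>r\<close> enters its gate through another edge. This is what makes
  maximality among vertices of degree at least two sufficient when a gate is replaced by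
  \<open>r\<close>.\<close>

lemma gate_hdegree:
  assumes "e \<in> E" "r \<in> V" "gate e r \<noteq> r"
  shows "2 \<le> hdegree G (gate e r)"
proof -
  from gate_joined[OF assms(1,2)] have "\<exists>f\<in>E - {e}. gate e r \<in> f"
    unfolding joined_def by (cases rule: rtranclE) (use assms(3) in auto)
  then obtain f where "f \<in> E - {e}" "gate e r \<in> f" by blast
  then show ?thesis using assms gate_in[OF assms(1,2)] by (intro two_edges_hdegree[of e f]) auto
qed

text \<open>Each edge of a path separates its ends, for otherwise the edge would have two gates; so
  every other path between them uses it too. Consequently any path realises the distance, and the
  diameter bounds the length of all paths.\<close>

lemma hpath_subset:
  assumes p: "hpath G u vs es v" and p': "hpath G u vs' es' v"
  shows "set es \<subseteq> set es'"
proof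
  fix e assume "e \<in> set es"
  then obtain i where i: "i < length es" "e = es ! i" by (auto simp: in_set_conv_nth)
  have d: "distinct es" "set es \<subseteq> E" using p by (auto simp: hpath_def)
  show "e \<in> set es'"
  proof (rule ccontr)
    assume "e \<notin> set es'"
    have "(u, v) \<in> joined ((!) es' ` {0..<length es'})"
      using hpath_joined[OF p', of 0 "length es'"] hpath_nth[OF p'] by simp
    then have uv: "(u, v) \<in> joined (E - {e})"
      by (rule joined_mono) (use p' \<open>e \<notin> set es'\<close> in \<open>auto simp: hpath_def\<close>)
    have "(vs ! Suc i, v) \<in> joined ((!) es ` {Suc i..<length es})"
      using hpath_joined[OF p, of "Suc i" "length es"] hpath_nth[OF p] i by simp
    then have "(vs ! Suc i, v) \<in> joined (E - {e})"
      by (rule joined_mono) (use d i in \<open>auto simp: nth_eq_iff_index_eq\<close>)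
    then have "(u, vs ! Suc i) \<in> joined (E - {e})" using uv joined_sym joined_trans by metis
    then have "gate e u = vs ! Suc i" using hpath_gate[OF p i(1)] i by (intro gate_eqI) auto
    then show False using hpath_gate[OF p i(1)] i by simp
  qed
qed

lemma hdist_hpath:
  assumes "hpath G u vs es v" shows "hdist G u v = length es"
  unfolding hdist_def
proof (rule Least_equality)
  show "\<exists>vs es'. hpath G u vs es' v \<and> length es' = length es" using assms by blast
  fix l assume "\<exists>vs es. hpath G u vs es v \<and> length es = l"
  then obtain vs' es' where p': "hpath G u vs' es' v" "length es' = l" by blast
  have "card (set es) \<le> card (set es')" using hpath_subset[OF assms p'(1)] by (intro card_mono) auto
  then show "length es \<le> l" using assms p' by (auto simp: hpath_def distinct_card)
qed

lemma diameter_path: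
  assumes "hdiameter G = d" "V \<noteq> {}"
  obtains vs es where "hpath G (hd vs) vs es (last vs)" "length es = d"
    "\<And>u vs' es' v. hpath G u vs' es' v \<Longrightarrow> length es' \<le> d"
proof -
  let ?S = "{hdist G u v | u v. u \<in> V \<and> v \<in> V}"
  have S: "?S = (\<lambda>(u, v). hdist G u v) ` (V \<times> V)" by auto
  have fin: "finite ?S" unfolding S using finite_V by auto
  have "Max ?S \<in> ?S" using fin assms(2) by (intro Max_in) (auto simp: S)
  then obtain u v where uv: "u \<in> V" "v \<in> V" "hdist G u v = d" using assms(1) unfolding hdiameter_def by auto
  obtain vs es where p: "hpath G u vs es v"
    using supertree uv unfolding supertree_def hconnected_def by blast
  show thesis
  proof (rule that[of vs es])
    show "hpath G (hd vs) vs es (last vs)" using p by (simp add: hpath_def)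
    show "length es = d" using hdist_hpath[OF p] uv by simp
    fix u vs' es' v assume p': "hpath G u vs' es' v"
    then have "vs' \<noteq> []" "set vs' \<subseteq> V" "hd vs' = u" "last vs' = v" by (auto simp: hpath_def)
    then have "u \<in> V" "v \<in> V" using hd_in_set last_in_set by blast+
    then have "hdist G u v \<le> Max ?S" using fin by (intro Max_ge) auto
    then show "length es' \<le> d" using hdist_hpath[OF p'] assms(1) unfolding hdiameter_def by simp
  qed
qed

end

text \<open>The joints \<open>p\<close> include the two ends \<open>p 0\<close> and
  \<open>p d\<close>. No ambient hypergraph is mentioned, because rerouting produces sequences whose
  sets need not be edges of the original one.\<close>

definition loose_seq :: "nat \<Rightarrow> (nat \<Rightarrow> 'a set) \<Rightarrow> (nat \<Rightarrow> 'a) \<Rightarrow> bool" where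
  "loose_seq d q p \<longleftrightarrow> inj_on p {..d} \<and> (\<forall>i<d. p i \<in> q i \<and> p (Suc i) \<in> q i) \<and>
     (\<forall>i j. i < j \<and> j < d \<longrightarrow> q i \<inter> q j = (if j = Suc i then {p j} else {}))"

lemma loose_seqD:
  assumes "loose_seq d q p"
  shows "i \<le> d \<Longrightarrow> j \<le> d \<Longrightarrow> p i = p j \<Longrightarrow> i = j"
    and "i < d \<Longrightarrow> p i \<in> q i" and "i < d \<Longrightarrow> p (Suc i) \<in> q i"
    and "i < j \<Longrightarrow> j < d \<Longrightarrow> z \<in> q i \<Longrightarrow> z \<in> q j \<Longrightarrow> j = Suc i \<and> z = p j"
    and "Suc i < d \<Longrightarrow> q i \<inter> q (Suc i) = {p (Suc i)}"
    and "Suc i < j \<Longrightarrow> j < d \<Longrightarrow> q i \<inter> q j = {}"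
proof -
  have *: "i < j \<Longrightarrow> j < d \<Longrightarrow> q i \<inter> q j = (if j = Suc i then {p j} else {})" for i j
    using assms unfolding loose_seq_def by blast
  show "i < j \<Longrightarrow> j < d \<Longrightarrow> z \<in> q i \<Longrightarrow> z \<in> q j \<Longrightarrow> j = Suc i \<and> z = p j"
    using *[of i j] by (auto split: if_splits)
  show "Suc i < d \<Longrightarrow> q i \<inter> q (Suc i) = {p (Suc i)}" using *[of i "Suc i"] by simp
  show "Suc i < j \<Longrightarrow> j < d \<Longrightarrow> q i \<inter> q j = {}" using *[of i j] by simp
qed (use assms in \<open>auto simp: loose_seq_def inj_on_def\<close>)

lemma loose_seq_vertex:
  assumes "loose_seq d q p" "m \<le> d" "i < d" "p m \<in> q i"
  shows "m = i \<or> m = Suc i"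
proof (rule ccontr)
  note L = loose_seqD[OF assms(1)]
  assume "\<not> ?thesis"
  then consider "m < i" | "Suc i < m" by linarith
  then show False
  proof cases
    case 1
    then show False using L(4)[of m i "p m"] L(2)[of m] L(1)[of m i] assms by auto
  next
    case 2
    then obtain n where n: "m = Suc n" "i < n" by (cases m) auto
    then show False using L(4)[of i n "p m"] L(3)[of n] L(1)[of m n] assms by auto
  qed
qed

text \<open>The vertex \<open>w\<close> takes over as the joint of \<open>q i\<close> and
  \<open>q (Suc i)\<close>. The old joint is dropped only from \<open>q (Suc i)\<close> and stays an
  ordinary vertex of \<open>q i\<close>, so the union does not change.\<close>

lemma loose_seq_rotate:
  assumes "loose_seq d q p" "Suc i < d" "w \<in> q i" "w \<noteq> p i" "w \<noteq> p (Suc i)"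
  shows "loose_seq d (q(Suc i := insert w (q (Suc i) - {p (Suc i)}))) (p(Suc i := w))" (is "loose_seq d ?q ?p")
    and "(\<Union>j<d. (q(Suc i := insert w (q (Suc i) - {p (Suc i)}))) j) = (\<Union>j<d. q j)"
proof -
  note L = loose_seqD[OF assms(1)]
  have w_neq: "w \<noteq> p m" if "m \<le> d" for m
    using loose_seq_vertex[OF assms(1) that, of i] assms by auto
  have w_notin: "w \<notin> q j" if "j < d" "j \<noteq> i" for j
    using that L(4)[of i j w] L(4)[of j i w] w_neq[of j] w_neq[of i] assms by (cases "i < j") auto
  show "loose_seq d ?q ?p"
    unfolding loose_seq_def
  proof (intro conjI allI impI)
    show "inj_on ?p {..d}" using L(1) w_neq by (auto simp: inj_on_def)
    show "?p j \<in> ?q j" if "j < d" for j using L(2)[OF that] by auto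
    show "?p (Suc j) \<in> ?q j" if "j < d" for j
      using L(3)[OF that] L(1)[of "Suc j" "Suc i"] that assms by auto
    fix a b assume "a < b \<and> b < d"
    then have ab: "a < b" "b < d" by auto
    have aux3: "insert w (A - {x}) \<inter> B = {y}" if "A \<inter> B = {y}" "w \<notin> B" "y \<noteq> x" for A B x y
      using that by auto
    have aux4: "insert w (A - {x}) \<inter> B = {}" if "A \<inter> B = {}" "w \<notin> B" for A B x
      using that by auto
    show "?q a \<inter> ?q b = (if b = Suc a then {?p b} else {})"
    proof (cases "a = Suc i \<or> b = Suc i")
      case False
      then show ?thesis using L(5)[of a] L(6)[of a b] ab by auto
    next
      case True
      then consider "b = Suc i" "a = i" | "b = Suc i" "a < i" | "a = Suc i" "b = Suc a" | "a = Suc i" "Suc a < b"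
        using ab by linarith
      then show ?thesis
      proof cases
        case 1
        then show ?thesis using L(5)[of i] assms by auto
      next
        case 2
        then have "q a \<inter> q b = {}" "w \<notin> q a" "b \<noteq> Suc a" "a \<noteq> Suc i"
          using L(6)[of a b] w_notin[of a] ab by auto
        then show ?thesis using 2(1) by auto
      next
        case 3
        have "q a \<inter> q b = {p b}" using L(5)[of a] 3(2) ab by simp
        moreover have "w \<notin> q b" by (rule w_notin) (use 3 ab in simp_all)
        moreover have "p b \<noteq> p a"
        proof
          assume "p b = p a"
          then have "b = a" by (rule L(1)[rotated 2]) (use ab in simp_all)
          then show False using ab by simp
        qed
        moreover have "b \<noteq> Suc i" "b = Suc a" using 3 by simp_all
        ultimately show ?thesis using aux3[of "q a" "q b" "p b" "p a"] 3(1) by simp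
      next
        case 4
        have "q a \<inter> q b = {}" by (rule L(6)) (use 4 ab in simp_all)
        moreover have "w \<notin> q b" by (rule w_notin) (use 4 ab in simp_all)
        moreover have "b \<noteq> Suc a" "b \<noteq> Suc i" using 4 by simp_all
        ultimately show ?thesis using aux4[of "q a" "q b" "p a"] 4(1) by simp
      qed
    qed
  qed
  show "(\<Union>j<d. ?q j) = (\<Union>j<d. q j)"
  proof
    show "(\<Union>j<d. ?q j) \<subseteq> (\<Union>j<d. q j)" using assms by (auto split: if_splits)
    show "(\<Union>j<d. q j) \<subseteq> (\<Union>j<d. ?q j)"
    proof
      fix z assume "z \<in> (\<Union>j<d. q j)"
      then obtain j where j: "j < d" "z \<in> q j" by blast
      show "z \<in> (\<Union>j<d. ?q j)"
      proof (cases "z = p (Suc i)")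
        case True
        then show ?thesis using L(3)[of i] assms by (intro UN_I[of i]) auto
      next
        case False
        then show ?thesis using j by (intro UN_I[of j]) auto
      qed
    qed
  qed
qed

section \<open>A diametral path and the edges off it\<close>

locale diametral_path = supertree_hypergraph k G for k and G :: "'a hypergraph" +
  fixes d :: nat and vs :: "'a list" and es :: "'a set list"
  assumes path: "hpath G (hd vs) vs es (last vs)" and length_es: "length es = d" and d_ge_2: "2 \<le> d"
    and longest: "hpath G u vs' es' v \<Longrightarrow> length es' \<le> d"
begin

abbreviation "p \<equiv> (!) vs"
abbreviation "q \<equiv> (!) es"

definition U :: "'a set" where "U = \<Union>(set es)"
definition Off :: "'a set set" where "Off = E - set es"

lemma distinct_path: "distinct vs" "distinct es" and length_vs: "length vs = Suc d"
  and path_subset: "set vs \<subseteq> V" "set es \<subseteq> E"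
  and path_in: "i < d \<Longrightarrow> p i \<in> q i" "i < d \<Longrightarrow> p (Suc i) \<in> q i"
  using path length_es by (auto simp: hpath_def)

lemma q_in: "i < d \<Longrightarrow> q i \<in> E"
  using path_subset length_es by auto

lemma set_es: "set es = q ` {..<d}"
  using length_es by (auto simp: set_conv_nth)

lemma inj_q: "inj_on q {..<d}"
  using distinct_path length_es by (auto simp: inj_on_def nth_eq_iff_index_eq)

lemma p_inj: "i \<le> d \<Longrightarrow> j \<le> d \<Longrightarrow> p i = p j \<Longrightarrow> i = j"
  using distinct_path length_vs by (simp add: nth_eq_iff_index_eq)

lemma U_eq: "U = (\<Union>i<d. q i)"
  unfolding U_def set_es by blast

lemma U_subset: "U \<subseteq> V"
  unfolding U_eq using q_in edge_subset by blast

lemma p_in_U: "i \<le> d \<Longrightarrow> p i \<in> U"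
  using path_in(1)[of i] path_in(2)[of "i - 1"] d_ge_2 unfolding U_eq by (cases "i < d") auto

lemma Off_in: "e \<in> Off \<Longrightarrow> e \<in> E" and Off_notin: "e \<in> Off \<Longrightarrow> e \<notin> set es"
  by (auto simp: Off_def)

lemma path_joined: "i \<le> j \<Longrightarrow> j \<le> d \<Longrightarrow> (p i, p j) \<in> joined (q ` {i..<j})"
  using hpath_joined[OF path] length_es by blast

lemma q_minus: "i < d \<Longrightarrow> S \<subseteq> {..<d} - {i} \<Longrightarrow> q ` S \<subseteq> E - {q i}"
  using q_in inj_onD[OF inj_q, of _ i] by blast

lemma loose_seq_path: "loose_seq d q p"
  unfolding loose_seq_def
proof (intro conjI allI impI)
  show "inj_on p {..d}" using p_inj by (auto simp: inj_on_def)
  show "p i \<in> q i" "p (Suc i) \<in> q i" if "i < d" for i using path_in that by auto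
  fix i j assume "i < j \<and> j < d"
  then have ij: "i < j" "j < d" by auto
  have *: "j = Suc i \<and> y = p j" if y: "y \<in> q i" "y \<in> q j" for y
  proof -
    have pj: "p j \<in> q j" "p (Suc i) \<in> q i" using path_in ij by auto
    have "(y, p (Suc i)) \<in> joined (E - {q j})"
      using ij y pj q_minus[of j "{i}"] by (intro joined_edge[of "q i"]) auto
    moreover have "(p (Suc i), p j) \<in> joined (E - {q j})"
      by (rule joined_mono[OF path_joined q_minus]) (use ij in auto)
    ultimately have yj: "y = p j"
      using ij y pj q_in by (intro edge_separates[of "q j"]) (auto intro: joined_trans)
    have "(p j, p (Suc i)) \<in> joined (E - {q i})"
      by (rule joined_sym[OF joined_mono[OF path_joined q_minus]]) (use ij in auto)
    then have "p j = p (Suc i)" using ij y pj q_in yj by (intro edge_separates[of "q i"]) auto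
    then show ?thesis using p_inj[of j "Suc i"] ij yj by auto
  qed
  show "q i \<inter> q j = (if j = Suc i then {p j} else {})"
  proof (cases "j = Suc i")
    case True
    have "p j \<in> q i" "p j \<in> q j" using path_in(2)[of i] path_in(1)[of j] ij True by simp_all
    then have "q i \<inter> q j = {p j}" using * by blast
    then show ?thesis using True by simp
  next
    case False
    then have "q i \<inter> q j = {}" using * by blast
    then show ?thesis using False by simp
  qed
qed

lemmas L = loose_seqD[OF loose_seq_path]

lemma U_joined:
  assumes "x \<in> U" "y \<in> U" shows "(x, y) \<in> joined (set es)"
proof -
  obtain i j where ij: "i < d" "x \<in> q i" "j < d" "y \<in> q j" using assms unfolding U_eq by blast
  have all: "(p i, p j) \<in> joined (set es)" if "i \<le> j" "j \<le> d" for i j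
    using path_joined[OF that] by (rule joined_mono) (use that in \<open>auto simp: set_es\<close>)
  have "(p i, p j) \<in> joined (set es)"
    using all[of i j] all[of j i] ij joined_sym by (cases "i \<le> j") auto
  moreover have "(x, p i) \<in> joined (set es)" by (rule joined_edge[of "q i"]) (use ij path_in set_es in auto)
  moreover have "(p j, y) \<in> joined (set es)" by (rule joined_edge[of "q j"]) (use ij path_in set_es in auto)
  ultimately show ?thesis by (blast intro: joined_trans)
qed

text \<open>The path stays connected when \<open>e\<close> is deleted. Hence an edge off the path
  meets it in at most one vertex, which is its gate as seen from anywhere on the path.\<close>

lemma gate_Off:
  assumes "e \<in> Off" "x \<in> e" "x \<in> U" "r \<in> U"
  shows "gate e r = x"
proof (rule gate_eqI)
  show "(r, x) \<in> joined (E - {e})"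
    using U_joined[OF assms(4,3)] by (rule joined_mono) (use path_subset assms in \<open>auto simp: Off_def\<close>)
qed (use assms in \<open>auto simp: Off_def\<close>)

lemma away_Off: "e \<in> Off \<Longrightarrow> r \<in> U \<Longrightarrow> away r e \<inter> U = {}"
  using gate_Off by (auto simp: away_def)

text \<open>Otherwise the diametral path could be prolonged through \<open>f\<close>.\<close>

lemma Off_first:
  assumes f: "f \<in> Off" "w \<in> f" "w \<in> q 0"
  shows "w = p 1"
proof (rule ccontr)
  assume neq: "w \<noteq> p 1"
  have fE: "f \<in> E" using f Off_in by blast
  have "\<not> f \<subseteq> {w}" using card_edge[OF fE] k_ge_2 card_mono[of "{w}" f] by auto
  then obtain y where y: "y \<in> f" "y \<noteq> w" by blast
  have wU: "w \<in> U" using f d_ge_2 unfolding U_eq by force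
  have yU: "y \<notin> U" using gate_Off[OF f(1,2) wU wU] gate_Off[OF f(1) y(1) _ wU] y by auto
  have w_nth: "w \<noteq> p i" if "0 < i" "i \<le> d" for i
    using loose_seq_vertex[OF loose_seq_path that(2), of 0] d_ge_2 f(3) neq that by auto
  obtain v0 vs' where vs: "vs = v0 # vs'" using length_vs by (cases vs) auto
  have nth_vs': "vs' ! i = p (Suc i)" for i using vs by simp
  have len': "length vs' = d" using vs length_vs by simp
  \<comment> \<open>The start \<open>p 0\<close> is replaced by \<open>y\<close>, \<open>w\<close>.
    Since \<open>w\<close> and \<open>p 1\<close> are distinct vertices of \<open>q 0\<close>, the
    route continues along \<open>es\<close> and has \<open>d + 1\<close> edges.\<close>
  have "hpath G y (y # w # vs') (f # es) (last vs)"
    unfolding hpath_def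
  proof (intro conjI allI impI)
    show "length (y # w # vs') = length (f # es) + 1" using length_vs vs length_es by simp
    have in_vs': "\<exists>i<d. z = p (Suc i)" if "z \<in> set vs'" for z
      using that nth_vs' len' by (metis in_set_conv_nth)
    have "w \<notin> set vs'"
    proof
      assume "w \<in> set vs'"
      then obtain i where "i < d" "w = p (Suc i)" using in_vs' by blast
      then show False using w_nth[of "Suc i"] by simp
    qed
    moreover have "y \<notin> set vs'"
    proof
      assume "y \<in> set vs'"
      then obtain i where "i < d" "y = p (Suc i)" using in_vs' by blast
      then show False using p_in_U[of "Suc i"] yU by simp
    qed
    ultimately show "distinct (y # w # vs')" using y distinct_path vs by auto
    show "distinct (f # es)" using f distinct_path Off_notin by auto
    show "set (y # w # vs') \<subseteq> V" using y wU U_subset fE edge_subset path_subset vs by auto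
    show "set (f # es) \<subseteq> E" using fE path_subset by auto
    show "hd (y # w # vs') = y" by simp
    show "last (y # w # vs') = last vs" using vs length_vs d_ge_2 by auto
    fix i assume i: "i < length (f # es)"
    show "(y # w # vs') ! i \<in> (f # es) ! i"
    proof (cases i)
      case (Suc n)
      then show ?thesis using f path_in(1)[of n] nth_vs' i length_es by (cases n) auto
    qed (use y in simp)
    show "(y # w # vs') ! Suc i \<in> (f # es) ! i"
    proof (cases i)
      case (Suc n)
      then show ?thesis using f path_in(2)[of n] nth_vs' i length_es by (cases n) auto
    qed (use f in simp)
  qed
  then show False using longest length_es by fastforce
qed

end

text \<open>The mirror image of \<open>Off_first\<close>, obtained by interpreting the locale with
  the reversed path.\<close>

lemma (in diametral_path) Off_last:
  assumes f: "f \<in> Off" "w \<in> f" "w \<in> q (d - 1)"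
  shows "w = p (d - 1)"
proof -
  have ne: "vs \<noteq> []" using length_vs by auto
  interpret R: diametral_path k G d "rev vs" "rev es"
    using hpath_rev[OF path] ne length_es d_ge_2 longest
    by unfold_locales (auto simp: hd_rev last_rev)
  have "f \<in> R.Off" using f(1) by (simp add: R.Off_def Off_def)
  moreover have "w \<in> rev es ! 0" using f(3) length_es d_ge_2 by (simp add: rev_nth)
  ultimately have "w = rev vs ! 1" using R.Off_first f(2) by blast
  then show ?thesis using length_vs d_ge_2 by (simp add: rev_nth)
qed

context diametral_path
begin

text \<open>The alternatives are tailored to \<open>junction\<close>: an inner joint can serve as
  centre at once, and any other vertex lies in an edge with a successor, so that rotation applies.
  The last edge is excluded because edges off the path meet it only at its inner joint.\<close>

lemma U_hdegree_cases:
  assumes M: "M \<in> U" "2 \<le> hdegree G M"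
  shows "(\<exists>j. 0 < j \<and> j < d \<and> M = p j) \<or> (\<exists>i. Suc i < d \<and> M \<in> q i \<and> M \<noteq> p i \<and> M \<noteq> p (Suc i))"
proof -
  obtain i where i: "i < d" "M \<in> q i" using M unfolding U_eq by blast
  obtain f where f: "f \<in> E" "f \<noteq> q i" "M \<in> f" using hdegree_two_edges[OF M(2)] by blast
  show ?thesis
  proof (cases "f \<in> set es")
    case True
    then obtain j where j: "j < d" "f = q j" unfolding set_es by blast
    then have "i < j \<or> j < i" using f by (metis linorder_neqE_nat)
    then show ?thesis
    proof
      assume "i < j"
      then have "M = p j" using L(4)[of i j M] i j f by blast
      then show ?thesis using \<open>i < j\<close> j by (intro disjI1 exI[of _ j]) simp
    next
      assume "j < i"
      then have "M = p i" using L(4)[of j i M] i j f by blast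
      then show ?thesis using \<open>j < i\<close> i by (intro disjI1 exI[of _ i]) simp
    qed
  next
    case False
    then have fO: "f \<in> Off" using f by (simp add: Off_def)
    have first: "M \<in> q 0 \<Longrightarrow> M = p 1" using Off_first[OF fO f(3)] .
    have last: "M \<in> q (d - 1) \<Longrightarrow> M = p (d - 1)" using Off_last[OF fO f(3)] .
    have end0: "M \<noteq> p 0" using first path_in(1)[of 0] p_inj[of 0 1] d_ge_2 by auto
    have endd: "M \<noteq> p d"
    proof
      assume "M = p d"
      then have "M \<in> q (d - 1)" using path_in(2)[of "d - 1"] d_ge_2 by simp
      then have "p d = p (d - 1)" using last \<open>M = p d\<close> by simp
      then show False using p_inj[of d "d - 1"] d_ge_2 by simp
    qed
    show ?thesis
    proof (cases "M = p i \<or> M = p (Suc i)")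
      case True
      then obtain j where "M = p j" "j \<le> d" using i by (metis Suc_leI less_imp_le_nat)
      then have "0 < j" "j < d" using end0 endd by (metis gr0I, metis le_neq_implies_less)
      then show ?thesis using \<open>M = p j\<close> by blast
    next
      case False
      then have "i \<noteq> d - 1" using last i by blast
      then show ?thesis using False i by (intro disjI2 exI[of _ i]) simp
    qed
  qed
qed

text \<open>If every edge off the path met it, these edges would all be pendant, as would the two
  end edges, while each inner path edge contains two joints of degree at least two. What remains
  after removal would be the inner part of the path, a loose path.\<close>

lemma exists_detached:
  assumes "\<not> caterpillar G"
  shows "\<exists>g\<in>Off. g \<inter> U = {}"
proof (rule ccontr)
  assume "\<not> ?thesis"
  then have touch: "\<And>g. g \<in> Off \<Longrightarrow> g \<inter> U \<noteq> {}" by blast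
  have deg1: "hdegree G z = 1" if "e \<in> E" "z \<in> e" "\<And>f. f \<in> E \<Longrightarrow> z \<in> f \<Longrightarrow> f = e" for e z
  proof -
    have "{f \<in> E. z \<in> f} = {e}" using that by blast
    then show ?thesis by (simp add: hdegree_def)
  qed
  have pendant_Off: "pendant_edge G g" if g: "g \<in> Off" for g
  proof -
    obtain w where w: "w \<in> g" "w \<in> U" using touch[OF g] by blast
    have "hdegree G z = 1" if z: "z \<in> g - {w}" for z
    proof (rule deg1[of g])
      fix f assume f: "f \<in> E" "z \<in> f"
      have zU: "z \<notin> U" using gate_Off[OF g w w(2)] gate_Off[OF g _ _ w(2), of z] z by auto
      show "f = g"
      proof (rule ccontr)
        assume "f \<noteq> g"
        have fO: "f \<in> Off" using f zU by (auto simp: Off_def U_def)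
        then obtain w' where w': "w' \<in> f" "w' \<in> U" using touch by blast
        have "gate f w = w'" "gate g w = w" using gate_Off fO g w w' by auto
        then have "z \<in> away w f" "z \<in> away w g" using z f zU w' by (auto simp: away_def)
        then show False using away_disjoint[of f g w] f Off_in[OF g] \<open>f \<noteq> g\<close> w U_subset by blast
      qed
    qed (use z g Off_in in auto)
    then show ?thesis unfolding pendant_edge_def using g Off_in by blast
  qed
  have pendant_end: "pendant_edge G (q i)" if "i = 0 \<and> u = p 1 \<or> i = d - 1 \<and> u = p (d - 1)" for i u
  proof -
    have id: "i < d" using that d_ge_2 by auto
    have "hdegree G z = 1" if z: "z \<in> q i - {u}" for z
    proof (rule deg1[of "q i"])
      fix f assume f: "f \<in> E" "z \<in> f"
      show "f = q i"
      proof (rule ccontr)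
        assume "f \<noteq> q i"
        then have "2 \<le> hdegree G z" using two_edges_hdegree[of f "q i" z] f z q_in[OF id] by blast
        moreover have "f \<notin> Off"
          using Off_first[of f z] Off_last[of f z] f z \<open>i = 0 \<and> u = p 1 \<or> i = d - 1 \<and> u = p (d - 1)\<close> by auto
        then obtain j where j: "j < d" "f = q j" using f unfolding Off_def set_es by blast
        then have "i < j \<or> j < i" using \<open>f \<noteq> q i\<close> by (metis linorder_neqE_nat)
        then show False
          using L(4)[of i j z] L(4)[of j i z] f z j id \<open>i = 0 \<and> u = p 1 \<or> i = d - 1 \<and> u = p (d - 1)\<close> by auto
      qed
    qed (use z q_in id in auto)
    then show ?thesis unfolding pendant_edge_def using q_in[OF id] by blast
  qed
  have not_pendant: "\<not> pendant_edge G (q i)" if i: "0 < i" "Suc i < d" for i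
  proof
    assume "pendant_edge G (q i)"
    then obtain u where u: "\<And>v. v \<in> q i - {u} \<Longrightarrow> hdegree G v = 1" unfolding pendant_edge_def by blast
    have i1: "i - 1 < d" "i - 1 \<noteq> i" using i by simp_all
    have neq: "q (i - 1) \<noteq> q i" "q i \<noteq> q (Suc i)"
      using inj_onD[OF inj_q, of "i - 1" i] inj_onD[OF inj_q, of i "Suc i"] i i1 by auto
    have "2 \<le> hdegree G (p i)"
      using path_in(1)[of i] path_in(2)[of "i - 1"] i q_in neq
      by (intro two_edges_hdegree[of "q (i - 1)" "q i"]) auto
    moreover have "2 \<le> hdegree G (p (Suc i))"
      using path_in(1)[of "Suc i"] path_in(2)[of i] i q_in neq
      by (intro two_edges_hdegree[of "q i" "q (Suc i)"]) auto
    ultimately have "p i = u" "p (Suc i) = u"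
      using u[of "p i"] u[of "p (Suc i)"] path_in(1)[of i] path_in(2)[of i] i by force+
    then show False using p_inj[of i "Suc i"] i by simp
  qed
  let ?P = "{e. pendant_edge G e}"
  let ?es = "map q [1..<d - 1]"
  have set_es': "set ?es = E - ?P"
  proof
    show "set ?es \<subseteq> E - ?P" using not_pendant q_in by auto
    show "E - ?P \<subseteq> set ?es"
    proof
      fix e assume e: "e \<in> E - ?P"
      then have "e \<notin> Off" using pendant_Off by blast
      then obtain i where i: "i < d" "e = q i" using e unfolding Off_def set_es by blast
      have "pendant_edge G (q 0)" "pendant_edge G (q (d - 1))" using pendant_end by blast+
      then have "i \<noteq> 0" "i \<noteq> d - 1" using e i(2) by (metis DiffD2 mem_Collect_eq)+
      then show "e \<in> set ?es" using i by auto
    qed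
  qed
  have "E \<noteq> {}" using q_in[of 0] d_ge_2 by auto
  have cover: "V = \<Union>E"
  proof
    show "V \<subseteq> \<Union>E"
    proof
      fix v assume v: "v \<in> V"
      show "v \<in> \<Union>E"
      proof (cases "v = p 0")
        case True
        then show ?thesis using path_in(1)[of 0] q_in[of 0] d_ge_2 by auto
      next
        case False
        then show ?thesis using away_cover[of "p 0" v] v p_in_U[of 0] U_subset by (auto simp: away_def)
      qed
    qed
  qed (use edge_subset in blast)
  have rem: "remove_pendant_edges G = Hypergraph (V - (\<Union>?P - \<Union>(set ?es))) (set ?es)"
    unfolding remove_pendant_edges_def Let_def set_es' ..
  have rem_V: "V - (\<Union>?P - \<Union>(set ?es)) = \<Union>(set ?es)" if "?es \<noteq> []"
    unfolding set_es' cover by blast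
  have "loose_path (remove_pendant_edges G)"
    unfolding loose_path_def
  proof (intro exI[of _ ?es] conjI allI impI)
    have "set [1..<d - 1] \<subseteq> {..<d}" by auto
    then show "distinct ?es" using inj_on_subset[OF inj_q] by (simp only: distinct_map distinct_upt simp_thms)
    show "set ?es = edges (remove_pendant_edges G)" unfolding rem by simp
    show "if ?es = [] then card (verts (remove_pendant_edges G)) \<le> 1
      else verts (remove_pendant_edges G) = \<Union>(set ?es)"
    proof (cases "?es = []")
      case False
      then show ?thesis unfolding rem using rem_V by simp
    next
      \<comment> \<open>The list is empty exactly for \<open>d = 2\<close>; then all edges are
        pendant and no vertex is left.\<close>
      case True
      have empty: "V - (\<Union>?P - \<Union>(set ?es)) = {}"
      proof -
        have "E \<subseteq> ?P" using set_es' True by auto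
        then show ?thesis unfolding True cover by auto
      qed
      have "verts (remove_pendant_edges G) = {}" unfolding rem hypergraph.sel(1) by (rule empty)
      then show ?thesis using True by (simp del: map_is_Nil_conv)
    qed
    fix i j assume ij: "i < length ?es" "j < length ?es"
    then have nth: "?es ! i = q (Suc i)" "?es ! j = q (Suc j)" and d: "Suc i < d" "Suc j < d" by auto
    show "card (?es ! i \<inter> ?es ! j) = 1" if "j = Suc i" using L(5)[of "Suc i"] d that unfolding nth by simp
    show "?es ! i \<inter> ?es ! j = {}" if "Suc i < j" using L(6)[of "Suc i" "Suc j"] d that unfolding nth by simp
  qed
  then show False using assms supertree by (simp add: caterpillar_def)
qed

text \<open>\<open>f\<close> is the edge through which the route from \<open>M\<close> enters the
  path. Seen from \<open>M\<close>, it touches the path beyond its gate, at \<open>w\<close>; any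
  other edge off the path can touch it only at its gate, so replacing that gate by \<open>M\<close>
  detaches it from the path.\<close>

lemma crossing:
  assumes M: "M \<in> V" "M \<notin> U"
  obtains f w where "f \<in> Off" "w \<in> f" "w \<in> U" "w \<noteq> gate f M"
    "\<And>e z. e \<in> Off \<Longrightarrow> e \<noteq> f \<Longrightarrow> z \<in> e \<Longrightarrow> z \<in> U \<Longrightarrow> z = gate e M"
proof -
  have p0: "p 0 \<in> U" using p_in_U[of 0] by simp
  obtain vs' es' where h: "hpath G M vs' es' (p 0)"
    using supertree M p0 U_subset unfolding supertree_def hconnected_def by blast
  define i where "i = (LEAST i. vs' ! i \<in> U)"
  have ex: "vs' ! length es' \<in> U" using hpath_nth(2)[OF h] p0 by simp
  have i: "vs' ! i \<in> U" "i \<le> length es'" unfolding i_def using ex by (auto intro: LeastI Least_le)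
  have "i \<noteq> 0" using i hpath_nth(1)[OF h] M by (cases i) auto
  then obtain n where n: "i = Suc n" by (cases i) auto
  then have "vs' ! n \<notin> U" using not_less_Least[of n "\<lambda>i. vs' ! i \<in> U", folded i_def] by simp
  let ?f = "es' ! n" and ?w = "vs' ! Suc n"
  have "n < length es'" using i n by simp
  note g = hpath_gate[OF h this]
  have "vs' ! n \<in> ?f" using h \<open>n < length es'\<close> by (simp add: hpath_def)
  then have fO: "?f \<in> Off" using g(2) \<open>vs' ! n \<notin> U\<close> by (auto simp: Off_def U_def)
  show thesis
  proof (rule that[of ?f ?w])
    show "?f \<in> Off" "?w \<in> ?f" "?w \<in> U" "?w \<noteq> gate ?f M" using fO g i n by auto
    fix e z assume e: "e \<in> Off" "e \<noteq> ?f" "z \<in> e" "z \<in> U"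
    have eE: "e \<in> E" "?f \<in> E" using e(1) fO Off_in by auto
    have wz: "(?w, z) \<in> joined (E - {f'})" if "f' \<in> Off" for f'
    proof -
      have "(?w, z) \<in> joined (set es)" using U_joined[of ?w z] i n e by auto
      then show ?thesis by (rule joined_mono) (use path_subset Off_notin[OF that] in auto)
    qed
    from joined_hit[OF gate_joined[OF eE(2) M(1)], of e]
    show "z = gate e M"
    proof
      assume "(M, gate ?f M) \<in> joined (E - {?f} - {e})"
      then have "(M, gate ?f M) \<in> joined (E - {e})" by (rule joined_mono) auto
      moreover have "(gate ?f M, ?w) \<in> joined (E - {e})"
        using eE e g gate_in[OF eE(2) M(1)] by (intro joined_edge[of ?f]) auto
      ultimately have "(M, z) \<in> joined (E - {e})" using wz[OF e(1)] by (blast intro: joined_trans)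
      then show ?thesis using gate_eqI[OF eE(1) e(3)] by simp
    next
      assume "\<exists>y\<in>e. (M, y) \<in> joined (E - {?f} - {e})"
      then obtain y where y: "y \<in> e" "(M, y) \<in> joined (E - {?f} - {e})" by blast
      have "(M, y) \<in> joined (E - {?f})" using y(2) by (rule joined_mono) auto
      moreover have "(y, z) \<in> joined (E - {?f})" using eE e y by (intro joined_edge[of e]) auto
      ultimately have "(M, ?w) \<in> joined (E - {?f})" using joined_sym[OF wz[OF fO]] by (blast intro: joined_trans)
      then have "gate ?f M = ?w" using gate_eqI[OF eE(2)] g by simp
      then show ?thesis using \<open>?w \<noteq> gate ?f M\<close> by simp
    qed
  qed
qed

end

section \<open>The extremal non-caterpillars\<close>

text \<open>Recognises the modified hypergraph: \<open>F\<close> is the central edge joining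
  \<open>c\<close> (\<open>CentreT\<close>) to \<open>u\<close> (\<open>CentreS\<close>),
  \<open>SE\<close> are the leaves at \<open>u\<close>, \<open>TE\<close> those at \<open>c\<close>,
  and the loose path is split at \<open>c\<close> into two arms. Both cases of the main construction
  end here.\<close>

lemma power_tree_T_assembly:
  fixes G :: "'a hypergraph"
  assumes k: "k \<ge> 3" and seq: "loose_seq d q p" and card_q: "\<And>i. i < d \<Longrightarrow> card (q i) = k"
    and j: "0 < j" "j < d" and c: "c = p j" and U: "U = (\<Union>i<d. q i)"
    and F: "card F = k" "c \<in> F" "u \<in> F" "u \<noteq> c" "(F - {c}) \<inter> U = {}"
    and fin: "finite SE" "finite TE"
    and SE: "\<And>l. l \<in> SE \<Longrightarrow> card l = k \<and> u \<in> l \<and> (l - {u}) \<inter> U = {} \<and> (l - {u}) \<inter> (F - {c}) = {}"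
    and TE: "\<And>l. l \<in> TE \<Longrightarrow> card l = k \<and> c \<in> l \<and> (l - {c}) \<inter> U = {} \<and> (l - {c}) \<inter> (F - {c}) = {}"
    and SE_SE: "\<And>l l'. l \<in> SE \<Longrightarrow> l' \<in> SE \<Longrightarrow> l \<noteq> l' \<Longrightarrow> (l - {u}) \<inter> (l' - {u}) = {}"
    and TE_TE: "\<And>l l'. l \<in> TE \<Longrightarrow> l' \<in> TE \<Longrightarrow> l \<noteq> l' \<Longrightarrow> (l - {c}) \<inter> (l' - {c}) = {}"
    and SE_TE: "\<And>l l'. l \<in> SE \<Longrightarrow> l' \<in> TE \<Longrightarrow> (l - {u}) \<inter> (l' - {c}) = {}"
    and E: "edges G = q ` {..<d} \<union> {F} \<union> SE \<union> TE"
    and V: "verts G = U \<union> F \<union> \<Union>SE \<union> \<Union>TE"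
  shows "\<exists>h g. power_tree (T_nodes (card SE) (card TE) j (d - j)) CentreT T_par T_depth k G h g"
proof -
  note L = loose_seqD[OF seq]
  let ?I = "T_nodes (card SE) (card TE) j (d - j)"
  obtain bS where bS: "bij_betw bS {..<card SE} SE"
    using ex_bij_betw_nat_finite[OF fin(1)] by (auto simp: atLeast0LessThan)
  obtain bT where bT: "bij_betw bT {..<card TE} TE"
    using ex_bij_betw_nat_finite[OF fin(2)] by (auto simp: atLeast0LessThan)
  have bS_in: "bS n \<in> SE" if "n < card SE" for n using bS that by (auto simp: bij_betw_def)
  have bT_in: "bT n \<in> TE" if "n < card TE" for n using bT that by (auto simp: bij_betw_def)
  have pick: "\<exists>z\<in>l. z \<noteq> y" if "card l = k" for l and y :: 'a
  proof -
    have "\<not> l \<subseteq> {y}" using card_mono[of "{y}" l] that k by auto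
    then show ?thesis by blast
  qed
  \<comment> \<open>A pendant edge has no distinguished outer vertex, so one is chosen to represent
    its leaf node.\<close>
  define other where "other l y = (SOME z. z \<in> l \<and> z \<noteq> y)" for l and y :: 'a
  have other: "other l y \<in> l \<and> other l y \<noteq> y" if "card l = k" for l y
  proof -
    have "\<exists>z. z \<in> l \<and> z \<noteq> y" using pick[OF that] by blast
    then show ?thesis unfolding other_def by (rule someI_ex)
  qed
  define h where "h v = (case v of CentreT \<Rightarrow> c | CentreS \<Rightarrow> u | LeafS n \<Rightarrow> other (bS n) u
    | LeafT n \<Rightarrow> other (bT n) c | ArmA n \<Rightarrow> p (j - Suc n) | ArmB n \<Rightarrow> p (j + Suc n))" for v
  define g where "g v = (case v of CentreT \<Rightarrow> {} | CentreS \<Rightarrow> F | LeafS n \<Rightarrow> bS n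
    | LeafT n \<Rightarrow> bT n | ArmA n \<Rightarrow> q (j - Suc n) | ArmB n \<Rightarrow> q (j + n))" for v
  \<comment> \<open>A path edge without the joint nearer to \<open>c = p j\<close>.
    \<open>ArmA\<close> runs back from \<open>p j\<close> to \<open>p 0\<close>, hence the index
    \<open>j - Suc n\<close>; \<open>ArmB\<close> runs forward.\<close>
  define arm where "arm a = q a - {if a < j then p (Suc a) else p a}" for a
  define D where "D v = (case v of CentreT \<Rightarrow> {} | CentreS \<Rightarrow> F - {c} | LeafS n \<Rightarrow> bS n - {u}
    | LeafT n \<Rightarrow> bT n - {c} | ArmA n \<Rightarrow> arm (j - Suc n) | ArmB n \<Rightarrow> arm (j + n))" for v
  have hA: "h (T_par (ArmA n)) = p (j - n)" and hB: "h (T_par (ArmB n)) = p (j + n)" for n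
    by (cases n; simp add: h_def c)+
  have gD: "g v - {h (T_par v)} = D v" if "v \<in> ?I" for v
  proof (cases v)
    case (ArmA n)
    then have "Suc (j - Suc n) = j - n" "j - Suc n < j" using that by (auto simp: T_nodes_def)
    then show ?thesis using hA[of n] ArmA unfolding g_def D_def arm_def by simp
  next
    case (ArmB n)
    then show ?thesis using hB[of n] unfolding g_def D_def arm_def by simp
  qed (simp_all add: g_def h_def D_def)
  have arm_U: "arm a \<subseteq> U" if "a < d" for a using that unfolding arm_def U by blast
  have arm_lt: "arm a \<inter> arm b = {}" if "a < b" "b < d" for a b
  proof (rule ccontr)
    assume "arm a \<inter> arm b \<noteq> {}"
    then obtain z where z: "z \<in> arm a" "z \<in> arm b" by blast
    then have "z \<in> q a" "z \<in> q b" by (auto simp: arm_def)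
    then have "b = Suc a" "z = p b" using L(4) that by blast+
    then show False using z that by (cases "b < j") (auto simp: arm_def)
  qed
  have arm_arm: "arm a \<inter> arm b = {}" if "a \<noteq> b" "a < d" "b < d" for a b
    using that arm_lt[of a b] arm_lt[of b a] by (cases "a < b") auto
  have c_arm: "c \<notin> arm a" if "a < d" for a
  proof
    assume ca: "c \<in> arm a"
    then have "p j \<in> q a" by (simp add: arm_def c)
    then have "j = a \<or> j = Suc a" using loose_seq_vertex[OF seq, of j a] j that by simp
    then show False using ca by (auto simp: arm_def c)
  qed
  have cU: "c \<in> U" using L(2) j unfolding U c by blast
  have D_cases: "(\<exists>a<d. D v = arm a \<and> g v = q a \<and> (v = ArmA (j - Suc a) \<and> a < j \<or> v = ArmB (a - j) \<and> j \<le> a))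
      \<or> (v = CentreS \<and> D v = F - {c}) \<or> (\<exists>n<card SE. v = LeafS n \<and> D v = bS n - {u})
      \<or> (\<exists>n<card TE. v = LeafT n \<and> D v = bT n - {c})" if "v \<in> ?I" for v
  proof (cases v)
    case (ArmA n)
    then have "n < j" using that by (auto simp: T_nodes_def)
    then have "j - Suc n < d" "j - Suc n < j" "j - Suc (j - Suc n) = n" using j by auto
    then show ?thesis using ArmA by (intro disjI1 exI[of _ "j - Suc n"]) (simp add: D_def g_def)
  next
    case (ArmB n)
    then have "j + n < d" using that by (auto simp: T_nodes_def)
    then show ?thesis using ArmB by (intro disjI1 exI[of _ "j + n"]) (simp add: D_def g_def)
  qed (use that in \<open>auto simp: T_nodes_def D_def\<close>)
  have D_U: "D v \<inter> U = {}" if "v \<in> {CentreS} \<union> LeafS ` {..<card SE} \<union> LeafT ` {..<card TE}" for v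
  proof -
    have SU: "(bS n - {u}) \<inter> U = {}" if "n < card SE" for n using SE[OF bS_in[OF that]] by blast
    have TU: "(bT n - {c}) \<inter> U = {}" if "n < card TE" for n using TE[OF bT_in[OF that]] by blast
    show ?thesis using that F(5) SU TU unfolding D_def by (elim UnE imageE singletonE) simp_all
  qed
  have disjoint: "D v \<inter> D w = {}" if vw: "v \<in> ?I" "w \<in> ?I" "v \<noteq> w" for v w
  proof (cases "D v \<subseteq> U \<or> D w \<subseteq> U")
    case True
    show ?thesis
    proof (cases "D v \<subseteq> U \<and> D w \<subseteq> U")
      case False
      then show ?thesis using True D_cases[OF vw(1)] D_cases[OF vw(2)] D_U[of v] D_U[of w] arm_U by blast
    next
      case both: True
      show ?thesis
      proof (cases "v \<in> {CentreS} \<union> LeafS ` {..<card SE} \<union> LeafT ` {..<card TE}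
          \<or> w \<in> {CentreS} \<union> LeafS ` {..<card SE} \<union> LeafT ` {..<card TE}")
        case True
        then show ?thesis using D_U[of v] D_U[of w] both by blast
      next
        case False
        obtain a where a: "a < d" "D v = arm a" "v = ArmA (j - Suc a) \<and> a < j \<or> v = ArmB (a - j) \<and> j \<le> a"
          using D_cases[OF vw(1)] False by blast
        obtain b where b: "b < d" "D w = arm b" "w = ArmA (j - Suc b) \<and> b < j \<or> w = ArmB (b - j) \<and> j \<le> b"
          using D_cases[OF vw(2)] False by blast
        have "a \<noteq> b" using a(3) b(3) vw(3) by auto
        then show ?thesis using arm_arm a b by simp
      qed
    qed
  next
    case False
    have FS: "(F - {c}) \<inter> (bS n - {u}) = {}" if "n < card SE" for n using SE[OF bS_in[OF that]] by blast
    have FT: "(F - {c}) \<inter> (bT n - {c}) = {}" if "n < card TE" for n using TE[OF bT_in[OF that]] by blast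
    have ST: "(bS n - {u}) \<inter> (bT n' - {c}) = {}" if "n < card SE" "n' < card TE" for n n'
      using SE_TE[OF bS_in[OF that(1)] bT_in[OF that(2)]] .
    have SS: "(bS n - {u}) \<inter> (bS n' - {u}) = {}" if "n < card SE" "n' < card SE" "n \<noteq> n'" for n n'
      using that bS by (intro SE_SE bS_in) (auto simp: bij_betw_def inj_on_def)
    have TT: "(bT n - {c}) \<inter> (bT n' - {c}) = {}" if "n < card TE" "n' < card TE" "n \<noteq> n'" for n n'
      using that bT by (intro TE_TE bT_in) (auto simp: bij_betw_def inj_on_def)
    have v: "v = CentreS \<and> D v = F - {c} \<or> (\<exists>n<card SE. v = LeafS n \<and> D v = bS n - {u})
      \<or> (\<exists>n<card TE. v = LeafT n \<and> D v = bT n - {c})" 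
      using D_cases[OF vw(1)]
    proof (rule disjE)
      assume "\<exists>a<d. D v = arm a \<and> g v = q a \<and> (v = ArmA (j - Suc a) \<and> a < j \<or> v = ArmB (a - j) \<and> j \<le> a)"
      then obtain a where "a < d" "D v = arm a" by blast
      then show ?thesis using arm_U[of a] False by simp
    qed
    have w: "w = CentreS \<and> D w = F - {c} \<or> (\<exists>n<card SE. w = LeafS n \<and> D w = bS n - {u})
      \<or> (\<exists>n<card TE. w = LeafT n \<and> D w = bT n - {c})" 
      using D_cases[OF vw(2)]
    proof (rule disjE)
      assume "\<exists>a<d. D w = arm a \<and> g w = q a \<and> (w = ArmA (j - Suc a) \<and> a < j \<or> w = ArmB (a - j) \<and> j \<le> a)"
      then obtain a where "a < d" "D w = arm a" by blast
      then show ?thesis using arm_U[of a] False by simp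
    qed
    from v w show ?thesis
    proof (elim disjE conjE exE)
      fix n n' assume *: "n < card SE" "v = LeafS n" "D v = bS n - {u}" "n' < card SE" "w = LeafS n'" "D w = bS n' - {u}"
      then show ?thesis using SS[of n n'] vw(3) by simp
    next
      fix n n' assume *: "n < card TE" "v = LeafT n" "D v = bT n - {c}" "n' < card TE" "w = LeafT n'" "D w = bT n' - {c}"
      then show ?thesis using TT[of n n'] vw(3) by simp
    next
      fix n n' assume *: "n < card SE" "D v = bS n - {u}" "n' < card TE" "D w = bT n' - {c}"
      then show ?thesis using ST[of n n'] by simp
    next
      fix n n' assume *: "n < card TE" "D v = bT n - {c}" "n' < card SE" "D w = bS n' - {u}"
      then show ?thesis using ST[of n' n] by (simp add: Int_commute)
    next
      fix n assume "D v = F - {c}" "n < card SE" "D w = bS n - {u}"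
      then show ?thesis using FS[of n] by simp
    next
      fix n assume "D v = F - {c}" "n < card TE" "D w = bT n - {c}"
      then show ?thesis using FT[of n] by simp
    next
      fix n assume "D w = F - {c}" "n < card SE" "D v = bS n - {u}"
      then show ?thesis using FS[of n] by (simp add: Int_commute)
    next
      fix n assume "D w = F - {c}" "n < card TE" "D v = bT n - {c}"
      then show ?thesis using FT[of n] by (simp add: Int_commute)
    next
      assume "v = CentreS" "w = CentreS"
      then show ?thesis using vw(3) by simp
    qed
  qed
  have img: "g ` ?I = q ` {..<d} \<union> {F} \<union> SE \<union> TE"
  proof -
    have "g ` ?I = {F} \<union> bS ` {..<card SE} \<union> bT ` {..<card TE} \<union> ((\<lambda>n. q (j - Suc n)) ` {..<j} \<union> (\<lambda>n. q (j + n)) ` {..<d - j})"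
      unfolding T_nodes_def image_Un image_image by (simp add: g_def Un_assoc)
    also have "(\<lambda>n. q (j - Suc n)) ` {..<j} \<union> (\<lambda>n. q (j + n)) ` {..<d - j} = q ` {..<d}"
    proof (intro set_eqI iffI)
      fix e assume "e \<in> q ` {..<d}"
      then obtain a where a: "a < d" "e = q a" by blast
      show "e \<in> (\<lambda>n. q (j - Suc n)) ` {..<j} \<union> (\<lambda>n. q (j + n)) ` {..<d - j}"
      proof (cases "a < j")
        case True
        then have "e = q (j - Suc (j - Suc a))" "j - Suc a < j" using a by auto
        then show ?thesis by blast
      next
        case False
        then have "e = q (j + (a - j))" "a - j < d - j" using a by auto
        then show ?thesis by blast
      qed
    qed (use j in auto)
    finally show ?thesis using bS bT by (auto simp: bij_betw_def)
  qed
  have "power_tree ?I CentreT T_par T_depth k G h g"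
  proof (intro power_tree.intro rooted_tree_T power_tree_axioms.intro)
    show "3 \<le> k" by fact
    show "edges G = g ` ?I" unfolding img E ..
    show "verts G = insert (h CentreT) (\<Union>i\<in>?I. g i)"
    proof -
      have eq: "(\<Union>i\<in>?I. g i) = verts G" unfolding V img U by auto
      have "h CentreT = c" by (simp add: h_def)
      moreover have "c \<in> verts G" using cU unfolding V by blast
      ultimately show ?thesis unfolding eq by (simp add: insert_absorb)
    qed
    fix v assume v: "v \<in> ?I"
    show "card (g v) = k"
    proof -
      have "g v \<in> q ` {..<d} \<union> {F} \<union> SE \<union> TE" using v img by blast
      then show ?thesis using card_q F SE TE by auto
    qed
    show "h v \<in> g v"
    proof (cases v)
      case (ArmA n)
      then show ?thesis using v L(2)[of "j - Suc n"] j by (auto simp: T_nodes_def h_def g_def)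
    next
      case (ArmB n)
      then show ?thesis using v L(3)[of "j + n"] by (auto simp: T_nodes_def h_def g_def)
    next
      case (LeafS n)
      then have "n < card SE" using v by (auto simp: T_nodes_def)
      then show ?thesis using LeafS SE[OF bS_in] other by (simp add: h_def g_def)
    next
      case (LeafT n)
      then have "n < card TE" using v by (auto simp: T_nodes_def)
      then show ?thesis using LeafT TE[OF bT_in] other by (simp add: h_def g_def)
    qed (use v F in \<open>auto simp: T_nodes_def h_def g_def\<close>)
    show "h (T_par v) \<in> g v"
    proof (cases v)
      case (ArmA n)
      then have "n < j" using v by (auto simp: T_nodes_def)
      then have "Suc (j - Suc n) = j - n" "j - Suc n < d" using j by auto
      then show ?thesis using ArmA hA[of n] L(3)[of "j - Suc n"] by (simp add: g_def)
    next
      case (ArmB n)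
      then show ?thesis using v hB[of n] L(2)[of "j + n"] by (auto simp: T_nodes_def g_def)
    next
      case (LeafS n)
      then have "n < card SE" using v by (auto simp: T_nodes_def)
      then show ?thesis using LeafS SE[OF bS_in] by (simp add: h_def g_def)
    next
      case (LeafT n)
      then have "n < card TE" using v by (auto simp: T_nodes_def)
      then show ?thesis using LeafT TE[OF bT_in] by (simp add: h_def g_def)
    qed (use v F in \<open>auto simp: T_nodes_def h_def g_def\<close>)
    show "h v \<noteq> h (T_par v)"
    proof (cases v)
      case (ArmA n)
      then have "n < j" using v by (auto simp: T_nodes_def)
      then have "j - Suc n \<noteq> j - n" "j - Suc n \<le> d" "j - n \<le> d" using j by auto
      then have "p (j - Suc n) \<noteq> p (j - n)" using L(1) by blast
      moreover have "h (ArmA n) = p (j - Suc n)" by (simp add: h_def)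
      ultimately show ?thesis unfolding ArmA hA by simp
    next
      case (ArmB n)
      then have "j + Suc n \<noteq> j + n" "j + Suc n \<le> d" "j + n \<le> d" using v by (auto simp: T_nodes_def)
      then have "p (j + Suc n) \<noteq> p (j + n)" using L(1) by blast
      moreover have "h (ArmB n) = p (j + Suc n)" by (simp add: h_def)
      ultimately show ?thesis unfolding ArmB hB by simp
    next
      case (LeafS n)
      then have "n < card SE" using v by (auto simp: T_nodes_def)
      then show ?thesis using LeafS SE[OF bS_in] other by (simp add: h_def)
    next
      case (LeafT n)
      then have "n < card TE" using v by (auto simp: T_nodes_def)
      then show ?thesis using LeafT TE[OF bT_in] other by (simp add: h_def)
    qed (use v F in \<open>auto simp: T_nodes_def h_def\<close>)
    show "h CentreT \<notin> g v - {h (T_par v)}"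
      unfolding gD[OF v] using D_cases[OF v] c_arm cU D_U[of v] by (auto simp: h_def)
    show "(g v - {h (T_par v)}) \<inter> (g w - {h (T_par w)}) = {}" if "w \<in> ?I" "v \<noteq> w" for w
      unfolding gD[OF v] gD[OF that(1)] using disjoint[OF v that] .
  qed
  then show ?thesis by blast
qed

text \<open>What the shifting lemma asks of a single edge. Being transitive, it allows two exchanges
  in the same edge.\<close>

definition dominates :: "nat \<Rightarrow> ('a \<Rightarrow> real) \<Rightarrow> 'a set \<Rightarrow> 'a set \<Rightarrow> bool" where
  "dominates k x e e' \<longleftrightarrow> (\<Prod>w\<in>e. x w) \<le> (\<Prod>w\<in>e'. x w) \<and> (\<Sum>w\<in>e. x w ^ k) \<le> (\<Sum>w\<in>e'. x w ^ k)"

lemma dominates_refl [simp]: "dominates k x e e"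
  by (simp add: dominates_def)

lemma dominates_trans: "dominates k x e f \<Longrightarrow> dominates k x f g \<Longrightarrow> dominates k x e g"
  by (auto simp: dominates_def)

lemma exchange_dominates:
  assumes "finite e" "y \<in> e" "c \<notin> e" "x y \<le> x c" "\<And>v. v \<in> e \<Longrightarrow> 0 < x v"
  shows "dominates k x e (insert c (e - {y}))"
proof -
  have "(\<Prod>w\<in>e. x w) = x y * (\<Prod>w\<in>e - {y}. x w)" "(\<Sum>w\<in>e. x w ^ k) = x y ^ k + (\<Sum>w\<in>e - {y}. x w ^ k)"
    using assms by (simp_all add: prod.remove[of e y] sum.remove[of e y])
  moreover have "(\<Prod>w\<in>insert c (e - {y}). x w) = x c * (\<Prod>w\<in>e - {y}. x w)"
    "(\<Sum>w\<in>insert c (e - {y}). x w ^ k) = x c ^ k + (\<Sum>w\<in>e - {y}. x w ^ k)"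
    using assms by simp_all
  moreover have "0 \<le> (\<Prod>w\<in>e - {y}. x w)" using assms(5) by (intro prod_nonneg) (auto intro: less_imp_le)
  moreover have "x y ^ k \<le> x c ^ k" using assms(2,4,5) by (intro power_mono) (auto intro: less_imp_le)
  ultimately show ?thesis unfolding dominates_def using assms(4) by (auto intro: mult_right_mono)
qed

lemma card_exchange:
  assumes "finite e" "y \<in> e" "c \<notin> e"
  shows "card (insert c (e - {y})) = card e"
  using assms card_Suc_Diff1[of e y] by simp

lemma card_T_nodes: "card (T_nodes s t a b) = 1 + s + t + a + b"
proof -
  have "card (T_nodes s t a b) = card {CentreS} + card (LeafS ` {..<s}) + card (LeafT ` {..<t})
      + card (ArmA ` {..<a}) + card (ArmB ` {..<b})"
    unfolding T_nodes_def by ((subst card_Un_disjoint, force, force, force)+, rule refl)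
  then show ?thesis by (simp add: card_image inj_on_def)
qed

section \<open>Rerooting edges at a heavy vertex\<close>

context supertree_hypergraph
begin

lemma away_dominates:
  assumes e: "e \<in> E" and r: "r \<in> V" and pos: "\<And>v. v \<in> V \<Longrightarrow> 0 < x v"
    and le: "\<And>v. v \<in> V \<Longrightarrow> 2 \<le> hdegree G v \<Longrightarrow> x v \<le> x r"
  shows "dominates k x e (insert r (away r e))"
proof (cases "gate e r = r")
  case True
  then have "insert r (away r e) = e" using gate_in[OF e r] by (auto simp: away_def)
  then show ?thesis by simp
next
  case False
  then have "r \<notin> e" using gate_self[OF e] by blast
  moreover have "x (gate e r) \<le> x r"
    using gate_hdegree[OF e r False] gate_in[OF e r] edge_subset[OF e] by (intro le) auto
  ultimately show ?thesis unfolding away_def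
    using gate_in[OF e r] edge_subset[OF e] finite_edge[OF e] pos by (intro exchange_dominates) auto
qed

lemma card_insert_away: "e \<in> E \<Longrightarrow> r \<in> V \<Longrightarrow> card (insert r (away r e)) = k"
  using card_away[of e r] away_root[of e r] finite_edge[of e] k_ge_2 by (simp add: away_def)

lemma inj_insert_away:
  assumes r: "r \<in> V"
  shows "inj_on (\<lambda>e. insert r (away r e)) E"
proof (rule inj_onI, rule ccontr)
  fix e e' assume e: "e \<in> E" "e' \<in> E" "insert r (away r e) = insert r (away r e')" "e \<noteq> e'"
  then have "away r e = away r e'" using away_root by (metis insert_ident)
  then have "away r e = {}" using away_disjoint[OF e(1,2,4) r] by simp
  then show False using card_away[OF e(1) r] k_ge_2 by simp
qed

lemma shift_conclude:
  fixes \<sigma> :: "'a set \<Rightarrow> 'a set"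
  defines "G' \<equiv> Hypergraph V (\<sigma> ` E)"
  assumes \<alpha>: "0 \<le> \<alpha>" "\<alpha> < 1" and ev: "alpha_eigenvector k \<alpha> G (alpha_spectral_radius k \<alpha> G) x"
    and V: "V \<noteq> {}"
    and pt: "power_tree (T_nodes s t a b) CentreT T_par T_depth k G' h g"
    and card_E: "card E = 1 + s + t + a + b"
    and dom: "\<And>e. e \<in> E \<Longrightarrow> dominates k x e (\<sigma> e)"
    and gain: "(\<forall>e\<in>E. \<sigma> e = e) \<or> (\<exists>z\<in>V. (\<forall>e\<in>E. z \<in> e \<longrightarrow> z \<in> \<sigma> e) \<and> (\<exists>e\<in>E. z \<notin> e \<and> z \<in> \<sigma> e))"
  shows "alpha_spectral_radius k \<alpha> G < alpha_spectral_radius k \<alpha> G' \<or> G' = G"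
proof -
  interpret P: power_tree "T_nodes s t a b" CentreT T_par T_depth k G' h g by fact
  have "card (edges G') = card E"
    unfolding P.edges_eq card_image[OF P.inj_g] card_T_nodes card_E ..
  \<comment> \<open>Injectivity comes from counting: the recognised tree has as many edges as
    \<open>G\<close>, so no two edges were merged.\<close>
  then have inj: "inj_on \<sigma> E" using finite_E by (intro eq_card_imp_inj_on) (auto simp: G'_def)
  have E': "edges G' = \<sigma> ` E" and V': "verts G' = V" by (simp_all add: G'_def)
  have "e \<in> E \<Longrightarrow> (\<Prod>w\<in>e. x w) \<le> (\<Prod>w\<in>\<sigma> e. x w)" "e \<in> E \<Longrightarrow> (\<Sum>w\<in>e. x w ^ k) \<le> (\<Sum>w\<in>\<sigma> e. x w ^ k)" for e
    using dom by (auto simp: dominates_def)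
  note shift = alpha_spectral_radius_shift(2)[OF uniform P.uniform_G P.linked_G k_ge_2 \<alpha> V' V ev inj E' this]
  from gain show ?thesis
  proof
    assume "\<forall>e\<in>E. \<sigma> e = e"
    then have "\<sigma> ` E = E" by simp
    then show ?thesis unfolding G'_def by simp
  next
    assume "\<exists>z\<in>V. (\<forall>e\<in>E. z \<in> e \<longrightarrow> z \<in> \<sigma> e) \<and> (\<exists>e\<in>E. z \<notin> e \<and> z \<in> \<sigma> e)"
    then obtain z e where "z \<in> V" "\<And>e. e \<in> E \<Longrightarrow> z \<in> e \<Longrightarrow> z \<in> \<sigma> e" "e \<in> E" "z \<notin> e" "z \<in> \<sigma> e" by blast
    from shift[OF _ _ this] show ?thesis by simp
  qed
qed

end

context diametral_path
begin

text \<open>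
  A vertex \<open>w\<close> of the path that is not one of its joints can replace the joint \<open>p (Suc i)\<close>
  next to it; one does so exactly if \<open>w\<close> carries more weight than that joint.
\<close>
lemma junction:
  fixes x :: "'a \<Rightarrow> real"
  assumes w: "w \<in> U" "2 \<le> hdegree G w"
  obtains c q' p' j where "0 < j" "j < d" "loose_seq d q' p'" "U = (\<Union>i<d. q' i)" "c = p' j" "x w \<le> x c"
    "\<And>i. i < d \<Longrightarrow> q' i = q i \<or> (\<exists>y\<in>q i. q' i = insert c (q i - {y}) \<and> c \<notin> q i \<and> x y \<le> x c)"
  using U_hdegree_cases[OF w]
proof (elim disjE exE conjE)
  fix j assume "0 < j" "j < d" "w = p j"
  then show thesis using that[of j q p w] loose_seq_path U_eq by simp
next
  fix i assume i: "Suc i < d" "w \<in> q i" "w \<noteq> p i" "w \<noteq> p (Suc i)"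
  show thesis
  proof (cases "x w \<le> x (p (Suc i))")
    case True
    then show thesis using that[of "Suc i" q p "p (Suc i)"] loose_seq_path U_eq i by simp
  next
    case False
    let ?q = "q(Suc i := insert w (q (Suc i) - {p (Suc i)}))" and ?p = "p(Suc i := w)"
    note rot = loose_seq_rotate[OF loose_seq_path i]
    have "w \<notin> q (Suc i)" using L(4)[of i "Suc i" w] i by auto
    moreover have "p (Suc i) \<in> q (Suc i)" using path_in(1)[of "Suc i"] i by simp
    ultimately have step: "?q m = q m \<or> (\<exists>y\<in>q m. ?q m = insert w (q m - {y}) \<and> w \<notin> q m \<and> x y \<le> x w)" for m
      using False by (cases "m = Suc i") auto
    show thesis
      by (rule that[of "Suc i" ?q ?p w, OF _ i(1) rot(1) _ _ _ step]) (use rot(2) U_eq in auto)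
  qed
qed

lemma E_split: "E = q ` {..<d} \<union> Off"
  using path_subset set_es by (auto simp: Off_def)

lemma card_Off: "card E = d + card Off"
proof -
  have "card (q ` {..<d}) = d" using card_image[OF inj_q] by simp
  moreover have "card E = card (q ` {..<d}) + card Off"
    by (subst E_split, rule card_Un_disjoint) (use finite_E set_es in \<open>auto simp: Off_def\<close>)
  ultimately show ?thesis by simp
qed

text \<open>Rerouted path edges are given by index, whereas shifting needs a map on edges;
  \<open>inv_into\<close> recovers the index of a path edge.\<close>

definition splice :: "(nat \<Rightarrow> 'a set) \<Rightarrow> ('a set \<Rightarrow> 'a set) \<Rightarrow> 'a set \<Rightarrow> 'a set" where
  "splice q' \<tau> e = (if e \<in> Off then \<tau> e else q' (inv_into {..<d} q e))"

lemma splice_path: "i < d \<Longrightarrow> splice q' \<tau> (q i) = q' i"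
  using inv_into_f_f[OF inj_q, of i] set_es by (auto simp: splice_def Off_def)

lemma splice_Off: "e \<in> Off \<Longrightarrow> splice q' \<tau> e = \<tau> e"
  by (simp add: splice_def)

lemma splice_image: "splice q' \<tau> ` E = q' ` {..<d} \<union> \<tau> ` Off"
  unfolding E_split image_Un image_image
  using splice_path splice_Off by (auto simp: image_iff)

lemma E_cases: "e \<in> E \<Longrightarrow> (\<exists>i. i < d \<and> e = q i) \<or> e \<in> Off"
  unfolding E_split by auto

lemma away_cover_Off:
  assumes r: "r \<in> V" and z: "z \<in> V" "z \<noteq> r" "z \<notin> U"
  shows "\<exists>e\<in>Off. z \<in> away r e"
proof -
  obtain e where e: "e \<in> E" "z \<in> away r e" using away_cover[OF r z(1,2)] by blast
  then have "e \<in> Off" using z(3) by (auto simp: Off_def U_def away_def)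
  then show ?thesis using e by blast
qed

text \<open>If \<open>M\<close> lies on the path the result has \<open>s = 1\<close>, otherwise
  \<open>t = 0\<close>. The alternative \<open>G' = G\<close> arises when nothing was moved, and
  carries the case of equality.\<close>

lemma shift_to_T:
  assumes k: "k \<ge> 3" and \<alpha>: "0 \<le> \<alpha>" "\<alpha> < 1" and nc: "\<not> caterpillar G"
    and ev: "alpha_eigenvector k \<alpha> G (alpha_spectral_radius k \<alpha> G) x"
  shows "\<exists>(G' :: 'a hypergraph) s t a b h g. power_tree (T_nodes s t a b) CentreT T_par T_depth k G' h g
    \<and> 1 \<le> s \<and> a + b = d \<and> card E = 1 + s + t + d
    \<and> (alpha_spectral_radius k \<alpha> G < alpha_spectral_radius k \<alpha> G' \<or> G' = G)"
proof -
  have pos: "\<And>v. v \<in> V \<Longrightarrow> 0 < x v" using ev by (simp add: alpha_eigenvector_def)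
  let ?W = "{v \<in> V. 2 \<le> hdegree G v}"
  have "p 1 \<in> ?W"
  proof -
    have "q 0 \<noteq> q 1" using inj_onD[OF inj_q, of 0 1] d_ge_2 by auto
    moreover have "p 1 \<in> q 0" "p 1 \<in> q 1" using path_in(2)[of 0] path_in(1)[of 1] d_ge_2 by auto
    ultimately have "2 \<le> hdegree G (p 1)" using q_in d_ge_2 by (intro two_edges_hdegree[of "q 0" "q 1"]) auto
    then show ?thesis using p_in_U[of 1] U_subset d_ge_2 by auto
  qed
  then have W: "finite ?W" "?W \<noteq> {}" using finite_V by auto
  have "\<exists>M\<in>?W. x M = Max (x ` ?W)" using W Max_in[of "x ` ?W"] by fastforce
  then obtain M where M: "M \<in> V" "2 \<le> hdegree G M" "x M = Max (x ` ?W)" by blast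
  have M_max: "x v \<le> x M" if "v \<in> V" "2 \<le> hdegree G v" for v
    unfolding M(3) using that W by (intro Max_ge) auto
  have V_ne: "V \<noteq> {}" using M by auto
  have Off_sub: "e \<subseteq> V" "finite e" "card e = k" if "e \<in> Off" for e
    using Off_in[OF that] edge_subset finite_edge card_edge by auto
  have fin_Off: "finite Off" using finite_E by (auto simp: Off_def)
  have path_step: "card (e') = k \<and> dominates k x (q i) (e')"
    if "e' = q i \<or> (\<exists>y\<in>q i. e' = insert c (q i - {y}) \<and> c \<notin> q i \<and> x y \<le> x c)" "i < d" for e' i c
    using that(1)
  proof
    assume "e' = q i"
    then show ?thesis using card_edge[OF q_in[OF that(2)]] by simp
  next
    note e = q_in[OF that(2)]
    assume "\<exists>y\<in>q i. e' = insert c (q i - {y}) \<and> c \<notin> q i \<and> x y \<le> x c"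
    then obtain y where y: "y \<in> q i" "e' = insert c (q i - {y})" "c \<notin> q i" "x y \<le> x c" by blast
    have "dominates k x (q i) (insert c (q i - {y}))"
      using y edge_subset[OF e] pos by (intro exchange_dominates finite_edge[OF e]) auto
    then show ?thesis using y(2) card_exchange[OF finite_edge[OF e] y(1,3)] card_edge[OF e] by simp
  qed
  show ?thesis
  proof (cases "M \<in> U")
    case True
    \<comment> \<open>\<open>c\<close> is \<open>M\<close> or a joint at least as heavy, so it
      inherits the maximality of \<open>M\<close> and is moreover an inner joint of the new
      path.\<close>
    obtain c q' p' j where j: "0 < j" "j < d" and seq: "loose_seq d q' p'" and U': "U = (\<Union>i<d. q' i)"
      and c: "c = p' j" and xc: "x M \<le> x c"
      and q': "\<And>i. i < d \<Longrightarrow> q' i = q i \<or> (\<exists>y\<in>q i. q' i = insert c (q i - {y}) \<and> c \<notin> q i \<and> x y \<le> x c)"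
      by (rule junction[OF True M(2), of x], rule that) (assumption | blast)+
    have cU: "c \<in> U" using loose_seqD(2)[OF seq j(2)] j(2) unfolding U' c by blast
    then have cV: "c \<in> V" using U_subset by blast
    have c_max: "x v \<le> x c" if "v \<in> V" "2 \<le> hdegree G v" for v using M_max[OF that] xc by simp
    \<comment> \<open>The edge left alone, which becomes the only leaf at \<open>CentreS\<close>.
      Its vertex \<open>u\<close> nearest to \<open>c\<close> will be \<open>CentreS\<close>, and
      the edge \<open>f\<close> by which \<open>u\<close> is reached from \<open>c\<close> becomes
      the central edge.\<close>
    obtain g where g: "g \<in> Off" "g \<inter> U = {}" using exists_detached[OF nc] by blast
    define u where "u = gate g c"
    have u: "u \<in> g" "u \<notin> U" "u \<in> V" "u \<noteq> c"
      using gate_in[OF Off_in[OF g(1)] cV] g Off_sub[OF g(1)] cU unfolding u_def by auto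
    obtain f where f: "f \<in> Off" "u \<in> away c f" using away_cover_Off[OF cV u(3,4,2)] by blast
    have fg: "f \<noteq> g" using f(2) by (auto simp: away_def u_def)
    define \<tau> where "\<tau> e = (if e = g then g else insert c (away c e))" for e
    define F where "F = insert c (away c f)"
    define T where "T = \<tau> ` (Off - {f, g})"
    have c_away: "c \<notin> away c e" if "e \<in> Off" for e using away_root[OF Off_in[OF that]] .
    have disj: "away c e \<inter> away c e' = {}" if "e \<in> Off" "e' \<in> Off" "e \<noteq> e'" for e e'
      using away_disjoint[OF Off_in[OF that(1)] Off_in[OF that(2)] that(3) cV] .
    have T_away: "\<exists>e\<in>Off - {f, g}. l = insert c (away c e) \<and> l - {c} = away c e" if lT: "l \<in> T" for l
    proof -
      obtain e where e: "e \<in> Off - {f, g}" "l = \<tau> e" using lT unfolding T_def by blast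
      then have "l = insert c (away c e)" by (simp add: \<tau>_def)
      then show ?thesis using e(1) c_away[of e] by (intro bexI[of _ e]) auto
    qed
    have F_away: "F - {c} = away c f" using c_away[OF f(1)] by (auto simp: F_def)
    have g_away: "g - {u} = away c g" by (simp add: away_def u_def)
    have \<tau>_Off: "\<tau> ` Off = {F} \<union> {g} \<union> T" using f(1) g(1) fg by (auto simp: T_def F_def \<tau>_def)
    have "inj_on \<tau> (Off - {f, g})"
      by (rule inj_onI) (use inj_onD[OF inj_insert_away[OF cV]] Off_in in \<open>auto simp: \<tau>_def\<close>)
    then have card_T: "card T = card Off - 2"
      unfolding T_def using f(1) g(1) fg fin_Off by (simp add: card_image card_Diff_subset)
    have "card {f, g} \<le> card Off" using f(1) g(1) fin_Off by (intro card_mono) auto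
    then have Off2: "2 \<le> card Off" using fg by simp
    let ?\<sigma> = "splice q' \<tau>"
    let ?G = "Hypergraph V (?\<sigma> ` E)"
    have "\<exists>h g'. power_tree (T_nodes (card {g}) (card T) j (d - j)) CentreT T_par T_depth k ?G h g'"
    proof (rule power_tree_T_assembly[OF k seq _ j c U', where F = F and u = u])
      show "card (q' i) = k" if "i < d" for i using path_step[OF q'[OF that] that, THEN conjunct1] .
      show "card F = k" unfolding F_def by (rule card_insert_away[OF Off_in[OF f(1)] cV])
      show "c \<in> F" "u \<in> F" "u \<noteq> c" using f u by (auto simp: F_def)
      show "(F - {c}) \<inter> U = {}" unfolding F_away by (rule away_Off[OF f(1) cU])
      show "finite {g}" "finite T" using fin_Off by (auto simp: T_def)
      show "card l = k \<and> u \<in> l \<and> (l - {u}) \<inter> U = {} \<and> (l - {u}) \<inter> (F - {c}) = {}" if "l \<in> {g}" for l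
      proof -
        have "away c g \<inter> U = {}" by (rule away_Off[OF g(1) cU])
        moreover have "away c g \<inter> (F - {c}) = {}" unfolding F_away by (rule disj[OF g(1) f(1) fg[symmetric]])
        moreover have "l = g" using that by simp
        ultimately show ?thesis using Off_sub[OF g(1)] u(1) by (simp only: g_away simp_thms)
      qed
      show "card l = k \<and> c \<in> l \<and> (l - {c}) \<inter> U = {} \<and> (l - {c}) \<inter> (F - {c}) = {}" if l: "l \<in> T" for l
      proof -
        obtain e where e: "e \<in> Off" "e \<noteq> f" "l = insert c (away c e)" "l - {c} = away c e" using T_away[OF l] by blast
        show ?thesis unfolding F_away e(4) using card_insert_away[OF Off_in[OF e(1)] cV] away_Off[OF e(1) cU]
          disj[OF e(1) f(1) e(2)] unfolding e(3) by blast
      qed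
      show "(l - {u}) \<inter> (l' - {u}) = {}" if "l \<in> {g}" "l' \<in> {g}" "l \<noteq> l'" for l l' using that by simp
      show "(l - {c}) \<inter> (l' - {c}) = {}" if ll: "l \<in> T" "l' \<in> T" "l \<noteq> l'" for l l'
      proof -
        obtain e where e: "e \<in> Off" "l = insert c (away c e)" "l - {c} = away c e" using T_away[OF ll(1)] by blast
        obtain e' where e': "e' \<in> Off" "l' = insert c (away c e')" "l' - {c} = away c e'" using T_away[OF ll(2)] by blast
        have "e \<noteq> e'" using e(2) e'(2) ll(3) by blast
        then show ?thesis unfolding e(3) e'(3) using disj e e' by blast
      qed
      show "(l - {u}) \<inter> (l' - {c}) = {}" if ll: "l \<in> {g}" "l' \<in> T" for l l'
      proof -
        obtain e where e: "e \<in> Off" "e \<noteq> g" "l' - {c} = away c e" using T_away[OF ll(2)] by blast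
        then show ?thesis using ll(1) g_away disj[OF g(1) e(1)] by auto
      qed
      show "edges ?G = q' ` {..<d} \<union> {F} \<union> {g} \<union> T" unfolding hypergraph.sel splice_image \<tau>_Off by blast
      show "verts ?G = U \<union> F \<union> \<Union>{g} \<union> \<Union>T"
      proof
        show "verts ?G \<subseteq> U \<union> F \<union> \<Union>{g} \<union> \<Union>T"
        proof
          fix z assume "z \<in> verts ?G"
          then have z: "z \<in> V" by simp
          show "z \<in> U \<union> F \<union> \<Union>{g} \<union> \<Union>T"
          proof (cases "z \<in> U")
            case False
            then have "z \<noteq> c" using cU by blast
            then obtain e where e: "e \<in> Off" "z \<in> away c e" using away_cover_Off[OF cV z _ False] by blast
            then have "z \<in> \<tau> e" by (auto simp: \<tau>_def away_def)
            then show ?thesis using e(1) \<tau>_Off by blast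
          qed simp
        qed
        have "\<tau> e \<subseteq> V" if "e \<in> Off" for e using Off_sub[OF that] cV by (auto simp: \<tau>_def away_def)
        then have "\<Union>(\<tau> ` Off) \<subseteq> V" by blast
        then show "U \<union> F \<union> \<Union>{g} \<union> \<Union>T \<subseteq> verts ?G" unfolding \<tau>_Off using U_subset by auto
      qed
    qed
    then obtain h g' where pt: "power_tree (T_nodes 1 (card T) j (d - j)) CentreT T_par T_depth k ?G h g'" by auto
    have "alpha_spectral_radius k \<alpha> G < alpha_spectral_radius k \<alpha> ?G \<or> ?G = G"
    proof (rule shift_conclude[OF \<alpha> ev V_ne pt])
      show "card E = 1 + 1 + card T + j + (d - j)" using card_Off card_T Off2 j by simp
      show "dominates k x e (?\<sigma> e)" if "e \<in> E" for e
        using E_cases[OF that]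
      proof (elim disjE exE conjE)
        fix i assume i: "i < d" "e = q i"
        show ?thesis unfolding i(2) splice_path[OF i(1)] using path_step[OF q'[OF i(1)] i(1), THEN conjunct2] .
      next
        assume that: "e \<in> Off"
        show ?thesis unfolding splice_Off[OF that] \<tau>_def using away_dominates[where x = x, OF Off_in[OF that] cV pos c_max] by simp
      qed
      have keep: "c \<in> ?\<sigma> e" if "e \<in> E" "c \<in> e" for e
        using E_cases[OF that(1)]
      proof (elim disjE exE conjE)
        fix i assume i: "i < d" "e = q i"
        then show ?thesis using q'[OF i(1)] that(2) unfolding i(2) splice_path[OF i(1)] by auto
      next
        assume 2: "e \<in> Off"
        then show ?thesis using that(2) unfolding splice_Off[OF 2] by (auto simp: \<tau>_def)
      qed
      \<comment> \<open>An edge changes only by gaining \<open>c\<close>. So either nothing moved at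
        all, or \<open>c\<close> is a vertex that only gains edges, as strict growth
        requires.\<close>
      have same: "?\<sigma> e = e" if "e \<in> E" "c \<in> ?\<sigma> e \<longrightarrow> c \<in> e" for e
        using E_cases[OF that(1)]
      proof (elim disjE exE conjE)
        fix i assume i: "i < d" "e = q i"
        then show ?thesis using q'[OF i(1)] that(2) unfolding i(2) splice_path[OF i(1)] by auto
      next
        assume 2: "e \<in> Off"
        then have \<sigma>e: "?\<sigma> e = \<tau> e" by (rule splice_Off)
        show ?thesis
        proof (cases "e = g")
          case True
          then show ?thesis unfolding \<sigma>e by (simp add: \<tau>_def)
        next
          case False
          then have \<tau>e: "\<tau> e = insert c (away c e)" by (simp add: \<tau>_def)
          then have "c \<in> e" using that(2) unfolding \<sigma>e by blast
          then have "gate e c = c" using gate_self[OF Off_in[OF 2]] by blast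
          then show ?thesis unfolding \<sigma>e \<tau>e away_def using \<open>c \<in> e\<close> by (simp add: insert_absorb)
        qed
      qed
      show "(\<forall>e\<in>E. ?\<sigma> e = e) \<or> (\<exists>z\<in>V. (\<forall>e\<in>E. z \<in> e \<longrightarrow> z \<in> ?\<sigma> e) \<and> (\<exists>e\<in>E. z \<notin> e \<and> z \<in> ?\<sigma> e))"
        using keep same cV by blast
    qed
    moreover have "card E = 1 + 1 + card T + d" using card_Off card_T Off2 by simp
    moreover have "j + (d - j) = d" using j by simp
    ultimately show ?thesis using pt by (intro exI[of _ ?G] exI[of _ 1] exI[of _ "card T"] exI[of _ j] exI[of _ "d - j"]) auto
  next
    case False
    obtain f w where f: "f \<in> Off" "w \<in> f" "w \<in> U" "w \<noteq> gate f M"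
      and others: "\<And>e z. e \<in> Off \<Longrightarrow> e \<noteq> f \<Longrightarrow> z \<in> e \<Longrightarrow> z \<in> U \<Longrightarrow> z = gate e M"
      by (rule crossing[OF M(1) False], rule that) (assumption | blast)+
    have w_deg: "2 \<le> hdegree G w"
    proof -
      obtain e where "e \<in> set es" "w \<in> e" using f(3) by (auto simp: U_def)
      then show ?thesis using f path_subset Off_in[OF f(1)] Off_notin[OF f(1)] by (intro two_edges_hdegree[of e f]) auto
    qed
    obtain c q' p' j where j: "0 < j" "j < d" and seq: "loose_seq d q' p'" and U': "U = (\<Union>i<d. q' i)"
      and c: "c = p' j" and xc: "x w \<le> x c"
      and q': "\<And>i. i < d \<Longrightarrow> q' i = q i \<or> (\<exists>y\<in>q i. q' i = insert c (q i - {y}) \<and> c \<notin> q i \<and> x y \<le> x c)"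
      by (rule junction[OF f(3) w_deg, of x], rule that) (assumption | blast)+
    have cU: "c \<in> U" using loose_seqD(2)[OF seq j(2)] j(2) unfolding U' c by blast
    then have cV: "c \<in> V" using U_subset by blast
    have cM: "c \<noteq> M" "w \<noteq> M" using cU f(3) False by auto
    have f_U: "z = w" if "z \<in> f" "z \<in> U" for z using gate_Off[OF f(1) that f(3)] gate_Off[OF f(1,2,3,3)] by simp
    \<comment> \<open>Two exchanges in \<open>f\<close>: its gate becomes \<open>M\<close>, giving
      \<open>X\<close>, and then its path vertex \<open>w\<close> becomes the joint
      \<open>c\<close>. The second is a genuine exchange or trivial, since \<open>f\<close> meets
      the path only in \<open>w\<close>.\<close>
    define X where "X = insert M (away M f)"
    define F where "F = insert c (X - {w})"
    define \<tau> where "\<tau> e = (if e = f then F else insert M (away M e))" for e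
    define S where "S = \<tau> ` (Off - {f})"
    have M_away: "M \<notin> away M e" if "e \<in> Off" for e using away_root[OF Off_in[OF that]] .
    have disj: "away M e \<inter> away M e' = {}" if "e \<in> Off" "e' \<in> Off" "e \<noteq> e'" for e e'
      using away_disjoint[OF Off_in[OF that(1)] Off_in[OF that(2)] that(3) M(1)] .
    have wX: "w \<in> X" using f by (auto simp: X_def away_def)
    have cX: "c = w \<or> c \<notin> X" using f_U[of c] cU cM by (auto simp: X_def away_def)
    have finX: "finite X" using Off_sub[OF f(1)] by (simp add: X_def away_def)
    have cardX: "card X = k" unfolding X_def by (rule card_insert_away[OF Off_in[OF f(1)] M(1)])
    have cardF: "card F = k"
      using cX card_exchange[OF finX wX, of c] cardX wX by (auto simp: F_def insert_absorb)
    have F_c: "F - {c} \<subseteq> insert M (away M f - {w})" by (auto simp: F_def X_def)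
    have S_away: "\<exists>e\<in>Off. e \<noteq> f \<and> l = insert M (away M e) \<and> l - {M} = away M e" if lS: "l \<in> S" for l
    proof -
      obtain e where e: "e \<in> Off - {f}" "l = \<tau> e" using lS unfolding S_def by blast
      then have "l = insert M (away M e)" by (simp add: \<tau>_def)
      then show ?thesis using e(1) M_away[of e] by (intro bexI[of _ e]) auto
    qed
    have \<tau>_Off: "\<tau> ` Off = {F} \<union> S" using f(1) by (auto simp: S_def \<tau>_def)
    have away_U: "away M e \<inter> U = {}" if "e \<in> Off" "e \<noteq> f" for e
      using others[OF that] by (auto simp: away_def)
    have "inj_on \<tau> (Off - {f})"
      by (rule inj_onI) (use inj_onD[OF inj_insert_away[OF M(1)]] Off_in in \<open>auto simp: \<tau>_def\<close>)
    then have card_S: "card S = card Off - 1" unfolding S_def using f(1) fin_Off by (simp add: card_image)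
    \<comment> \<open>The detached edge differs from \<open>f\<close>, which meets the path. It
      guarantees at least one leaf at \<open>M\<close>, that is \<open>s \<ge> 1\<close>.\<close>
    have Off2: "2 \<le> card Off"
    proof -
      obtain g where "g \<in> Off" "g \<inter> U = {}" using exists_detached[OF nc] by blast
      then have "g \<noteq> f" using f by auto
      moreover have "card {f, g} \<le> card Off" using f(1) \<open>g \<in> Off\<close> fin_Off by (intro card_mono) auto
      ultimately show ?thesis by simp
    qed
    let ?\<sigma> = "splice q' \<tau>"
    let ?G = "Hypergraph V (?\<sigma> ` E)"
    have "\<exists>h g'. power_tree (T_nodes (card S) (card ({} :: 'a set set)) j (d - j)) CentreT T_par T_depth k ?G h g'"
    proof (rule power_tree_T_assembly[OF k seq _ j c U', where F = F and u = M])
      show "card (q' i) = k" if "i < d" for i using path_step[OF q'[OF that] that, THEN conjunct1] .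
      show "card F = k" by (rule cardF)
      show "c \<in> F" "M \<in> F" "M \<noteq> c" using cM by (auto simp: F_def X_def)
      show "(F - {c}) \<inter> U = {}"
        using F_c f_U False by (auto simp: away_def)
      show "finite S" "finite ({} :: 'a set set)" using fin_Off by (auto simp: S_def)
      show "card l = k \<and> M \<in> l \<and> (l - {M}) \<inter> U = {} \<and> (l - {M}) \<inter> (F - {c}) = {}" if l: "l \<in> S" for l
      proof -
        obtain e where e: "e \<in> Off" "e \<noteq> f" "l = insert M (away M e)" "l - {M} = away M e" using S_away[OF l] by blast
        have "away M e \<inter> (F - {c}) = {}" using F_c disj[OF e(1) f(1) e(2)] M_away[OF e(1)] by blast
        then show ?thesis unfolding e(4) using card_insert_away[OF Off_in[OF e(1)] M(1)] away_U[OF e(1,2)]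
          unfolding e(3) by blast
      qed
      show "(l - {M}) \<inter> (l' - {M}) = {}" if ll: "l \<in> S" "l' \<in> S" "l \<noteq> l'" for l l'
      proof -
        obtain e where e: "e \<in> Off" "l = insert M (away M e)" "l - {M} = away M e" using S_away[OF ll(1)] by blast
        obtain e' where e': "e' \<in> Off" "l' = insert M (away M e')" "l' - {M} = away M e'" using S_away[OF ll(2)] by blast
        have "e \<noteq> e'" using e(2) e'(2) ll(3) by blast
        then show ?thesis unfolding e(3) e'(3) using disj e e' by blast
      qed
      show "edges ?G = q' ` {..<d} \<union> {F} \<union> S \<union> {}" unfolding hypergraph.sel splice_image \<tau>_Off by blast
      show "verts ?G = U \<union> F \<union> \<Union>S \<union> \<Union>{}"
      proof
        show "verts ?G \<subseteq> U \<union> F \<union> \<Union>S \<union> \<Union>{}"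
        proof
          fix z assume "z \<in> verts ?G"
          then have z: "z \<in> V" by simp
          show "z \<in> U \<union> F \<union> \<Union>S \<union> \<Union>{}"
          proof (cases "z \<in> U \<or> z = M")
            case True
            then show ?thesis using cM by (auto simp: F_def X_def)
          next
            case False
            then obtain e where e: "e \<in> Off" "z \<in> away M e" using away_cover_Off[OF M(1) z] by blast
            then have "z \<in> \<tau> e" using False f(3) by (auto simp: \<tau>_def F_def X_def)
            then show ?thesis using e(1) \<tau>_Off by blast
          qed
        qed
        have "\<tau> e \<subseteq> V" if "e \<in> Off" for e
          using Off_sub[OF that] Off_sub[OF f(1)] M(1) cV by (auto simp: \<tau>_def F_def X_def away_def)
        then have "\<Union>(\<tau> ` Off) \<subseteq> V" by blast
        then show "U \<union> F \<union> \<Union>S \<union> \<Union>{} \<subseteq> verts ?G" unfolding \<tau>_Off using U_subset by auto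
      qed
    qed simp_all
    then obtain h g' where pt: "power_tree (T_nodes (card S) 0 j (d - j)) CentreT T_par T_depth k ?G h g'" by auto
    have "alpha_spectral_radius k \<alpha> G < alpha_spectral_radius k \<alpha> ?G \<or> ?G = G"
    proof (rule shift_conclude[OF \<alpha> ev V_ne pt])
      show "card E = 1 + card S + 0 + j + (d - j)" using card_Off card_S Off2 j by simp
      have dom_X: "dominates k x e (insert M (away M e))" if "e \<in> Off" for e
        using away_dominates[where x = x, OF Off_in[OF that] M(1) pos M_max] .
      have X_pos: "0 < x v" if "v \<in> X" for v using that Off_sub[OF f(1)] M(1) pos by (auto simp: X_def away_def)
      have dom_F: "dominates k x f F"
      proof (cases "c = w")
        case True
        then have "F = X" using wX by (auto simp: F_def)
        then show ?thesis using dom_X[OF f(1)] by (simp add: X_def)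
      next
        case False
        then have "dominates k x X F" unfolding F_def using cX finX wX xc X_pos by (intro exchange_dominates) auto
        then show ?thesis using dom_X[OF f(1)] dominates_trans by (auto simp: X_def)
      qed
      show "dominates k x e (?\<sigma> e)" if "e \<in> E" for e
        using E_cases[OF that]
      proof (elim disjE exE conjE)
        fix i assume i: "i < d" "e = q i"
        show ?thesis unfolding i(2) splice_path[OF i(1)] using path_step[OF q'[OF i(1)] i(1), THEN conjunct2] .
      next
        assume that: "e \<in> Off"
        show ?thesis unfolding splice_Off[OF that] \<tau>_def using dom_X[OF that] dom_F by simp
      qed
      show "(\<forall>e\<in>E. ?\<sigma> e = e) \<or> (\<exists>z\<in>V. (\<forall>e\<in>E. z \<in> e \<longrightarrow> z \<in> ?\<sigma> e) \<and> (\<exists>e\<in>E. z \<notin> e \<and> z \<in> ?\<sigma> e))"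
      \<comment> \<open>\<open>M\<close> is on no path edge, so if some edge off the path lacks
        \<open>M\<close>, then \<open>M\<close> only gains edges. Otherwise rerooting at
        \<open>M\<close> changes nothing, and the remaining exchanges all insert \<open>c\<close>,
        which then takes this role.\<close>
      proof (cases "\<forall>e\<in>Off. M \<in> e")
        case noM: False
        have M_path: "M \<notin> q i" if "i < d" for i using False that unfolding U_eq by blast
        have M_Off: "M \<in> ?\<sigma> e" if "e \<in> Off" for e
          unfolding splice_Off[OF that] using cM by (auto simp: \<tau>_def F_def X_def)
        have "\<forall>e\<in>E. M \<in> e \<longrightarrow> M \<in> ?\<sigma> e" using M_path M_Off unfolding E_split by blast
        moreover have "\<exists>e\<in>E. M \<notin> e \<and> M \<in> ?\<sigma> e" using noM M_Off Off_in by blast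
        ultimately show ?thesis using M(1) by blast
      next
        case allM: True
        have away_M: "insert M (away M e) = e" if "e \<in> Off" for e
          using gate_self[OF Off_in[OF that], of M] allM that by (auto simp: away_def)
        then have \<tau>_same: "\<tau> e = e" if "e \<in> Off" "e \<noteq> f" for e using that by (simp add: \<tau>_def)
        have \<tau>_f: "\<tau> f = insert c (f - {w})" using away_M[OF f(1)] by (simp add: \<tau>_def F_def X_def)
        have keep: "c \<in> ?\<sigma> e" if "e \<in> E" "c \<in> e" for e
          using E_cases[OF that(1)]
        proof (elim disjE exE conjE)
          fix i assume i: "i < d" "e = q i"
          then show ?thesis using q'[OF i(1)] that(2) unfolding i(2) splice_path[OF i(1)] by auto
        next
          assume 2: "e \<in> Off"
          then show ?thesis using \<tau>_f \<tau>_same[of e] that(2) unfolding splice_Off[OF 2] by (cases "e = f") auto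
        qed
        have same: "?\<sigma> e = e" if "e \<in> E" "c \<in> ?\<sigma> e \<longrightarrow> c \<in> e" for e
          using E_cases[OF that(1)]
        proof (elim disjE exE conjE)
          fix i assume i: "i < d" "e = q i"
          then show ?thesis using q'[OF i(1)] that(2) unfolding i(2) splice_path[OF i(1)] by auto
        next
          assume 2: "e \<in> Off"
          show ?thesis
          proof (cases "e = f")
            case True
            then have "c \<in> f" using that(2) \<tau>_f splice_Off[OF f(1)] by auto
            then have "c = w" using f_U cU by blast
            then show ?thesis unfolding splice_Off[OF 2] using True \<tau>_f f(2) by auto
          next
            case False
            then show ?thesis unfolding splice_Off[OF 2] using \<tau>_same 2 by blast
          qed
        qed
        show ?thesis using keep same cV by blast
      qed
    qed
    moreover have "card E = 1 + card S + 0 + d" using card_Off card_S Off2 by simp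
    moreover have "j + (d - j) = d" using j by simp
    moreover have "1 \<le> card S" using card_S Off2 by simp
    ultimately show ?thesis using pt
      by (intro exI[of _ ?G] exI[of _ "card S"] exI[of _ 0] exI[of _ j] exI[of _ "d - j"]) auto
  qed
qed

end

text \<open>The equations hold with equality at the radius of the tree. Passing to a larger
  \<open>R\<close> lowers \<open>C\<close> and hence all shares, while the right-hand sides
  grow.\<close>

lemma T_tree_radius_transfer:
  fixes \<alpha> R :: real
  assumes k: "k \<ge> 3" and \<alpha>: "0 \<le> \<alpha>" "\<alpha> < 1"
    and le: "alpha_spectral_radius k \<alpha> (hpower k (T_tree s t a b)) \<le> R"
  defines "C \<equiv> (1 - \<alpha>) ^ k / (R - \<alpha>) ^ (k - 2)"
  shows "\<alpha> < R" and "centre_share \<alpha> C R s t a b \<le> R" and "\<alpha> + real s * arm_share \<alpha> C R 1 < R"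
    and "j < a \<Longrightarrow> \<alpha> + arm_share \<alpha> C R j < R" and "j < b \<Longrightarrow> \<alpha> + arm_share \<alpha> C R j < R"
proof -
  let ?H = "hpower k (T_tree s t a b)" and ?I = "T_nodes s t a b"
  note pt = power_tree_T[OF k, of s t a b]
  interpret P: power_tree ?I CentreT T_par T_depth k ?H Inl
    "\<lambda>i. Inl ` {i, T_par i} \<union> (\<lambda>n. Inr ({i, T_par i}, n)) ` {..<k - 2}" by (rule pt)
  interpret H: uniform_hypergraph k \<alpha> ?H by unfold_locales (use P.uniform_G k \<alpha> in auto)
  define \<mu> where "\<mu> = alpha_spectral_radius k \<alpha> ?H"
  have "verts ?H \<noteq> {}" unfolding P.verts_eq by blast
  then obtain x where ev: "alpha_eigenvector k \<alpha> ?H \<mu> x"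
    using H.alpha_spectral_radius_eigenvector[OF P.linked_G] unfolding \<mu>_def by metis
  define B where "B = (1 - \<alpha>) ^ k / (\<mu> - \<alpha>) ^ (k - 2)"
  note eqs = power_tree_T_equations[OF pt \<alpha> ev, folded B_def]
  have \<mu>R: "\<mu> \<le> R" using le by (simp add: \<mu>_def)
  show "\<alpha> < R" using eqs(1) \<mu>R by simp
  have C0: "0 \<le> C" unfolding C_def using \<alpha> \<open>\<alpha> < R\<close> by simp
  have CB: "C \<le> B" unfolding C_def B_def
    using \<alpha> eqs(1) \<mu>R by (intro divide_left_mono power_mono mult_pos_pos zero_less_power) auto
  have arm: "arm_share \<alpha> C R j \<le> arm_share \<alpha> B \<mu> j" if "\<And>i. i < j \<Longrightarrow> \<alpha> + arm_share \<alpha> B \<mu> i < \<mu>" for j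
    by (rule arm_share_antimono[OF \<mu>R C0 CB that])
  show "centre_share \<alpha> C R s t a b \<le> R"
  proof -
    have "centre_share \<alpha> C R s t a b \<le> centre_share \<alpha> B \<mu> s t a b"
      by (rule centre_share_antimono[OF \<mu>R C0 CB \<alpha>(1) eqs(1) eqs(3)]) (erule eqs(4) eqs(5))+
    then show ?thesis using eqs(2) \<mu>R by linarith
  qed
  have "arm_share \<alpha> C R 1 \<le> arm_share \<alpha> B \<mu> 1" using eqs(1) by (intro arm) simp
  then have "real s * arm_share \<alpha> C R 1 \<le> real s * arm_share \<alpha> B \<mu> 1" by (intro mult_left_mono) auto
  then show "\<alpha> + real s * arm_share \<alpha> C R 1 < R" using eqs(3) \<mu>R by linarith
  show "\<alpha> + arm_share \<alpha> C R j < R" if "j < a"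
  proof -
    have "arm_share \<alpha> C R j \<le> arm_share \<alpha> B \<mu> j" using that by (intro arm eqs(4)) auto
    then show ?thesis using eqs(4)[OF that] \<mu>R by linarith
  qed
  show "\<alpha> + arm_share \<alpha> C R j < R" if "j < b"
  proof -
    have "arm_share \<alpha> C R j \<le> arm_share \<alpha> B \<mu> j" using that by (intro arm eqs(5)) auto
    then show ?thesis using eqs(5)[OF that] \<mu>R by linarith
  qed
qed

text \<open>Evaluating both candidates at the radius of \<open>G\<close> reduces the claim to
  \<open>centre_share_extremal\<close>; isomorphism follows as the parameters determine a power tree
  up to isomorphism.\<close>

lemma T_tree_extremal:
  assumes k: "k \<ge> 3" and \<alpha>: "0 \<le> \<alpha>" "\<alpha> < 1"
    and pt: "power_tree (T_nodes s t a b) CentreT T_par T_depth k G h g"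
    and N: "1 \<le> s" "s + t = N" and d: "a + b = d" "4 \<le> d"
    and H1: "alpha_spectral_radius k \<alpha> (hpower k (T_tree 1 (N - 1) (d div 2) (d - d div 2))) \<le> alpha_spectral_radius k \<alpha> G"
    and H2: "alpha_spectral_radius k \<alpha> (hpower k (T_tree N 0 (d div 2) (d - d div 2))) \<le> alpha_spectral_radius k \<alpha> G"
  shows "G \<cong>\<^sub>h hpower k (T_tree 1 (N - 1) (d div 2) (d - d div 2)) \<or> G \<cong>\<^sub>h hpower k (T_tree N 0 (d div 2) (d - d div 2))"
proof -
  define R where "R = alpha_spectral_radius k \<alpha> G"
  define C where "C = (1 - \<alpha>) ^ k / (R - \<alpha>) ^ (k - 2)"
  interpret P: power_tree "T_nodes s t a b" CentreT T_par T_depth k G h g by fact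
  interpret G: uniform_hypergraph k \<alpha> G by unfold_locales (use P.uniform_G k \<alpha> in auto)
  have "verts G \<noteq> {}" unfolding P.verts_eq by blast
  then obtain x where ev: "alpha_eigenvector k \<alpha> G R x"
    using G.alpha_spectral_radius_eigenvector[OF P.linked_G] unfolding R_def by metis
  note eqs = power_tree_T_equations[OF pt \<alpha> ev, folded C_def]
  note H1' = T_tree_radius_transfer[OF k \<alpha> H1[folded R_def], folded C_def]
  note H2' = T_tree_radius_transfer[OF k \<alpha> H2[folded R_def], folded C_def]
  interpret S: shares \<alpha> C R by unfold_locales (use \<alpha> eqs(1) in \<open>auto simp: C_def\<close>)
  have ext: "(s = 1 \<or> s = N) \<and> (a = d div 2 \<or> b = d div 2)"
    by (rule S.centre_share_extremal[OF N d eqs(2) H1'(2) H2'(2) H2'(3) H1'(5)])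
  obtain h' g' where pt': "power_tree (T_nodes s t (d div 2) (d - d div 2)) CentreT T_par T_depth k G h' g'"
  proof (cases "a = d div 2")
    case True
    then have "b = d - d div 2" using d by simp
    then show thesis using that pt True by blast
  next
    case False
    then have "b = d div 2" "a = d - d div 2" using ext d by auto
    then show thesis using that power_tree_T_swap[OF pt] by blast
  qed
  have "G \<cong>\<^sub>h hpower k (T_tree s t (d div 2) (d - d div 2))"
    using power_tree_hiso[OF pt' power_tree_T[OF k]] .
  moreover have "s = 1 \<and> t = N - 1 \<or> s = N \<and> t = 0" using ext N by auto
  ultimately show ?thesis by auto
qed

text \<open>Isomorphism to one candidate gives equality only if that candidate attains the maximum;
  hence each disjunct carries a comparison of the two radii.\<close>

theorem theorem5p2:
  fixes k m d :: nat and \<alpha> :: real and G :: "'a hypergraph"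
  assumes "k \<ge> 3" and "0 \<le> \<alpha>" and "\<alpha> < 1"
    and "4 \<le> d" and "d + 2 \<le> m"
    and "G \<in> NC k m d"
  shows "alpha_spectral_radius k \<alpha> G
           \<le> max (alpha_spectral_radius k \<alpha> (H1 k m d)) (alpha_spectral_radius k \<alpha> (H2 k m d))
    \<and> (alpha_spectral_radius k \<alpha> G
           = max (alpha_spectral_radius k \<alpha> (H1 k m d)) (alpha_spectral_radius k \<alpha> (H2 k m d))
        \<longleftrightarrow>
          (G \<cong>\<^sub>h H1 k m d \<and>
             alpha_spectral_radius k \<alpha> (H2 k m d) \<le> alpha_spectral_radius k \<alpha> (H1 k m d)) \<or>
          (G \<cong>\<^sub>h H2 k m d \<and>
             alpha_spectral_radius k \<alpha> (H1 k m d) \<le> alpha_spectral_radius k \<alpha> (H2 k m d)))"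
proof -
  let ?r1 = "alpha_spectral_radius k \<alpha> (H1 k m d)" and ?r2 = "alpha_spectral_radius k \<alpha> (H2 k m d)"
  note \<alpha> = assms(2,3)
  have k2: "k \<ge> 2" using assms(1) by simp
  have G: "uniform k G" "supertree G" "\<not> caterpillar G" "card (edges G) = m" "hdiameter G = d"
    using assms(6) by (auto simp: NC_def)
  interpret ST: supertree_hypergraph k G by unfold_locales (use G k2 in auto)
  interpret UH: uniform_hypergraph k \<alpha> G by unfold_locales (use G k2 \<alpha> in auto)
  have "edges G \<noteq> {}" using G(4) assms(5) by auto
  then obtain e where "e \<in> edges G" by blast
  then have V_ne: "verts G \<noteq> {}" using ST.edge_subset[of e] ST.card_edge[of e] k2 by auto
  obtain vs es where path: "hpath G (hd vs) vs es (last vs)" "length es = d"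
    "\<And>u vs' es' v. hpath G u vs' es' v \<Longrightarrow> length es' \<le> d"
    by (rule ST.diameter_path[OF G(5) V_ne], rule that) (assumption | blast)+
  interpret DP: diametral_path k G d vs es by unfold_locales (use path assms(4) in auto)
  obtain x where ev: "alpha_eigenvector k \<alpha> G (alpha_spectral_radius k \<alpha> G) x"
    using UH.alpha_spectral_radius_eigenvector[OF ST.linked_G V_ne] by metis
  obtain G' :: "'a hypergraph" and s t a b h g
    where pt: "power_tree (T_nodes s t a b) CentreT T_par T_depth k G' h g"
      and st: "1 \<le> s" "a + b = d" "card (edges G) = 1 + s + t + d"
      and rel: "alpha_spectral_radius k \<alpha> G < alpha_spectral_radius k \<alpha> G' \<or> G' = G"
    using DP.shift_to_T[OF assms(1) \<alpha> G(3) ev] by (elim exE conjE)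
  have N: "s + t = m - d - 1" using st(3) G(4) by simp
  have H1_eq: "H1 k m d = hpower k (T_tree 1 (m - d - 1 - 1) (d div 2) (d - d div 2))"
    by (simp add: H1_def)
  have H2_eq: "H2 k m d = hpower k (T_tree (m - d - 1) 0 (d div 2) (d - d div 2))"
    by (simp add: H2_def)
  have extremal: "G' \<cong>\<^sub>h H1 k m d \<or> G' \<cong>\<^sub>h H2 k m d"
    if "?r1 \<le> alpha_spectral_radius k \<alpha> G'" "?r2 \<le> alpha_spectral_radius k \<alpha> G'"
    unfolding H1_eq H2_eq
    by (rule T_tree_extremal[OF assms(1) \<alpha> pt st(1) N st(2) assms(4) that[unfolded H1_eq H2_eq]])
  interpret P: power_tree "T_nodes s t a b" CentreT T_par T_depth k G' h g by fact
  have V'_ne: "verts G' \<noteq> {}" unfolding P.verts_eq by blast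
  have T_props: "uniform k (hpower k (T_tree s t a b))" "linked (hpower k (T_tree s t a b))" for s t a b
    using power_tree.uniform_G[OF power_tree_T[OF assms(1)]] power_tree.linked_G[OF power_tree_T[OF assms(1)]] by auto
  have iso_eq: "alpha_spectral_radius k \<alpha> K = alpha_spectral_radius k \<alpha> (hpower k (T_tree s t a b))"
    if "K \<cong>\<^sub>h hpower k (T_tree s t a b)" "uniform k K" "linked K" "verts K \<noteq> {}" for K :: "'a hypergraph" and s t a b
    by (rule alpha_spectral_radius_hiso[OF that(1,2) T_props(1) that(3) T_props(2) that(4) k2 \<alpha>])
  have iso1: "alpha_spectral_radius k \<alpha> K = ?r1" if "K \<cong>\<^sub>h H1 k m d" "uniform k K" "linked K" "verts K \<noteq> {}" for K :: "'a hypergraph"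
    using iso_eq that unfolding H1_eq by blast
  have iso2: "alpha_spectral_radius k \<alpha> K = ?r2" if "K \<cong>\<^sub>h H2 k m d" "uniform k K" "linked K" "verts K \<noteq> {}" for K :: "'a hypergraph"
    using iso_eq that unfolding H2_eq by blast
  \<comment> \<open>A larger radius would satisfy both hypotheses of \<open>extremal\<close>, so
    \<open>G'\<close> would be isomorphic to a candidate whose radius it strictly exceeds.\<close>
  have G'_le: "alpha_spectral_radius k \<alpha> G' \<le> max ?r1 ?r2"
  proof (rule ccontr)
    assume "\<not> ?thesis"
    then have less: "?r1 < alpha_spectral_radius k \<alpha> G'" "?r2 < alpha_spectral_radius k \<alpha> G'" by auto
    then have "G' \<cong>\<^sub>h H1 k m d \<or> G' \<cong>\<^sub>h H2 k m d" by (intro extremal) auto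
    then show False
      using iso1[OF _ P.uniform_G P.linked_G V'_ne] iso2[OF _ P.uniform_G P.linked_G V'_ne] less by auto
  qed
  have le: "alpha_spectral_radius k \<alpha> G \<le> max ?r1 ?r2" using rel G'_le by auto
  moreover have "G \<cong>\<^sub>h H1 k m d \<and> ?r2 \<le> ?r1 \<or> G \<cong>\<^sub>h H2 k m d \<and> ?r1 \<le> ?r2"
    if eq: "alpha_spectral_radius k \<alpha> G = max ?r1 ?r2"
  proof -
    have "G' = G" using rel G'_le eq by auto
    then have "G \<cong>\<^sub>h H1 k m d \<or> G \<cong>\<^sub>h H2 k m d" using extremal eq by simp
    then show ?thesis
      using iso1[OF _ G(1) ST.linked_G V_ne] iso2[OF _ G(1) ST.linked_G V_ne] eq by auto
  qed
  moreover have "alpha_spectral_radius k \<alpha> G = max ?r1 ?r2"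
    if "G \<cong>\<^sub>h H1 k m d \<and> ?r2 \<le> ?r1 \<or> G \<cong>\<^sub>h H2 k m d \<and> ?r1 \<le> ?r2"
    using that iso1[OF _ G(1) ST.linked_G V_ne] iso2[OF _ G(1) ST.linked_G V_ne] by auto
  ultimately show ?thesis by blast
qed

end
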